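(* Let $a,b,c$ be real numbers with $a\ge 0$ and $b\ge |c|$, and let $G$ be the simply-connected three-dimensional Lie group with left-invariant Riemannian metric whose metric Lie algebra $\mathfrak g$ has triple $(a,b,c)$ with respect to a standard orthonormal basis $e_1,e_2,e_3$. Let $S_e\subseteq\mathfrak g$ be the space of values at $e$ of Killing fields parallel at $e$, and $i(G)=\dim S_e$. When $a>0$ and $b>0$ put $K=bc/a^2$; the underlying Lie algebra is then denoted $\mathfrak g(K)$. Then $S_e$ and $i(G)$ are as follows. \begin{enumerate} \item $\mathfrak g(K)$ with $K>1$, triple $(a,b,b)$, $a>0$: $S_e=\operatorname{span}(e_1)$ and $i(G)=1$. \item $\mathfrak g(1)$, triple $(a,b,b)$, $a>0$ (so $b=a$): $S_e=\mathfrak g$ and $i(G)=3$. \item $\mathfrak g(1)$, triple $(a,b,c)$, $a>0$, $b\ne c$ (so $bc=a^2$): $S_e=\operatorname{span}(\alpha_2e_2+\alpha_3e_3)$ and $i(G)=1$, where, with $s=\frac{a^2+b^2}{2b}$ and $D=a^2-s^2$ (which is nonzero), $\alpha_2=\frac{-ab+as}{D}$ and $\alpha_3=\frac{-a^2+bs}{D}$. \item $\mathfrak g(K)$ with $0<K<1$, triple $(a,b,b)$, $a>0$: $S_e=\operatorname{span}(e_1)$ and $i(G)=1$. \item $\mathfrak g(K)$ with $0<K<1$, triple $(a,\,a+a\sqrt{1-K},\,a-a\sqrt{1-K})$, $a>0$: $S_e=\operatorname{span}(e_2-e_3)$ and $i(G)=1$. \item $\mathfrak g(0)$, triple $(a,2a,0)$,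 $a>0$: $S_e=\operatorname{span}(e_2-e_3)$ and $i(G)=1$. \item $\mathfrak g(K)$ with $K<0$, triple $(a,b,-b)$, $a>0$: $S_e=\mathfrak g$ and $i(G)=3$. \item $\mathfrak g(K)$ with $K<0$, triple $(a,\,a+a\sqrt{1-K},\,a-a\sqrt{1-K})$, $a>0$: $S_e=\operatorname{span}(e_2-e_3)$ and $i(G)=1$. \item $\mathfrak g_I$, triple $(a,0,0)$, $a>0$: $S_e=\mathfrak g$ and $i(G)=3$. \item $\mathfrak e(1,1)$, triple $(0,b,b)$, $b>0$: $S_e=\operatorname{span}(e_1)$ and $i(G)=1$. \item Heisenberg algebra, triple $(0,b,0)$, $b>0$: $S_e=\operatorname{span}(e_3)$ and $i(G)=1$. \item $\mathfrak e(2)$, triple $(0,b,-b)$, $b>0$: $S_e=\mathfrak g$ and $i(G)=3$. \item Abelian algebra, triple $(0,0,0)$: $S_e=\mathfrak g$ and $i(G)=3$. \end{enumerate} For every other triple $(a,b,c)$ with $a\ge0$, $b\ge|c|$, one has $i(G)=0$.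
   Context: Triples. For $a\ge 0$, $b\ge|c|$, a metric Lie algebra (a real Lie algebra with an inner product) $\mathfrak g$ of dimension three has triple $(a,b,c)$ with standard basis $e_1,e_2,e_3$ if $e_1,e_2,e_3$ is an orthonormal basis with $[e_1,e_2]=ae_2+be_3$, $[e_1,e_3]=ce_2+ae_3$, $[e_2,e_3]=0$. It is known that every three-dimensional solvable metric Lie algebra has exactly one such triple, and that equivalence classes of such algebras (Lie algebra isomorphisms preserving the inner product) correspond bijectively to triples. Underlying Lie algebras. If $a=0$: the algebra is $\mathfrak e(1,1)$ (Lie algebra of the group of rigid motions of Minkowski 2-space) when $b\ge c>0$; $\mathfrak e(2)$ (Lie algebra of the group of rigid motions of the Euclidean plane) when $c<0$; the Heisenberg algebra when $b>0$, $c=0$; abelian when $b=c=0$. If $a>0$ and $b=c=0$ it is denoted $\mathfrak g_I$. If $a>0$, $b>0$, its isomorphism class depends only on $K=bc/a^2$ and it is denoted $\mathfrak g(K)$. Index of symmetry. Let $G$ be a Lie group with identity $e$, left-invariant metric $g$ and Levi-Civita connection $\nabla$; identify $\mathfrak g$ with $T_eG$. A vector field $X$ on $G$ is parallel at $e$ if $(\nabla_YX)|_e=0$ for every vector field $Y$. $S_e\subseteq\mathfrak g$ is the subspace of all vectors $X|_e$ with $X$ a Killing field for $g$ that is parallel at $e$. The index of symmetry is $i(G)=\dim S_e$. *)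

theory Defs
  imports "HOL-Analysis.Analysis" "HOL-Library.Function_Algebras" "HOL-Algebra.Group"
begin

text \<open>Tangent vectors are operators on functions, so that \<^const>\<open>span\<close> and
  \<^const>\<open>dim\<close> are needed for function spaces.\<close>

instantiation "fun" :: (type, real_vector) real_vector
begin

definition scaleR_fun :: "real \<Rightarrow> ('a \<Rightarrow> 'b) \<Rightarrow> 'a \<Rightarrow> 'b"
  where "scaleR_fun r f = (\<lambda>x. r *\<^sub>R f x)"

instance
  by standard (auto simp: scaleR_fun_def plus_fun_def fun_eq_iff scaleR_add_right scaleR_add_left)

end


section \<open>Smooth manifolds\<close>

text \<open>Both notions are meant for open sets only.\<close>

primrec Ck_on :: "nat \<Rightarrow> 'a::euclidean_space set \<Rightarrow> ('a \<Rightarrow> 'b::real_normed_vector) \<Rightarrow> bool" where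
  "Ck_on 0 S f \<longleftrightarrow> continuous_on S f"
| "Ck_on (Suc k) S f \<longleftrightarrow>
     (\<forall>x\<in>S. f differentiable (at x)) \<and> (\<forall>v. Ck_on k S (\<lambda>x. frechet_derivative f (at x) v))"

definition smooth_on :: "'a::euclidean_space set \<Rightarrow> ('a \<Rightarrow> 'b::real_normed_vector) \<Rightarrow> bool"
  where "smooth_on S f \<longleftrightarrow> (\<forall>k. Ck_on k S f)"

text \<open>A chart is a pair of its domain and its coordinate map; its inverse is
  \<^term>\<open>inv_into U \<phi>\<close>. The manifold is the whole type \<^typ>\<open>'m\<close>, with the topology of that
  type. Atlases are not required to be maximal.\<close>

type_synonym ('m, 'e) atlas = "('m set \<times> ('m \<Rightarrow> 'e)) set"

definition smooth_atlas ::
    "('m::{t2_space,second_countable_topology}, 'e::euclidean_space) atlas \<Rightarrow> bool" where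
  "smooth_atlas A \<longleftrightarrow>
     (\<Union>(U, \<phi>)\<in>A. U) = UNIV \<and>
     (\<forall>(U, \<phi>)\<in>A. open U \<and> open (\<phi> ` U) \<and> homeomorphism U (\<phi> ` U) \<phi> (inv_into U \<phi>)) \<and>
     (\<forall>(U, \<phi>)\<in>A. \<forall>(V, \<psi>)\<in>A. smooth_on (\<phi> ` (U \<inter> V)) (\<psi> \<circ> inv_into U \<phi>))"

definition smooth_map ::
    "('m::topological_space, 'e::euclidean_space) atlas \<Rightarrow>
     ('n::topological_space, 'f::euclidean_space) atlas \<Rightarrow> ('m \<Rightarrow> 'n) \<Rightarrow> bool" where
  "smooth_map A B F \<longleftrightarrow>
     continuous_on UNIV F \<and>
     (\<forall>(U, \<phi>)\<in>A. \<forall>(V, \<psi>)\<in>B. smooth_on (\<phi> ` (U \<inter> F -` V)) (\<psi> \<circ> F \<circ> inv_into U \<phi>))"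

definition prod_atlas :: "('m, 'e) atlas \<Rightarrow> ('n, 'f) atlas \<Rightarrow> ('m \<times> 'n, 'e \<times> 'f) atlas" where
  "prod_atlas A B = {(U \<times> V, map_prod \<phi> \<psi>) |U \<phi> V \<psi>. (U, \<phi>) \<in> A \<and> (V, \<psi>) \<in> B}"

definition smooth_fun_on ::
    "('m::topological_space, 'e::euclidean_space) atlas \<Rightarrow> 'm set \<Rightarrow> ('m \<Rightarrow> real) \<Rightarrow> bool" where
  "smooth_fun_on A S f \<longleftrightarrow> (\<forall>(U, \<phi>)\<in>A. smooth_on (\<phi> ` (U \<inter> S)) (f \<circ> inv_into U \<phi>))"

definition smooth_at ::
    "('m::topological_space, 'e::euclidean_space) atlas \<Rightarrow> 'm \<Rightarrow> ('m \<Rightarrow> real) \<Rightarrow> bool" where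
  "smooth_at A p f \<longleftrightarrow> (\<exists>S. open S \<and> p \<in> S \<and> smooth_fun_on A S f)"


section \<open>Tangent vectors and vector fields\<close>

text \<open>A tangent vector at \<open>p\<close> is a directional derivative operator on functions smooth near \<open>p\<close>.
  It takes the value 0 on all other functions, so that equality of tangent vectors is equality of
  operators.\<close>

type_synonym 'm tangent = "('m \<Rightarrow> real) \<Rightarrow> real"

definition tangent_space ::
    "('m::topological_space, 'e::euclidean_space) atlas \<Rightarrow> 'm \<Rightarrow> 'm tangent set" where
  "tangent_space A p =
     {v. \<exists>U \<phi> w. (U, \<phi>) \<in> A \<and> p \<in> U \<and>
        v = (\<lambda>f. if smooth_at A p f
                 then frechet_derivative (f \<circ> inv_into U \<phi>) (at (\<phi> p)) w else 0)}"

definition vector_fields ::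
    "('m::topological_space, 'e::euclidean_space) atlas \<Rightarrow> ('m \<Rightarrow> 'm tangent) set" where
  "vector_fields A =
     {X. (\<forall>p. X p \<in> tangent_space A p) \<and>
         (\<forall>S f. open S \<longrightarrow> smooth_fun_on A S f \<longrightarrow> smooth_fun_on A S (\<lambda>p. X p f))}"

definition lie_bracket ::
    "('m::topological_space, 'e::euclidean_space) atlas \<Rightarrow>
     ('m \<Rightarrow> 'm tangent) \<Rightarrow> ('m \<Rightarrow> 'm tangent) \<Rightarrow> 'm \<Rightarrow> 'm tangent" where
  "lie_bracket A X Y p =
     (\<lambda>f. if smooth_at A p f then X p (\<lambda>q. Y q f) - Y p (\<lambda>q. X q f) else 0)"

text \<open>The differential of a diffeomorphism \<open>F\<close>. For other maps the convention that tangent vectors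
  vanish on non-smooth functions would not be respected.\<close>

definition pushforward :: "('m \<Rightarrow> 'n) \<Rightarrow> 'm tangent \<Rightarrow> 'n tangent"
  where "pushforward F v = (\<lambda>f. v (f \<circ> F))"


section \<open>Riemannian metrics, Levi-Civita connections, Killing fields\<close>

definition riemannian_metric ::
    "('m::topological_space, 'e::euclidean_space) atlas \<Rightarrow>
     ('m \<Rightarrow> 'm tangent \<Rightarrow> 'm tangent \<Rightarrow> real) \<Rightarrow> bool" where
  "riemannian_metric A g \<longleftrightarrow>
     (\<forall>p. \<forall>u\<in>tangent_space A p. \<forall>v\<in>tangent_space A p.
        g p u v = g p v u \<and>
        (\<forall>w\<in>tangent_space A p. g p (u + v) w = g p u w + g p v w) \<and>
        (\<forall>r. g p (r *\<^sub>R u) v = r * g p u v) \<and>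
        (u \<noteq> 0 \<longrightarrow> g p u u > 0)) \<and>
     (\<forall>X\<in>vector_fields A. \<forall>Y\<in>vector_fields A. smooth_fun_on A UNIV (\<lambda>p. g p (X p) (Y p)))"

definition affine_connection ::
    "('m::topological_space, 'e::euclidean_space) atlas \<Rightarrow>
     (('m \<Rightarrow> 'm tangent) \<Rightarrow> ('m \<Rightarrow> 'm tangent) \<Rightarrow> 'm \<Rightarrow> 'm tangent) \<Rightarrow> bool" where
  "affine_connection A D \<longleftrightarrow>
     (\<forall>X\<in>vector_fields A. \<forall>Y\<in>vector_fields A. D X Y \<in> vector_fields A) \<and>
     (\<forall>X\<in>vector_fields A. \<forall>X'\<in>vector_fields A. \<forall>Y\<in>vector_fields A.
        D (X + X') Y = D X Y + D X' Y) \<and>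
     (\<forall>X\<in>vector_fields A. \<forall>Y\<in>vector_fields A. \<forall>Y'\<in>vector_fields A.
        D X (Y + Y') = D X Y + D X Y') \<and>
     (\<forall>f. \<forall>X\<in>vector_fields A. \<forall>Y\<in>vector_fields A. smooth_fun_on A UNIV f \<longrightarrow>
        D (\<lambda>p. f p *\<^sub>R X p) Y = (\<lambda>p. f p *\<^sub>R D X Y p) \<and>
        D X (\<lambda>p. f p *\<^sub>R Y p) = (\<lambda>p. X p f *\<^sub>R Y p + f p *\<^sub>R D X Y p))"

definition levi_civita_connection ::
    "('m::topological_space, 'e::euclidean_space) atlas \<Rightarrow>
     ('m \<Rightarrow> 'm tangent \<Rightarrow> 'm tangent \<Rightarrow> real) \<Rightarrow>
     (('m \<Rightarrow> 'm tangent) \<Rightarrow> ('m \<Rightarrow> 'm tangent) \<Rightarrow> 'm \<Rightarrow> 'm tangent) \<Rightarrow> bool" where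
  "levi_civita_connection A g D \<longleftrightarrow>
     affine_connection A D \<and>
     (\<forall>X\<in>vector_fields A. \<forall>Y\<in>vector_fields A. D X Y - D Y X = lie_bracket A X Y) \<and>
     (\<forall>X\<in>vector_fields A. \<forall>Y\<in>vector_fields A. \<forall>Z\<in>vector_fields A. \<forall>p.
        X p (\<lambda>q. g q (Y q) (Z q)) = g p (D X Y p) (Z p) + g p (Y p) (D X Z p))"

text \<open>The Killing condition says that the Lie derivative of the metric along \<open>X\<close> vanishes.\<close>

definition killing_field ::
    "('m::topological_space, 'e::euclidean_space) atlas \<Rightarrow>
     ('m \<Rightarrow> 'm tangent \<Rightarrow> 'm tangent \<Rightarrow> real) \<Rightarrow> ('m \<Rightarrow> 'm tangent) \<Rightarrow> bool" where
  "killing_field A g X \<longleftrightarrow>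
     X \<in> vector_fields A \<and>
     (\<forall>Y\<in>vector_fields A. \<forall>Z\<in>vector_fields A. \<forall>p.
        X p (\<lambda>q. g q (Y q) (Z q)) =
          g p (lie_bracket A X Y p) (Z p) + g p (Y p) (lie_bracket A X Z p))"

definition parallel_at ::
    "('m::topological_space, 'e::euclidean_space) atlas \<Rightarrow>
     (('m \<Rightarrow> 'm tangent) \<Rightarrow> ('m \<Rightarrow> 'm tangent) \<Rightarrow> 'm \<Rightarrow> 'm tangent) \<Rightarrow>
     'm \<Rightarrow> ('m \<Rightarrow> 'm tangent) \<Rightarrow> bool" where
  "parallel_at A D p X \<longleftrightarrow> (\<forall>Y\<in>vector_fields A. D Y X p = 0)"

definition symmetry_space ::
    "('m::topological_space, 'e::euclidean_space) atlas \<Rightarrow>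
     ('m \<Rightarrow> 'm tangent \<Rightarrow> 'm tangent \<Rightarrow> real) \<Rightarrow>
     (('m \<Rightarrow> 'm tangent) \<Rightarrow> ('m \<Rightarrow> 'm tangent) \<Rightarrow> 'm \<Rightarrow> 'm tangent) \<Rightarrow>
     'm \<Rightarrow> 'm tangent set" where
  "symmetry_space A g D p = {X p |X. killing_field A g X \<and> parallel_at A D p X}"


section \<open>Lie groups with left-invariant metric\<close>

definition lie_group ::
    "('g::{t2_space,second_countable_topology}, 'e::euclidean_space) atlas \<Rightarrow>
     'g monoid \<Rightarrow> bool" where
  "lie_group A G \<longleftrightarrow>
     smooth_atlas A \<and> group G \<and> carrier G = UNIV \<and>
     smooth_map (prod_atlas A A) A (\<lambda>(x, y). x \<otimes>\<^bsub>G\<^esub> y) \<and>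
     smooth_map A A (\<lambda>x. inv\<^bsub>G\<^esub> x)"

definition left_invariant_metric ::
    "('g::topological_space, 'e::euclidean_space) atlas \<Rightarrow> 'g monoid \<Rightarrow>
     ('g \<Rightarrow> 'g tangent \<Rightarrow> 'g tangent \<Rightarrow> real) \<Rightarrow> bool" where
  "left_invariant_metric A G g \<longleftrightarrow>
     riemannian_metric A g \<and>
     (\<forall>x p. \<forall>u\<in>tangent_space A p. \<forall>v\<in>tangent_space A p.
        g (x \<otimes>\<^bsub>G\<^esub> p) (pushforward (\<lambda>q. x \<otimes>\<^bsub>G\<^esub> q) u) (pushforward (\<lambda>q. x \<otimes>\<^bsub>G\<^esub> q) v) = g p u v)"

text \<open>The Lie algebra is the tangent space at the identity, with the bracket of left-invariant
  vector fields.\<close>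

definition left_invariant_field :: "'g monoid \<Rightarrow> 'g tangent \<Rightarrow> 'g \<Rightarrow> 'g tangent"
  where "left_invariant_field G u p = pushforward (\<lambda>q. p \<otimes>\<^bsub>G\<^esub> q) u"

definition lie_algebra ::
    "('g::topological_space, 'e::euclidean_space) atlas \<Rightarrow> 'g monoid \<Rightarrow> 'g tangent set"
  where "lie_algebra A G = tangent_space A \<one>\<^bsub>G\<^esub>"

definition lie_algebra_bracket ::
    "('g::topological_space, 'e::euclidean_space) atlas \<Rightarrow> 'g monoid \<Rightarrow>
     'g tangent \<Rightarrow> 'g tangent \<Rightarrow> 'g tangent" where
  "lie_algebra_bracket A G u v =
     lie_bracket A (left_invariant_field G u) (left_invariant_field G v) \<one>\<^bsub>G\<^esub>"

definition orthonormal_basis ::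
    "'g tangent set \<Rightarrow> ('g tangent \<Rightarrow> 'g tangent \<Rightarrow> real) \<Rightarrow>
     'g tangent \<Rightarrow> 'g tangent \<Rightarrow> 'g tangent \<Rightarrow> bool" where
  "orthonormal_basis V ip e1 e2 e3 \<longleftrightarrow>
     span {e1, e2, e3} = V \<and>
     ip e1 e1 = 1 \<and> ip e2 e2 = 1 \<and> ip e3 e3 = 1 \<and>
     ip e1 e2 = 0 \<and> ip e1 e3 = 0 \<and> ip e2 e3 = 0"

definition has_triple ::
    "('g::topological_space, 'e::euclidean_space) atlas \<Rightarrow> 'g monoid \<Rightarrow>
     ('g \<Rightarrow> 'g tangent \<Rightarrow> 'g tangent \<Rightarrow> real) \<Rightarrow>
     'g tangent \<Rightarrow> 'g tangent \<Rightarrow> 'g tangent \<Rightarrow> real \<Rightarrow> real \<Rightarrow> real \<Rightarrow> bool" where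
  "has_triple A G g e1 e2 e3 a b c \<longleftrightarrow>
     a \<ge> 0 \<and> b \<ge> \<bar>c\<bar> \<and>
     orthonormal_basis (lie_algebra A G) (g \<one>\<^bsub>G\<^esub>) e1 e2 e3 \<and>
     lie_algebra_bracket A G e1 e2 = a *\<^sub>R e2 + b *\<^sub>R e3 \<and>
     lie_algebra_bracket A G e1 e3 = c *\<^sub>R e2 + a *\<^sub>R e3 \<and>
     lie_algebra_bracket A G e2 e3 = 0"

end

theory Submission
  imports Defs
begin

text \<open>In an orthonormal left-invariant frame the Killing equations are a linear first-order system
  for the coefficients of a vector field. Its integrability conditions say that the Lie derivative
  of the Ricci tensor vanishes; for a field parallel at the identity they confine its value there
  to a subspace determined by the triple. Conversely, right-invariant fields are Killing, and the
  further Killing fields that are needed (on hyperbolic space, on the product of a hyperbolic plane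
  and a line, and on the metrics with a four-dimensional isometry group) have coefficients that are
  rational in the matrix entries of the adjoint representation. These entries are globally defined
  and satisfy the required differential equations, so no coordinates on the group are needed.\<close>

section \<open>Calculus of smooth maps between Euclidean spaces\<close>

text \<open>The thirteen cases collapse to four degenerate loci. Let M be the matrix of ad e_1 on
  the plane of e_2 and e_3, with diagonal a, a and off-diagonal entries b, c. Away from b + c = 0
  the conditions on a value (X, Y, Z) say (b - c) X = 0 together with a linear system for (Y, Z) of
  determinant (4 a^2 - (b + c)^2) (a^2 - b c). A nonzero value therefore forces b + c = 0 (M is a
  scalar plus a skew part), b = c (M symmetric), b + c = 2 a (the symmetric part of M is singular)
  or b c = a^2 (M singular). On the second and third locus a right-invariant field is already
  parallel at the identity. On the last one the kernel of M is central, and rotating the frame onto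
  it exhibits the group over a surface whose rotations can be lifted. On the first the curvature is
  constant, and for a > 0 the invariant fields do not suffice.

  The connection is given axiomatically and acts on global fields. The left-invariant frame is
  global, so values at a point are computed by expanding fields in the frame, without cutting off
  local fields.\<close>

lemma Ck_on_subset: "Ck_on k S f \<Longrightarrow> T \<subseteq> S \<Longrightarrow> Ck_on k T f"
  by (induction k arbitrary: f) (auto intro: continuous_on_subset)

lemma Ck_on_differentiable: "Ck_on (Suc k) S f \<Longrightarrow> x \<in> S \<Longrightarrow> f differentiable (at x)"
  by simp

lemma Ck_on_cong:
  assumes "open S" "\<And>x. x \<in> S \<Longrightarrow> f x = g x" "Ck_on k S f"
  shows "Ck_on k S g"
  using assms(2,3)
proof (induction k arbitrary: f g)
  case 0
  then show ?case by (metis Ck_on.simps(1) continuous_on_cong)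
next
  case (Suc k)
  have "g differentiable (at x)" if "x \<in> S" for x
    using Suc.prems that assms(1)
    by (meson Ck_on_differentiable differentiable_def has_derivative_transform_within_open)
  moreover have "Ck_on k S (\<lambda>x. frechet_derivative g (at x) v)" for v
  proof (rule Suc.IH)
    show "Ck_on k S (\<lambda>x. frechet_derivative f (at x) v)" using Suc.prems by simp
    show "frechet_derivative f (at x) v = frechet_derivative g (at x) v" if "x \<in> S" for x
      using frechet_derivative_transform_within_open[of f x S g] Suc.prems that assms(1) by auto
  qed
  ultimately show ?case by simp
qed

lemma Ck_on_local:
  assumes "\<And>x. x \<in> S \<Longrightarrow> \<exists>T. open T \<and> x \<in> T \<and> Ck_on k T f"
  shows "Ck_on k S f"
  using assms
proof (induction k arbitrary: f)
  case 0
  have "isCont f x" if x: "x \<in> S" for x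
  proof -
    obtain T where "open T" "x \<in> T" "Ck_on 0 T f" using 0[OF x] by blast
    then show ?thesis by (simp add: continuous_on_eq_continuous_at)
  qed
  then show ?case by (simp add: continuous_at_imp_continuous_on)
next
  case (Suc k)
  then show ?case by (simp del: split_paired_Ex) (meson)
qed

lemma Ck_on_Suc_imp: "Ck_on (Suc k) S f \<Longrightarrow> Ck_on k S f"
proof (induction k arbitrary: f)
  case 0
  then show ?case
    by (simp add: continuous_on_eq_continuous_within)
      (meson continuous_at_imp_continuous_at_within differentiable_imp_continuous_within)
next
  case (Suc k)
  from Suc.prems have "\<forall>x\<in>S. f differentiable (at x)"
    and "\<And>v. Ck_on (Suc k) S (\<lambda>x. frechet_derivative f (at x) v)"
    by simp_all
  then have "\<And>v. Ck_on k S (\<lambda>x. frechet_derivative f (at x) v)"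
    by (intro Suc.IH)
  with \<open>\<forall>x\<in>S. f differentiable (at x)\<close> show ?case by simp
qed

text \<open>\<open>Ck_on\<close> speaks of \<open>frechet_derivative\<close>, which is awkward to
  rewrite; on an open set any explicit derivative may be supplied instead. Closure under sums,
  products, composition and inverses goes through this rule.\<close>

lemma Ck_on_SucI:
  assumes "open S" "\<And>x. x \<in> S \<Longrightarrow> (f has_derivative f' x) (at x)"
    and "\<And>v. Ck_on k S (\<lambda>x. f' x v)"
  shows "Ck_on (Suc k) S f"
proof -
  have "Ck_on k S (\<lambda>x. frechet_derivative f (at x) v)" for v
  proof (rule Ck_on_cong[OF assms(1) _ assms(3)])
    show "f' x v = frechet_derivative f (at x) v" if "x \<in> S" for x
      using frechet_derivative_at[OF assms(2)[OF that]] by simp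
  qed
  with assms(2) show ?thesis by (auto simp: differentiable_def)
qed

lemma Ck_on_const: "Ck_on k S (\<lambda>x. c)"
  by (induction k arbitrary: c) auto

lemma Ck_on_add:
  assumes "open S" "Ck_on k S f" "Ck_on k S g"
  shows "Ck_on k S (\<lambda>x. f x + g x)"
  using assms(2,3)
proof (induction k arbitrary: f g)
  case 0
  then show ?case by (simp add: continuous_on_add)
next
  case (Suc k)
  show ?case
  proof (rule Ck_on_SucI[OF assms(1)])
    show "((\<lambda>x. f x + g x) has_derivative
        (\<lambda>v. frechet_derivative f (at x) v + frechet_derivative g (at x) v)) (at x)" if "x \<in> S" for x
      using Suc.prems that by (intro has_derivative_add) (auto simp: frechet_derivative_works[symmetric])
    show "Ck_on k S (\<lambda>x. frechet_derivative f (at x) v + frechet_derivative g (at x) v)" for v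
      using Suc.prems by (intro Suc.IH) auto
  qed
qed

lemma Ck_on_bounded_linear:
  assumes "bounded_linear h" "open S" "Ck_on k S f"
  shows "Ck_on k S (\<lambda>x. h (f x))"
  using assms(3)
proof (induction k arbitrary: f)
  case 0
  then show ?case by (simp add: bounded_linear.continuous_on[OF assms(1)])
next
  case (Suc k)
  show ?case
  proof (rule Ck_on_SucI[OF assms(2)])
    show "((\<lambda>x. h (f x)) has_derivative (\<lambda>v. h (frechet_derivative f (at x) v))) (at x)"
      if "x \<in> S" for x
      using Suc.prems that
      by (intro bounded_linear.has_derivative[OF assms(1)]) (auto simp: frechet_derivative_works[symmetric])
    show "Ck_on k S (\<lambda>x. h (frechet_derivative f (at x) v))" for v
      using Suc.prems by (intro Suc.IH) auto
  qed
qed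

lemma Ck_on_id: "open S \<Longrightarrow> Ck_on k S (\<lambda>x. x)"
proof (cases k)
  case (Suc j)
  assume "open S"
  then show ?thesis unfolding Suc
    by (intro Ck_on_SucI[where f' = "\<lambda>x v. v"]) (auto intro: Ck_on_const)
qed simp

lemma Ck_on_linear: "bounded_linear h \<Longrightarrow> open S \<Longrightarrow> Ck_on k S h"
  using Ck_on_bounded_linear[OF _ _ Ck_on_id] by blast

text \<open>The product rule yields bilinear terms again, with one factor differentiated and the
  other merely demoted from order \<open>Suc k\<close> to \<open>k\<close>; hence the induction
  generalises over both factors.\<close>

lemma Ck_on_bilinear:
  assumes "bounded_bilinear B" "open S" "Ck_on k S f" "Ck_on k S g"
  shows "Ck_on k S (\<lambda>x. B (f x) (g x))"
  using assms(3,4)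
proof (induction k arbitrary: f g)
  case 0
  then show ?case by (simp add: bounded_bilinear.continuous_on[OF assms(1)])
next
  case (Suc k)
  show ?case
  proof (rule Ck_on_SucI[OF assms(2)])
    show "((\<lambda>x. B (f x) (g x)) has_derivative
        (\<lambda>v. B (f x) (frechet_derivative g (at x) v) + B (frechet_derivative f (at x) v) (g x))) (at x)"
      if "x \<in> S" for x
      using Suc.prems that
      by (intro bounded_bilinear.FDERIV[OF assms(1)]) (auto simp: frechet_derivative_works[symmetric])
    show "Ck_on k S (\<lambda>x. B (f x) (frechet_derivative g (at x) v)
        + B (frechet_derivative f (at x) v) (g x))" for v
      using Suc.prems by (intro Ck_on_add[OF assms(2)] Suc.IH Ck_on_Suc_imp[of k S f] Ck_on_Suc_imp[of k S g]) auto
  qed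
qed

lemmas Ck_on_mult = Ck_on_bilinear[OF bounded_bilinear_mult]
lemmas Ck_on_scaleR = Ck_on_bilinear[OF bounded_bilinear_scaleR]

lemma Ck_on_sum:
  "open S \<Longrightarrow> (\<And>i. i \<in> I \<Longrightarrow> Ck_on k S (f i)) \<Longrightarrow> Ck_on k S (\<lambda>x. \<Sum>i\<in>I. f i x)"
  by (induction I rule: infinite_finite_induct) (auto intro: Ck_on_add Ck_on_const)

lemma frechet_derivative_basis:
  fixes g :: "'a::euclidean_space \<Rightarrow> 'b::real_normed_vector"
  assumes "g differentiable (at y)"
  shows "frechet_derivative g (at y) v = (\<Sum>i\<in>Basis. (v \<bullet> i) *\<^sub>R frechet_derivative g (at y) i)"
proof -
  have lin: "linear (frechet_derivative g (at y))"
    using assms by (rule linear_frechet_derivative)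
  have "frechet_derivative g (at y) v = frechet_derivative g (at y) (\<Sum>i\<in>Basis. (v \<bullet> i) *\<^sub>R i)"
    by (simp add: euclidean_representation)
  then show ?thesis by (simp add: linear_sum[OF lin] linear_scale[OF lin])
qed

text \<open>Order \<open>Suc k\<close> controls the derivative of \<open>g\<close> in fixed
  directions, whereas the chain rule evaluates it in the varying direction given by the derivative
  of \<open>f\<close>. Expanding that direction in the basis leaves fixed directions, to which the
  induction hypothesis applies.\<close>

lemma Ck_on_compose:
  fixes f :: "'a::euclidean_space \<Rightarrow> 'b::euclidean_space" and g :: "'b \<Rightarrow> 'c::real_normed_vector"
  assumes "open S" "f ` S \<subseteq> T" "Ck_on k S f" "Ck_on k T g"
  shows "Ck_on k S (\<lambda>x. g (f x))"
  using assms(3,4)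
proof (induction k arbitrary: g)
  case 0
  then show ?case using assms(2) by (auto intro: continuous_on_compose2)
next
  case (Suc k)
  show ?case
  proof (rule Ck_on_SucI[OF assms(1)])
    show "((\<lambda>x. g (f x)) has_derivative
        (\<lambda>v. \<Sum>i\<in>Basis. (frechet_derivative f (at x) v \<bullet> i) *\<^sub>R frechet_derivative g (at (f x)) i)) (at x)"
      if "x \<in> S" for x
    proof -
      have g: "g differentiable (at (f x))" and f: "f differentiable (at x)"
        using Suc.prems assms(2) that by auto
      have "((g \<circ> f) has_derivative (frechet_derivative g (at (f x)) \<circ> frechet_derivative f (at x))) (at x)"
        using f g by (intro diff_chain_at) (auto simp: frechet_derivative_works[symmetric])
      then show ?thesis
        by (simp add: o_def frechet_derivative_basis[OF g, symmetric])
    qed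
    show "Ck_on k S (\<lambda>x. \<Sum>i\<in>Basis. (frechet_derivative f (at x) v \<bullet> i) *\<^sub>R frechet_derivative g (at (f x)) i)" for v
    proof (intro Ck_on_sum Ck_on_scaleR assms(1) Ck_on_bounded_linear[OF bounded_linear_inner_left])
      show "Ck_on k S (\<lambda>x. frechet_derivative f (at x) v)" using Suc.prems by simp
      show "Ck_on k S (\<lambda>x. frechet_derivative g (at (f x)) i)" for i
        using Suc.prems(2) by (intro Suc.IH Ck_on_Suc_imp[OF Suc.prems(1)]) simp
    qed
  qed
qed

text \<open>The derivative of the reciprocal is a product containing the reciprocal itself, which is
  covered by the induction hypothesis one order lower.\<close>

lemma Ck_on_inverse:
  fixes f :: "'a::euclidean_space \<Rightarrow> real"
  assumes "open S" "\<And>x. x \<in> S \<Longrightarrow> f x \<noteq> 0" "Ck_on k S f"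
  shows "Ck_on k S (\<lambda>x. inverse (f x))"
  using assms(3)
proof (induction k)
  case 0
  then show ?case using assms(2) by (auto intro: continuous_on_inverse)
next
  case (Suc k)
  have f: "Ck_on k S (\<lambda>x. inverse (f x))" using Suc Ck_on_Suc_imp by blast
  show ?case
  proof (rule Ck_on_SucI[OF assms(1)])
    show "((\<lambda>x. inverse (f x)) has_derivative
        (\<lambda>v. - 1 * (inverse (f x) * frechet_derivative f (at x) v * inverse (f x)))) (at x)" if "x \<in> S" for x
      using Suc.prems that assms(2)
      by (auto intro!: derivative_eq_intros simp: frechet_derivative_works[symmetric])
    show "Ck_on k S (\<lambda>x. - 1 * (inverse (f x) * frechet_derivative f (at x) v * inverse (f x)))" for v
      using Suc.prems by (intro Ck_on_mult Ck_on_const assms(1) f) auto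
  qed
qed

section \<open>Smoothness of all orders, inherited from the finite orders\<close>

lemma smooth_on_subset: "smooth_on S f \<Longrightarrow> T \<subseteq> S \<Longrightarrow> smooth_on T f"
  unfolding smooth_on_def by (blast intro: Ck_on_subset)

lemma smooth_on_cong:
  "open S \<Longrightarrow> (\<And>x. x \<in> S \<Longrightarrow> f x = g x) \<Longrightarrow> smooth_on S f \<Longrightarrow> smooth_on S g"
  unfolding smooth_on_def by (blast intro: Ck_on_cong)

lemma smooth_on_local:
  "(\<And>x. x \<in> S \<Longrightarrow> \<exists>T. open T \<and> x \<in> T \<and> smooth_on T f) \<Longrightarrow> smooth_on S f"
  unfolding smooth_on_def by (intro allI Ck_on_local) meson

lemma smooth_on_const: "smooth_on S (\<lambda>x. c)"
  and smooth_on_id: "open S \<Longrightarrow> smooth_on S (\<lambda>x. x)"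
  and smooth_on_linear: "bounded_linear h \<Longrightarrow> open S \<Longrightarrow> smooth_on S h"
  and smooth_on_add: "open S \<Longrightarrow> smooth_on S f \<Longrightarrow> smooth_on S g \<Longrightarrow> smooth_on S (\<lambda>x. f x + g x)"
  and smooth_on_bounded_linear:
    "bounded_linear k \<Longrightarrow> open S \<Longrightarrow> smooth_on S f \<Longrightarrow> smooth_on S (\<lambda>x. k (f x))"
  unfolding smooth_on_def
  by (simp_all add: Ck_on_const Ck_on_id Ck_on_linear Ck_on_add Ck_on_bounded_linear)

lemma smooth_on_mult:
  fixes f g :: "'a::euclidean_space \<Rightarrow> real"
  shows "open S \<Longrightarrow> smooth_on S f \<Longrightarrow> smooth_on S g \<Longrightarrow> smooth_on S (\<lambda>x. f x * g x)"
  unfolding smooth_on_def by (simp add: Ck_on_mult)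

lemma smooth_on_inverse:
  fixes f :: "'a::euclidean_space \<Rightarrow> real"
  shows "open S \<Longrightarrow> (\<And>x. x \<in> S \<Longrightarrow> f x \<noteq> 0) \<Longrightarrow> smooth_on S f \<Longrightarrow> smooth_on S (\<lambda>x. inverse (f x))"
  unfolding smooth_on_def by (simp add: Ck_on_inverse)

lemma smooth_on_compose:
  fixes f :: "'a::euclidean_space \<Rightarrow> 'b::euclidean_space" and g :: "'b \<Rightarrow> 'c::real_normed_vector"
  shows "open S \<Longrightarrow> f ` S \<subseteq> T \<Longrightarrow> smooth_on S f \<Longrightarrow> smooth_on T g \<Longrightarrow> smooth_on S (\<lambda>x. g (f x))"
  unfolding smooth_on_def by (simp add: Ck_on_compose)

lemma smooth_on_differentiable: "smooth_on S f \<Longrightarrow> x \<in> S \<Longrightarrow> f differentiable (at x)"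
  unfolding smooth_on_def using Ck_on_differentiable[of 0 S f x] by blast

lemma smooth_on_frechet_derivative:
  "smooth_on S f \<Longrightarrow> smooth_on S (\<lambda>x. frechet_derivative f (at x) v)"
proof (unfold smooth_on_def, rule allI)
  fix k assume "\<forall>k. Ck_on k S f"
  then have "Ck_on (Suc k) S f" by blast
  then show "Ck_on k S (\<lambda>x. frechet_derivative f (at x) v)" by simp
qed

lemma smooth_on_Pair:
  fixes f :: "'a::euclidean_space \<Rightarrow> 'b::euclidean_space" and g :: "'a \<Rightarrow> 'c::euclidean_space"
  assumes "open S" "smooth_on S f" "smooth_on S g"
  shows "smooth_on S (\<lambda>x. (f x, g x))"
proof -
  have "smooth_on S (\<lambda>x. (f x, 0) + (0, g x))"
    using assms by (intro smooth_on_add smooth_on_bounded_linear[of "\<lambda>y. (y, 0)"]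
        smooth_on_bounded_linear[of "\<lambda>y. (0, y)"] bounded_linear_Pair bounded_linear_ident bounded_linear_zero)
  then show ?thesis by simp
qed

lemma open_slice:
  "open N \<Longrightarrow> open {y. (y, z) \<in> N}" "open N \<Longrightarrow> open {z. (y, z) \<in> N}"
  using open_vimage[of N "\<lambda>y. (y, z)"] open_vimage[of N "\<lambda>z. (y, z)"]
  by (simp_all add: vimage_def continuous_intros)

text \<open>Schwarz's theorem. The second difference quotient is written by the mean value theorem,
  applied once in each direction, as a value of either of the two mixed derivatives.\<close>

lemma second_difference_mean_value:
  fixes f :: "'a::euclidean_space \<Rightarrow> real"
  assumes f: "smooth_on (ball x d) f" and h: "h > 0" and uv: "h * norm u + h * norm v < d"
  shows "\<exists>y. norm (y - x) \<le> h * norm u + h * norm v \<and>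
    f (x + h *\<^sub>R u + h *\<^sub>R v) - f (x + h *\<^sub>R u) - f (x + h *\<^sub>R v) + f x =
      h * h * frechet_derivative (\<lambda>z. frechet_derivative f (at z) u) (at y) v"
proof -
  let ?D = "\<lambda>z. frechet_derivative f (at z) u"
  have D: "smooth_on (ball x d) ?D"
    using f by (rule smooth_on_frechet_derivative)
  have bnd: "norm (s *\<^sub>R u + t *\<^sub>R v) \<le> h * norm u + h * norm v"
    if "0 \<le> s" "s \<le> h" "0 \<le> t" "t \<le> h" for s t
    using that by (intro order.trans[OF norm_triangle_ineq] add_mono) (auto intro: mult_right_mono)
  have ball: "x + s *\<^sub>R u + t *\<^sub>R v \<in> ball x d" if "0 \<le> s" "s \<le> h" "0 \<le> t" "t \<le> h" for s t
  proof -
    have "dist x (x + s *\<^sub>R u + t *\<^sub>R v) = norm (s *\<^sub>R u + t *\<^sub>R v)"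
      by (metis add.assoc add_diff_cancel_left' dist_commute dist_norm)
    then show ?thesis using bnd[OF that] uv by simp
  qed
  have der: "((\<lambda>s. g (p + s *\<^sub>R w)) has_real_derivative frechet_derivative g (at (p + s *\<^sub>R w)) w) (at s)"
    if "g differentiable (at (p + s *\<^sub>R w))" for g :: "'a \<Rightarrow> real" and p w s
  proof -
    have "(g has_derivative frechet_derivative g (at (p + s *\<^sub>R w))) (at (p + s *\<^sub>R w))"
      using that by (simp add: frechet_derivative_works[symmetric])
    moreover have "((\<lambda>s. p + s *\<^sub>R w) has_derivative (\<lambda>h. h *\<^sub>R w)) (at s)"
      by (auto intro!: derivative_eq_intros)
    ultimately have "((g \<circ> (\<lambda>s. p + s *\<^sub>R w)) has_derivative
        (frechet_derivative g (at (p + s *\<^sub>R w)) \<circ> (\<lambda>h. h *\<^sub>R w))) (at s)"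
      by (rule diff_chain_at[rotated])
    then show ?thesis
      using linear_scale[OF linear_frechet_derivative[OF that]]
      by (simp add: has_field_derivative_def o_def mult.commute fun_eq_iff mult_commute_abs)
  qed
  let ?G = "\<lambda>s. f ((x + h *\<^sub>R v) + s *\<^sub>R u) - f (x + s *\<^sub>R u)"
  have "\<exists>s>0. s < h \<and> ?G h - ?G 0 = (h - 0) * (?D ((x + h *\<^sub>R v) + s *\<^sub>R u) - ?D (x + s *\<^sub>R u))"
  proof (rule MVT2[OF h])
    fix s assume s: "0 \<le> s" "s \<le> h"
    have "f differentiable (at ((x + h *\<^sub>R v) + s *\<^sub>R u))" "f differentiable (at (x + s *\<^sub>R u))"
      using ball[OF s, of h] ball[OF s, of 0] h smooth_on_differentiable[OF f] by (auto simp: ac_simps)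
    then show "(?G has_real_derivative ?D ((x + h *\<^sub>R v) + s *\<^sub>R u) - ?D (x + s *\<^sub>R u)) (at s)"
      by (intro DERIV_diff der)
  qed
  then obtain s where s: "0 < s" "s < h"
    and 1: "?G h - ?G 0 = h * (?D ((x + h *\<^sub>R v) + s *\<^sub>R u) - ?D (x + s *\<^sub>R u))" by auto
  let ?K = "\<lambda>t. ?D ((x + s *\<^sub>R u) + t *\<^sub>R v)"
  have "\<exists>t>0. t < h \<and> ?K h - ?K 0 = (h - 0) * frechet_derivative ?D (at ((x + s *\<^sub>R u) + t *\<^sub>R v)) v"
  proof (rule MVT2[OF h])
    fix t assume "0 \<le> t" "t \<le> h"
    then show "(?K has_real_derivative frechet_derivative ?D (at ((x + s *\<^sub>R u) + t *\<^sub>R v)) v) (at t)"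
      using ball[of s t] s smooth_on_differentiable[OF D] by (intro der) auto
  qed
  then obtain t where t: "0 < t" "t < h"
    and 2: "?K h - ?K 0 = h * frechet_derivative ?D (at ((x + s *\<^sub>R u) + t *\<^sub>R v)) v" by auto
  have "norm ((x + s *\<^sub>R u + t *\<^sub>R v) - x) \<le> h * norm u + h * norm v"
    using bnd[of s t] s t by (simp add: add.assoc)
  then show ?thesis
    using 1 2 by (intro exI[of _ "x + s *\<^sub>R u + t *\<^sub>R v"]) (simp add: algebra_simps)
qed

lemma frechet_derivative_commute:
  fixes f :: "'a::euclidean_space \<Rightarrow> real"
  assumes S: "open S" "x \<in> S" and f: "smooth_on S f"
  shows "frechet_derivative (\<lambda>z. frechet_derivative f (at z) u) (at x) v =
    frechet_derivative (\<lambda>z. frechet_derivative f (at z) v) (at x) u"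
proof -
  obtain d where d: "d > 0" "ball x d \<subseteq> S" using S openE by blast
  have fd: "smooth_on (ball x d) f" using f d(2) by (rule smooth_on_subset)
  \<comment> \<open>The summand 1 keeps \<open>M\<close> positive when both directions vanish and
    makes the bound \<open>hM\<close> strict.\<close>
  define M where "M = norm u + norm v + 1"
  have M: "M > 0" unfolding M_def by (simp add: add_nonneg_pos)
  define h where "h n = d / (M * real (Suc n + 1))" for n
  have h: "h n > 0" for n unfolding h_def using d M by simp
  have hM: "h n * norm u + h n * norm v < d / real (Suc n)" for n
  proof -
    have "h n * norm u + h n * norm v < h n * M"
      using h[of n] by (simp add: M_def algebra_simps)
    also have "\<dots> = d / real (Suc n + 1)" using M by (simp add: h_def)
    also have "\<dots> \<le> d / real (Suc n)" using d by (intro divide_left_mono) auto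
    finally show ?thesis .
  qed
  have hd: "h n * norm u + h n * norm v < d" for n
    by (rule order.strict_trans2[OF hM]) (use d(1) in \<open>simp add: field_simps\<close>)
  \<comment> \<open>The quotient is symmetric in \<open>u\<close> and \<open>v\<close>, so this one
    sequence converges to both mixed derivatives.\<close>
  define Q where "Q n = (f (x + h n *\<^sub>R u + h n *\<^sub>R v) - f (x + h n *\<^sub>R u) - f (x + h n *\<^sub>R v) + f x) / (h n * h n)" for n
  have lim: "Q \<longlonglongrightarrow> frechet_derivative (\<lambda>z. frechet_derivative f (at z) a) (at x) b"
    if "\<And>n. \<exists>y. norm (y - x) \<le> h n * norm u + h n * norm v \<and>
      Q n = frechet_derivative (\<lambda>z. frechet_derivative f (at z) a) (at y) b" for a b
  proof -
    from that have "\<forall>n. \<exists>y. norm (y - x) \<le> h n * norm u + h n * norm v \<and>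
      Q n = frechet_derivative (\<lambda>z. frechet_derivative f (at z) a) (at y) b" ..
    from choice[OF this] obtain y where y: "\<And>n. norm (y n - x) \<le> h n * norm u + h n * norm v"
      and Q: "\<And>n. Q n = frechet_derivative (\<lambda>z. frechet_derivative f (at z) a) (at (y n)) b"
      by blast
    have "(\<lambda>n. d * inverse (real (Suc n))) \<longlonglongrightarrow> d * 0"
      by (intro tendsto_mult tendsto_const LIMSEQ_inverse_real_of_nat)
    then have "(\<lambda>n. y n - x) \<longlonglongrightarrow> 0"
      using order.trans[OF y less_imp_le[OF hM]]
      by (intro Lim_null_comparison[of "\<lambda>n. y n - x" _ sequentially] always_eventually)
        (simp_all add: divide_inverse)
    then have lim: "y \<longlonglongrightarrow> x" by (simp add: LIM_zero_iff)
    have "smooth_on S (\<lambda>z. frechet_derivative (\<lambda>z. frechet_derivative f (at z) a) (at z) b)"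
      using f by (intro smooth_on_frechet_derivative)
    then have "isCont (\<lambda>z. frechet_derivative (\<lambda>z. frechet_derivative f (at z) a) (at z) b) x"
      using S(2) by (intro differentiable_imp_continuous_within smooth_on_differentiable)
    then show ?thesis
      unfolding Q[abs_def] using lim by (rule isCont_tendsto_compose)
  qed
  have "\<exists>y. norm (y - x) \<le> h n * norm u + h n * norm v \<and>
      Q n = frechet_derivative (\<lambda>z. frechet_derivative f (at z) u) (at y) v" for n
    using second_difference_mean_value[OF fd h hd] h[of n] by (force simp: Q_def)
  moreover have "\<exists>y. norm (y - x) \<le> h n * norm u + h n * norm v \<and>
      Q n = frechet_derivative (\<lambda>z. frechet_derivative f (at z) v) (at y) u" for n
    using second_difference_mean_value[OF fd h, of n v u] hd[of n] h[of n]
    by (force simp: Q_def algebra_simps)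
  ultimately show ?thesis by (intro LIMSEQ_unique[OF lim lim])
qed

section \<open>Tangent vectors as derivations\<close>

text \<open>The element of \<open>tangent_space\<close> given by a chart and a coordinate vector,
  isolated so that linearity in \<open>w\<close> and the change of chart can be stated.\<close>

definition tangent_vec ::
    "('m::topological_space, 'e::euclidean_space) atlas \<Rightarrow> 'm set \<Rightarrow> ('m \<Rightarrow> 'e) \<Rightarrow> 'm \<Rightarrow> 'e \<Rightarrow> 'm tangent"
  where "tangent_vec A U \<phi> p w =
    (\<lambda>f. if smooth_at A p f then frechet_derivative (f \<circ> inv_into U \<phi>) (at (\<phi> p)) w else 0)"

section \<open>Smooth germs, tangent spaces and vector fields in charts\<close>

locale smooth_manifold =
  fixes A :: "('m::{t2_space,second_countable_topology}, 'e::euclidean_space) atlas"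
  assumes smooth_atlas: "smooth_atlas A"
begin

lemma chart_ex: "\<exists>U \<phi>. (U, \<phi>) \<in> A \<and> p \<in> U"
proof -
  have "p \<in> (\<Union>(U, \<phi>)\<in>A. U)" using smooth_atlas by (simp add: smooth_atlas_def)
  then show ?thesis by auto
qed

lemma chart:
  assumes "(U, \<phi>) \<in> A"
  shows chart_open: "open U"
    and chart_open_image: "open (\<phi> ` U)"
    and chart_continuous: "continuous_on U \<phi>"
    and chart_inv_continuous: "continuous_on (\<phi> ` U) (inv_into U \<phi>)"
    and chart_inv: "p \<in> U \<Longrightarrow> inv_into U \<phi> (\<phi> p) = p"
proof -
  have "open U \<and> open (\<phi> ` U) \<and> homeomorphism U (\<phi> ` U) \<phi> (inv_into U \<phi>)"
    using assms smooth_atlas by (auto simp: smooth_atlas_def)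
  then show "open U" "open (\<phi> ` U)" "continuous_on U \<phi>" "continuous_on (\<phi> ` U) (inv_into U \<phi>)"
    "p \<in> U \<Longrightarrow> inv_into U \<phi> (\<phi> p) = p"
    by (auto simp: homeomorphism_def)
qed

lemma chart_image_Int:
  assumes "(U, \<phi>) \<in> A"
  shows "\<phi> ` (U \<inter> S) = \<phi> ` U \<inter> inv_into U \<phi> -` S"
  using chart_inv[OF assms] by (auto simp: image_iff)

lemma chart_image_open:
  assumes "(U, \<phi>) \<in> A" "open S"
  shows "open (\<phi> ` (U \<inter> S))"
  unfolding chart_image_Int[OF assms(1)]
  using chart_inv_continuous[OF assms(1)] chart_open_image[OF assms(1)] assms(2)
  by (rule continuous_open_preimage)

lemma chart_preimage_open:
  assumes "(U, \<phi>) \<in> A" "open N"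
  shows "open (U \<inter> \<phi> -` N)"
  using chart_continuous[OF assms(1)] chart_open[OF assms(1)] assms(2) by (rule continuous_open_preimage)

lemma transition_smooth:
  assumes "(U, \<phi>) \<in> A" "(V, \<psi>) \<in> A"
  shows "smooth_on (\<phi> ` (U \<inter> V)) (\<psi> \<circ> inv_into U \<phi>)"
  using assms smooth_atlas by (fastforce simp: smooth_atlas_def)

text \<open>\<open>smooth_fun_on\<close> tests every chart of the atlas. Smooth transition maps
  carry the property from one chart to the others, so local arguments may work in a single
  chart.\<close>

lemma smooth_atI:
  assumes U: "(U, \<phi>) \<in> A" "p \<in> U" and N: "open N" "\<phi> p \<in> N" "smooth_on N (f \<circ> inv_into U \<phi>)"
  shows "smooth_at A p f"
  unfolding smooth_at_def smooth_fun_on_def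
proof (intro exI[of _ "U \<inter> \<phi> -` N"] conjI ballI)
  show "open (U \<inter> \<phi> -` N)" using U(1) N(1) by (rule chart_preimage_open)
  show "p \<in> U \<inter> \<phi> -` N" using U N by simp
  show "case x of (V, \<psi>) \<Rightarrow> smooth_on (\<psi> ` (V \<inter> (U \<inter> \<phi> -` N))) (f \<circ> inv_into V \<psi>)" if "x \<in> A" for x
  proof (cases x)
    case (Pair V \<psi>)
    then have V: "(V, \<psi>) \<in> A" using that by simp
    let ?S = "\<psi> ` (V \<inter> (U \<inter> \<phi> -` N))"
    have S: "open ?S"
      using V U(1) N(1) by (intro chart_image_open chart_preimage_open)
    have "smooth_on ?S (\<lambda>y. (f \<circ> inv_into U \<phi>) ((\<phi> \<circ> inv_into V \<psi>) y))"
    proof (rule smooth_on_compose[OF S, where f = "\<phi> \<circ> inv_into V \<psi>" and g = "f \<circ> inv_into U \<phi>" and T = N])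
      show "(\<phi> \<circ> inv_into V \<psi>) ` ?S \<subseteq> N" using chart_inv[OF V] by auto
      show "smooth_on ?S (\<phi> \<circ> inv_into V \<psi>)"
        using transition_smooth[OF V U(1)] by (rule smooth_on_subset) auto
    qed (rule N)
    then have "smooth_on ?S (f \<circ> inv_into V \<psi>)"
      by (rule smooth_on_cong[OF S, rotated]) (auto simp: chart_inv[OF U(1)] chart_inv[OF V])
    then show ?thesis using Pair by simp
  qed
qed

lemma smooth_atE:
  assumes f: "smooth_at A p f" and U: "(U, \<phi>) \<in> A" "p \<in> U"
  obtains N where "open N" "\<phi> p \<in> N" "N \<subseteq> \<phi> ` U" "smooth_on N (f \<circ> inv_into U \<phi>)"
    "\<And>y. y \<in> N \<Longrightarrow> smooth_at A (inv_into U \<phi> y) f"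
proof -
  from f obtain S where S: "open S" "p \<in> S" "smooth_fun_on A S f" by (auto simp: smooth_at_def)
  show ?thesis
  proof (rule that)
    show "open (\<phi> ` (U \<inter> S))" using U S by (intro chart_image_open)
    show "\<phi> p \<in> \<phi> ` (U \<inter> S)" using U S by blast
    show "smooth_on (\<phi> ` (U \<inter> S)) (f \<circ> inv_into U \<phi>)" using S U by (auto simp: smooth_fun_on_def)
    show "smooth_at A (inv_into U \<phi> y) f" if "y \<in> \<phi> ` (U \<inter> S)" for y
      using that S U chart_inv[OF U(1)] by (auto simp: smooth_at_def)
  qed auto
qed

lemma smooth_fun_on_iff: "open S \<Longrightarrow> smooth_fun_on A S f \<longleftrightarrow> (\<forall>p\<in>S. smooth_at A p f)"
proof
  assume "open S" "smooth_fun_on A S f"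
  then show "\<forall>p\<in>S. smooth_at A p f" by (auto simp: smooth_at_def)
next
  assume S: "open S" and *: "\<forall>p\<in>S. smooth_at A p f"
  have "smooth_on (\<phi> ` (U \<inter> S)) (f \<circ> inv_into U \<phi>)" if U: "(U, \<phi>) \<in> A" for U \<phi>
  proof (rule smooth_on_local)
    fix y assume "y \<in> \<phi> ` (U \<inter> S)"
    then obtain p where p: "p \<in> U" "p \<in> S" "y = \<phi> p" by auto
    with * have "smooth_at A p f" by blast
    from smooth_atE[OF this U p(1)] show "\<exists>T. open T \<and> y \<in> T \<and> smooth_on T (f \<circ> inv_into U \<phi>)"
      unfolding p(3) by metis
  qed
  then show "smooth_fun_on A S f" by (auto simp: smooth_fun_on_def)
qed

lemma smooth_at_nbhd:
  assumes "smooth_at A p f"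
  obtains S where "open S" "p \<in> S" "\<And>q. q \<in> S \<Longrightarrow> smooth_at A q f"
  using assms by (auto simp: smooth_at_def smooth_fun_on_iff)

lemma smooth_at_const: "smooth_at A p (\<lambda>q. c)"
proof -
  obtain U \<phi> where U: "(U, \<phi>) \<in> A" "p \<in> U" using chart_ex by blast
  show ?thesis by (rule smooth_atI[OF U open_UNIV]) (auto simp: o_def smooth_on_const)
qed

lemma smooth_at_op:
  assumes "smooth_at A p f" "smooth_at A p g"
    and op: "\<And>N (F :: 'e \<Rightarrow> real) G. open N \<Longrightarrow> smooth_on N F \<Longrightarrow> smooth_on N G \<Longrightarrow> smooth_on N (\<lambda>x. B (F x) (G x))"
  shows "smooth_at A p (\<lambda>q. B (f q) (g q))"
proof -
  obtain U \<phi> where U: "(U, \<phi>) \<in> A" "p \<in> U" using chart_ex by blast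
  obtain N where N: "open N" "\<phi> p \<in> N" "smooth_on N (f \<circ> inv_into U \<phi>)"
    using smooth_atE[OF assms(1) U] by metis
  obtain M where M: "open M" "\<phi> p \<in> M" "smooth_on M (g \<circ> inv_into U \<phi>)"
    using smooth_atE[OF assms(2) U] by metis
  have "smooth_on (N \<inter> M) (\<lambda>y. B ((f \<circ> inv_into U \<phi>) y) ((g \<circ> inv_into U \<phi>) y))"
    using N M by (intro op smooth_on_subset[OF N(3)] smooth_on_subset[OF M(3)]) auto
  then show ?thesis using N M by (intro smooth_atI[OF U, of "N \<inter> M"]) (auto simp: o_def)
qed

lemma smooth_at_add: "smooth_at A p f \<Longrightarrow> smooth_at A p g \<Longrightarrow> smooth_at A p (\<lambda>q. f q + g q)"
  by (rule smooth_at_op) (auto intro: smooth_on_add)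

lemma smooth_at_mult: "smooth_at A p f \<Longrightarrow> smooth_at A p g \<Longrightarrow> smooth_at A p (\<lambda>q. f q * g q)"
  by (rule smooth_at_op) (auto intro: smooth_on_mult)

lemma smooth_at_sum:
  "(\<And>i. i \<in> I \<Longrightarrow> smooth_at A p (f i)) \<Longrightarrow> smooth_at A p (\<lambda>q. \<Sum>i\<in>I. f i q)"
  by (induction I rule: infinite_finite_induct) (auto intro: smooth_at_add smooth_at_const)

lemma smooth_at_inverse:
  assumes "smooth_at A p f" "\<And>q. f q \<noteq> 0"
  shows "smooth_at A p (\<lambda>q. inverse (f q))"
proof -
  obtain U \<phi> where U: "(U, \<phi>) \<in> A" "p \<in> U" using chart_ex by blast
  obtain N where N: "open N" "\<phi> p \<in> N" "smooth_on N (f \<circ> inv_into U \<phi>)"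
    using smooth_atE[OF assms(1) U] by metis
  have "smooth_on N (\<lambda>y. inverse ((f \<circ> inv_into U \<phi>) y))"
    using N(1) _ N(3) by (rule smooth_on_inverse) (simp add: assms(2))
  then show ?thesis using N by (intro smooth_atI[OF U, of N]) (auto simp: o_def)
qed

lemma smooth_at_differentiable:
  assumes "smooth_at A p f" "(U, \<phi>) \<in> A" "p \<in> U"
  shows "(f \<circ> inv_into U \<phi>) differentiable (at (\<phi> p))"
proof -
  obtain N where "\<phi> p \<in> N" "smooth_on N (f \<circ> inv_into U \<phi>)" using smooth_atE[OF assms] by metis
  then show ?thesis by (intro smooth_on_differentiable)
qed

lemma smooth_at_coordinate:
  assumes U: "(U, \<phi>) \<in> A" "p \<in> U"
  shows "smooth_at A p (\<lambda>q. \<phi> q \<bullet> i)"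
proof (rule smooth_atI[OF U chart_open_image[OF U(1)]])
  show "\<phi> p \<in> \<phi> ` U" using U by simp
  have "smooth_on (\<phi> ` U) (\<lambda>y. y \<bullet> i)"
    by (intro smooth_on_linear bounded_linear_inner_left chart_open_image[OF U(1)])
  then show "smooth_on (\<phi> ` U) ((\<lambda>q. \<phi> q \<bullet> i) \<circ> inv_into U \<phi>)"
    by (rule smooth_on_cong[OF chart_open_image[OF U(1)], rotated]) (auto simp: f_inv_into_f)
qed

text \<open>It suffices that a map pulls back smooth functions to smooth functions, as can be seen on
  the coordinate functions of a chart.\<close>

lemma tangent_vec_pullback:
  assumes cont: "continuous_on UNIV F"
    and F: "\<And>f. smooth_at A (F q) f \<Longrightarrow> smooth_at A q (\<lambda>x. f (F x))"
    and U: "(U, \<phi>) \<in> A" "q \<in> U" and V: "(V, \<psi>) \<in> A" "F q \<in> V"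
  shows "\<exists>w'. \<forall>f. smooth_at A (F q) f \<longrightarrow>
    tangent_vec A U \<phi> q w (\<lambda>x. f (F x)) = tangent_vec A V \<psi> (F q) w' f"
proof (intro exI allI impI)
  let ?G = "\<psi> \<circ> F \<circ> inv_into U \<phi>"
  fix f assume f: "smooth_at A (F q) f"
  have q: "inv_into U \<phi> (\<phi> q) = q" using U by (rule chart_inv)
  have "((\<lambda>x. \<psi> (F x) \<bullet> i) \<circ> inv_into U \<phi>) differentiable (at (\<phi> q))" for i
    using smooth_at_differentiable[OF F[OF smooth_at_coordinate[OF V]] U] .
  then have "(\<lambda>y. \<Sum>i\<in>Basis. (?G y \<bullet> i) *\<^sub>R i) differentiable (at (\<phi> q))"
    by (intro differentiable_sum differentiable_scaleR differentiable_const) (auto simp: o_def)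
  then have G: "?G differentiable (at (\<phi> q))"
    by (simp add: euclidean_representation o_def)
  have df: "(f \<circ> inv_into V \<psi>) differentiable (at (?G (\<phi> q)))"
    using smooth_at_differentiable[OF f V] q by simp
  have "open (F -` V)" using cont chart_open[OF V(1)] by (simp add: open_vimage)
  then have o: "open (\<phi> ` (U \<inter> F -` V))" by (rule chart_image_open[OF U(1)])
  have "frechet_derivative ((\<lambda>x. f (F x)) \<circ> inv_into U \<phi>) (at (\<phi> q)) =
      frechet_derivative ((f \<circ> inv_into V \<psi>) \<circ> ?G) (at (\<phi> q))"
  proof (rule frechet_derivative_transform_within_open[OF _ o])
    show "((\<lambda>x. f (F x)) \<circ> inv_into U \<phi>) differentiable at (\<phi> q)"
      by (intro smooth_at_differentiable F f U)
  qed (use U V chart_inv[OF U(1)] chart_inv[OF V(1)] in auto)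
  also have "\<dots> = frechet_derivative (f \<circ> inv_into V \<psi>) (at (\<psi> (F q))) \<circ> frechet_derivative ?G (at (\<phi> q))"
    unfolding frechet_derivative_compose[OF G df] by (simp add: q)
  finally show "tangent_vec A U \<phi> q w (\<lambda>x. f (F x)) =
      tangent_vec A V \<psi> (F q) (frechet_derivative ?G (at (\<phi> q)) w) f"
    using F[OF f] f by (simp add: tangent_vec_def)
qed

text \<open>The definition lets each tangent vector use a chart of its own. Pulling back along the
  identity map rewrites all of them in one prescribed chart, which makes the space a linear image of
  the model space.\<close>

lemma tangent_space_eq:
  assumes U: "(U, \<phi>) \<in> A" "p \<in> U"
  shows "tangent_space A p = range (tangent_vec A U \<phi> p)"
proof (intro equalityI subsetI)
  fix v assume "v \<in> tangent_space A p"
  then obtain V \<psi> w where V: "(V, \<psi>) \<in> A" "p \<in> V" and v: "v = tangent_vec A V \<psi> p w"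
    by (auto simp: tangent_space_def tangent_vec_def)
  obtain w' where "\<forall>f. smooth_at A p f \<longrightarrow> tangent_vec A V \<psi> p w f = tangent_vec A U \<phi> p w' f"
    using tangent_vec_pullback[of id p V \<psi> U \<phi> w] U V by auto
  then have "v = tangent_vec A U \<phi> p w'" unfolding v by (auto simp: tangent_vec_def fun_eq_iff)
  then show "v \<in> range (tangent_vec A U \<phi> p)" by blast
qed (use U in \<open>auto simp: tangent_space_def tangent_vec_def\<close>)

lemma tangent_vec_linear:
  assumes U: "(U, \<phi>) \<in> A" "p \<in> U"
  shows "tangent_vec A U \<phi> p (x + y) = tangent_vec A U \<phi> p x + tangent_vec A U \<phi> p y"
    and "tangent_vec A U \<phi> p (r *\<^sub>R x) = r *\<^sub>R tangent_vec A U \<phi> p x"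
proof -
  have lin: "linear (frechet_derivative (f \<circ> inv_into U \<phi>) (at (\<phi> p)))" if "smooth_at A p f" for f
    by (intro linear_frechet_derivative smooth_at_differentiable that U)
  show "tangent_vec A U \<phi> p (x + y) = tangent_vec A U \<phi> p x + tangent_vec A U \<phi> p y"
    "tangent_vec A U \<phi> p (r *\<^sub>R x) = r *\<^sub>R tangent_vec A U \<phi> p x"
    using linear_add[OF lin] linear_scale[OF lin]
    by (auto simp: tangent_vec_def fun_eq_iff scaleR_fun_def)
qed

lemma tangent_subspace: "subspace (tangent_space A p)"
proof -
  obtain U \<phi> where U: "(U, \<phi>) \<in> A" "p \<in> U" using chart_ex by blast
  have "linear (tangent_vec A U \<phi> p)"
    using tangent_vec_linear[OF U] by (intro linearI)
  then show ?thesis unfolding tangent_space_eq[OF U]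
    by (intro linear_subspace_image) auto
qed

lemma tangent_nonsmooth: "v \<in> tangent_space A p \<Longrightarrow> \<not> smooth_at A p f \<Longrightarrow> v f = 0"
  by (auto simp: tangent_space_def)

lemma tangent_const: "v \<in> tangent_space A p \<Longrightarrow> v (\<lambda>q. c) = 0"
  by (auto simp: tangent_space_def o_def)

lemma tangent_add:
  assumes v: "v \<in> tangent_space A p" and f: "smooth_at A p f" and g: "smooth_at A p g"
  shows "v (\<lambda>q. f q + g q) = v f + v g"
proof -
  obtain U \<phi> w where U: "(U, \<phi>) \<in> A" "p \<in> U" and v: "v = tangent_vec A U \<phi> p w"
    using v by (auto simp: tangent_space_def tangent_vec_def)
  have "((\<lambda>y. (f \<circ> inv_into U \<phi>) y + (g \<circ> inv_into U \<phi>) y) has_derivative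
      (\<lambda>w. frechet_derivative (f \<circ> inv_into U \<phi>) (at (\<phi> p)) w + frechet_derivative (g \<circ> inv_into U \<phi>) (at (\<phi> p)) w)) (at (\<phi> p))"
    using smooth_at_differentiable[OF f U, unfolded frechet_derivative_works]
      smooth_at_differentiable[OF g U, unfolded frechet_derivative_works]
    by (rule has_derivative_add)
  from frechet_derivative_at[OF this] show ?thesis
    using f g smooth_at_add[OF f g] by (simp add: v tangent_vec_def o_def fun_eq_iff)
qed

lemma tangent_mult:
  assumes v: "v \<in> tangent_space A p" and f: "smooth_at A p f" and g: "smooth_at A p g"
  shows "v (\<lambda>q. f q * g q) = f p * v g + v f * g p"
proof -
  obtain U \<phi> w where U: "(U, \<phi>) \<in> A" "p \<in> U" and v: "v = tangent_vec A U \<phi> p w"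
    using v by (auto simp: tangent_space_def tangent_vec_def)
  have "((\<lambda>y. (f \<circ> inv_into U \<phi>) y * (g \<circ> inv_into U \<phi>) y) has_derivative
      (\<lambda>w. (f \<circ> inv_into U \<phi>) (\<phi> p) * frechet_derivative (g \<circ> inv_into U \<phi>) (at (\<phi> p)) w
         + frechet_derivative (f \<circ> inv_into U \<phi>) (at (\<phi> p)) w * (g \<circ> inv_into U \<phi>) (\<phi> p))) (at (\<phi> p))"
    using smooth_at_differentiable[OF f U, unfolded frechet_derivative_works]
      smooth_at_differentiable[OF g U, unfolded frechet_derivative_works]
    by (rule has_derivative_mult)
  from frechet_derivative_at[OF this] show ?thesis
    using f g smooth_at_mult[OF f g] chart_inv[OF U] by (simp add: v tangent_vec_def o_def fun_eq_iff)
qed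

lemma tangent_cmult:
  "v \<in> tangent_space A p \<Longrightarrow> smooth_at A p f \<Longrightarrow> v (\<lambda>q. c * f q) = c * v f"
  by (subst tangent_mult) (auto simp: tangent_const smooth_at_const)

lemma tangent_sum:
  assumes "v \<in> tangent_space A p" "\<And>i. i \<in> I \<Longrightarrow> smooth_at A p (f i)"
  shows "v (\<lambda>q. \<Sum>i\<in>I. f i q) = (\<Sum>i\<in>I. v (f i))"
  using assms(2)
  by (induction I rule: infinite_finite_induct)
    (auto simp: tangent_const[OF assms(1)] tangent_add[OF assms(1)] smooth_at_sum)

text \<open>An equivalence of smoothness is assumed because tangent vectors vanish on non-smooth
  functions: a non-smooth \<open>f\<close> has to remain non-smooth after composition with
  \<open>F\<close> if the pushforward is to respect this convention.\<close>

lemma pushforward_tangent: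
  assumes cont: "continuous_on UNIV F"
    and F: "\<And>f. smooth_at A (F q) f \<longleftrightarrow> smooth_at A q (\<lambda>x. f (F x))"
    and v: "v \<in> tangent_space A q"
  shows "pushforward F v \<in> tangent_space A (F q)"
proof -
  obtain U \<phi> w where U: "(U, \<phi>) \<in> A" "q \<in> U" and w: "v = tangent_vec A U \<phi> q w"
    using v by (auto simp: tangent_space_def tangent_vec_def)
  obtain V \<psi> where V: "(V, \<psi>) \<in> A" "F q \<in> V" using chart_ex by blast
  obtain w' where w': "\<forall>f. smooth_at A (F q) f \<longrightarrow>
      tangent_vec A U \<phi> q w (\<lambda>x. f (F x)) = tangent_vec A V \<psi> (F q) w' f"
    using tangent_vec_pullback[OF cont _ U V] F by blast
  have "pushforward F v f = tangent_vec A V \<psi> (F q) w' f" for f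
  proof (cases "smooth_at A (F q) f")
    case True
    then show ?thesis using w' by (simp add: pushforward_def o_def w)
  next
    case False
    then have "v (\<lambda>x. f (F x)) = 0" using F v tangent_nonsmooth by blast
    then show ?thesis using False by (simp add: pushforward_def o_def tangent_vec_def)
  qed
  then have "pushforward F v = tangent_vec A V \<psi> (F q) w'" by (rule ext)
  then show ?thesis using tangent_space_eq[OF V] by blast
qed

lemma vector_fields_iff:
  "X \<in> vector_fields A \<longleftrightarrow>
    (\<forall>p. X p \<in> tangent_space A p) \<and> (\<forall>p f. smooth_at A p f \<longrightarrow> smooth_at A p (\<lambda>q. X q f))"
proof -
  have "(\<forall>S f. open S \<longrightarrow> smooth_fun_on A S f \<longrightarrow> smooth_fun_on A S (\<lambda>p. X p f)) \<longleftrightarrow>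
      (\<forall>p f. smooth_at A p f \<longrightarrow> smooth_at A p (\<lambda>q. X q f))"
    by (auto simp: smooth_fun_on_iff elim: smooth_at_nbhd)
  then show ?thesis by (auto simp: vector_fields_def)
qed

lemma vector_fieldsD:
  assumes "X \<in> vector_fields A"
  shows vector_fields_tangent: "X p \<in> tangent_space A p"
    and vector_fields_smooth: "smooth_at A p f \<Longrightarrow> smooth_at A p (\<lambda>q. X q f)"
  using assms by (auto simp: vector_fields_iff)

lemma vector_fields_add:
  "X \<in> vector_fields A \<Longrightarrow> Y \<in> vector_fields A \<Longrightarrow> (\<lambda>p. X p + Y p) \<in> vector_fields A"
  by (auto simp: vector_fields_iff smooth_at_add subspace_add[OF tangent_subspace])

lemma vector_fields_scaleR:
  "(\<And>p. smooth_at A p x) \<Longrightarrow> X \<in> vector_fields A \<Longrightarrow> (\<lambda>p. x p *\<^sub>R X p) \<in> vector_fields A"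
  unfolding vector_fields_iff
  by (intro conjI allI subspace_scale[OF tangent_subspace]) (auto simp: scaleR_fun_def smooth_at_mult)

text \<open>In a chart the derivative vanishes on a ball, so \<open>f\<close> is locally constant,
  and connectedness does the rest. Identities between globally defined functions are obtained in
  this way, in place of solving differential equations in coordinates.\<close>

lemma vanishing_derivative_imp_constant:
  assumes "connected (UNIV :: 'm set)" "\<And>p. smooth_at A p f"
    and 0: "\<And>p v. v \<in> tangent_space A p \<Longrightarrow> v f = 0"
  shows "f p = f q"
proof (rule connected_local_const[OF assms(1)])
  show "\<forall>a\<in>UNIV. eventually (\<lambda>b. f a = f b) (at a)"
  proof
    fix a
    obtain U \<phi> where U: "(U, \<phi>) \<in> A" "a \<in> U" using chart_ex by blast
    obtain d where d: "d > 0" "ball (\<phi> a) d \<subseteq> \<phi> ` U"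
      using chart_open_image[OF U(1)] U openE by blast
    let ?F = "f \<circ> inv_into U \<phi>"
    have "(?F has_derivative (\<lambda>h. 0)) (at y within ball (\<phi> a) d)" if "y \<in> ball (\<phi> a) d" for y
    proof -
      have "y \<in> \<phi> ` U" using that d by blast
      then obtain b where b: "b \<in> U" "y = \<phi> b" by blast
      have "frechet_derivative ?F (at y) w = 0" for w
        using 0[of "tangent_vec A U \<phi> b w" b] tangent_space_eq[OF U(1) b(1)] assms(2) b
        by (auto simp: tangent_vec_def)
      then have "(?F has_derivative (\<lambda>h. 0)) (at y)"
        using smooth_at_differentiable[OF assms(2) U(1) b(1)] b(2)
        by (simp add: frechet_derivative_works fun_eq_iff[symmetric])
          (metis (no_types) ext)
      then show ?thesis by (rule has_derivative_at_withinI)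
    qed
    then have *: "?F y = ?F (\<phi> a)" if "y \<in> ball (\<phi> a) d" for y
      using has_derivative_zero_unique[OF convex_ball _ that, of ?F "\<phi> a"] d by simp
    have "f a = f b" if "b \<in> U \<inter> \<phi> -` ball (\<phi> a) d" for b
      using that *[of "\<phi> b"] chart_inv[OF U(1)] U by simp
    moreover have "open (U \<inter> \<phi> -` ball (\<phi> a) d)" "a \<in> U \<inter> \<phi> -` ball (\<phi> a) d"
      using U d by (auto intro: chart_preimage_open)
    ultimately show "eventually (\<lambda>b. f a = f b) (at a)"
      by (auto simp: eventually_at_topological)
  qed
qed auto

end

section \<open>Invariant vector fields on a Lie group\<close>

lemma frechet_derivative_slice:
  assumes F: "F differentiable (at (y, z))"
  shows "frechet_derivative (\<lambda>z. F (y, z)) (at z) w = frechet_derivative F (at (y, z)) (0, w)"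
    and "frechet_derivative (\<lambda>y. F (y, z)) (at y) w = frechet_derivative F (at (y, z)) (w, 0)"
proof -
  have F': "(F has_derivative frechet_derivative F (at (y, z))) (at (y, z))"
    using F by (simp add: frechet_derivative_works)
  have "((\<lambda>z. (y, z)) has_derivative (\<lambda>w. (0, w))) (at z)" by (auto intro!: derivative_eq_intros)
  from frechet_derivative_at[OF diff_chain_at[OF this F'], symmetric] show "frechet_derivative (\<lambda>z. F (y, z)) (at z) w = frechet_derivative F (at (y, z)) (0, w)"
    by (simp add: o_def fun_eq_iff)
  have "((\<lambda>y. (y, z)) has_derivative (\<lambda>w. (w, 0))) (at y)" by (auto intro!: derivative_eq_intros)
  from frechet_derivative_at[OF diff_chain_at[OF this F'], symmetric] show "frechet_derivative (\<lambda>y. F (y, z)) (at y) w = frechet_derivative F (at (y, z)) (w, 0)"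
    by (simp add: o_def fun_eq_iff)
qed

section \<open>Jointly smooth binary operations and their mixed derivatives\<close>

context smooth_manifold
begin

text \<open>Joint smoothness tested on real functions in pairs of charts. In this form it is stable
  under exchanging the arguments, and derivatives in either argument are partial derivatives on a
  Euclidean product.\<close>

definition smooth_op :: "('m \<Rightarrow> 'm \<Rightarrow> 'm) \<Rightarrow> bool" where
  "smooth_op m \<longleftrightarrow>
    (\<forall>q r f U \<phi> V \<psi>. (U, \<phi>) \<in> A \<longrightarrow> q \<in> U \<longrightarrow> (V, \<psi>) \<in> A \<longrightarrow> r \<in> V \<longrightarrow> smooth_at A (m q r) f \<longrightarrow>
      (\<exists>N. open N \<and> (\<phi> q, \<psi> r) \<in> N \<and> N \<subseteq> \<phi> ` U \<times> \<psi> ` V \<and>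
        smooth_on N (\<lambda>x. f (m (inv_into U \<phi> (fst x)) (inv_into V \<psi> (snd x))))))"

lemma smooth_opE:
  assumes "smooth_op m" "(U, \<phi>) \<in> A" "q \<in> U" "(V, \<psi>) \<in> A" "r \<in> V" "smooth_at A (m q r) f"
  obtains N where "open N" "(\<phi> q, \<psi> r) \<in> N" "N \<subseteq> \<phi> ` U \<times> \<psi> ` V"
    "smooth_on N (\<lambda>x. f (m (inv_into U \<phi> (fst x)) (inv_into V \<psi> (snd x))))"
proof -
  have "\<exists>N. open N \<and> (\<phi> q, \<psi> r) \<in> N \<and> N \<subseteq> \<phi> ` U \<times> \<psi> ` V \<and>
      smooth_on N (\<lambda>x. f (m (inv_into U \<phi> (fst x)) (inv_into V \<psi> (snd x))))"
    using assms unfolding smooth_op_def by simp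
  then show ?thesis using that by blast
qed

text \<open>Makes every statement about one argument available for the other; for a group it turns
  left translations into right translations.\<close>

lemma smooth_op_flip:
  assumes "smooth_op m"
  shows "smooth_op (\<lambda>x y. m y x)"
  unfolding smooth_op_def
proof (intro allI impI)
  fix q r f U \<phi> V \<psi>
  assume *: "(U, \<phi>) \<in> A" "q \<in> U" "(V, \<psi>) \<in> A" "r \<in> V" "smooth_at A (m r q) f"
  obtain N where N: "open N" "(\<psi> r, \<phi> q) \<in> N" "N \<subseteq> \<psi> ` V \<times> \<phi> ` U"
    "smooth_on N (\<lambda>x. f (m (inv_into V \<psi> (fst x)) (inv_into U \<phi> (snd x))))"
    by (rule smooth_opE[OF assms *(3,4,1,2,5)])
  have cont: "continuous_on UNIV (prod.swap :: 'e \<times> 'e \<Rightarrow> 'e \<times> 'e)"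
    unfolding prod.swap_def by (intro continuous_intros)
  have o: "open (prod.swap -` N)" using N(1) cont by (simp add: open_vimage)
  have "smooth_on (prod.swap -` N) (\<lambda>x :: 'e \<times> 'e. (snd x, fst x))"
    by (intro smooth_on_linear o bounded_linear_Pair bounded_linear_fst bounded_linear_snd)
  then have "smooth_on (prod.swap -` N) (\<lambda>x. (\<lambda>x. f (m (inv_into V \<psi> (fst x)) (inv_into U \<phi> (snd x)))) (snd x, fst x))"
    using N(4) by (rule smooth_on_compose[OF o, rotated]) (auto simp: prod.swap_def)
  then show "\<exists>N. open N \<and> (\<phi> q, \<psi> r) \<in> N \<and> N \<subseteq> \<phi> ` U \<times> \<psi> ` V \<and>
      smooth_on N (\<lambda>x. f (m (inv_into V \<psi> (snd x)) (inv_into U \<phi> (fst x))))"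
    using N(2,3) o by (intro exI[of _ "prod.swap -` N"]) auto
qed

lemma smooth_op_slice:
  assumes m: "smooth_op m" and f: "smooth_at A (m q r) f"
  shows "smooth_at A r (\<lambda>y. f (m q y))"
proof -
  obtain U \<phi> where U: "(U, \<phi>) \<in> A" "q \<in> U" using chart_ex by blast
  obtain V \<psi> where V: "(V, \<psi>) \<in> A" "r \<in> V" using chart_ex by blast
  obtain N where N: "open N" "(\<phi> q, \<psi> r) \<in> N" "N \<subseteq> \<phi> ` U \<times> \<psi> ` V"
    "smooth_on N (\<lambda>x. f (m (inv_into U \<phi> (fst x)) (inv_into V \<psi> (snd x))))"
    by (rule smooth_opE[OF m U V f])
  let ?N = "{z. (\<phi> q, z) \<in> N}"
  have o: "open ?N" using N(1) by (rule open_slice)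
  have "smooth_on ?N (\<lambda>z. (\<phi> q, z))"
    by (intro smooth_on_Pair o smooth_on_const smooth_on_id)
  then have "smooth_on ?N (\<lambda>z. (\<lambda>x. f (m (inv_into U \<phi> (fst x)) (inv_into V \<psi> (snd x)))) (\<phi> q, z))"
    using N(4) by (rule smooth_on_compose[OF o, rotated]) auto
  then show ?thesis
    using N(2) chart_inv[OF U] by (intro smooth_atI[OF V o]) (auto simp: o_def)
qed

text \<open>A tangent vector acting in the second argument becomes a partial derivative of the
  coordinate expression, simultaneously for all nearby values of the first argument. This gives
  access to calculus on the Euclidean product.\<close>

lemma smooth_op_partial:
  assumes m: "smooth_op m" and f: "smooth_at A (m q r) f" and v: "v = tangent_vec A V \<psi> r w"
    and U: "(U, \<phi>) \<in> A" "q \<in> U" and V: "(V, \<psi>) \<in> A" "r \<in> V"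
    and N: "open N" "(\<phi> q, \<psi> r) \<in> N" "N \<subseteq> \<phi> ` U \<times> \<psi> ` V"
    and F: "smooth_on N (\<lambda>x. f (m (inv_into U \<phi> (fst x)) (inv_into V \<psi> (snd x))))" (is "smooth_on N ?F")
    and y: "(y, \<psi> r) \<in> N"
  shows "v (\<lambda>z. f (m (inv_into U \<phi> y) z)) = frechet_derivative ?F (at (y, \<psi> r)) (0, w)"
proof -
  let ?N = "{z. (y, z) \<in> N}"
  have o: "open ?N" using N(1) by (rule open_slice)
  have "smooth_on ?N (\<lambda>z. (y, z))"
    by (intro smooth_on_Pair o smooth_on_const smooth_on_id)
  then have "smooth_on ?N (\<lambda>z. ?F (y, z))"
    using F by (rule smooth_on_compose[OF o, rotated]) auto
  then have "smooth_at A r (\<lambda>z. f (m (inv_into U \<phi> y) z))"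
    using y by (intro smooth_atI[OF V o]) (auto simp: o_def)
  moreover have "frechet_derivative (\<lambda>z. ?F (y, z)) (at (\<psi> r)) w = frechet_derivative ?F (at (y, \<psi> r)) (0, w)"
    by (intro frechet_derivative_slice smooth_on_differentiable[OF F y])
  ultimately show ?thesis by (simp add: v tangent_vec_def o_def)
qed

text \<open>The result is a partial derivative of a jointly smooth function, restricted to a slice.
  Smoothness of the invariant vector fields is an instance.\<close>

lemma smooth_op_derivative:
  assumes m: "smooth_op m" and f: "smooth_at A (m q r) f" and v: "v \<in> tangent_space A r"
  shows "smooth_at A q (\<lambda>x. v (\<lambda>y. f (m x y)))"
proof -
  obtain U \<phi> where U: "(U, \<phi>) \<in> A" "q \<in> U" using chart_ex by blast
  obtain V \<psi> w where V: "(V, \<psi>) \<in> A" "r \<in> V" and w: "v = tangent_vec A V \<psi> r w"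
    using v by (auto simp: tangent_space_def tangent_vec_def)
  obtain N where N: "open N" "(\<phi> q, \<psi> r) \<in> N" "N \<subseteq> \<phi> ` U \<times> \<psi> ` V" and
    F: "smooth_on N (\<lambda>x. f (m (inv_into U \<phi> (fst x)) (inv_into V \<psi> (snd x))))" (is "smooth_on N ?F")
    by (rule smooth_opE[OF m U V f])
  let ?N = "{y. (y, \<psi> r) \<in> N}"
  have o: "open ?N" using N(1) by (rule open_slice)
  have "smooth_on ?N (\<lambda>y. (y, \<psi> r))"
    by (intro smooth_on_Pair o smooth_on_const smooth_on_id)
  then have "smooth_on ?N (\<lambda>y. (\<lambda>x. frechet_derivative ?F (at x) (0, w)) (y, \<psi> r))"
    using smooth_on_frechet_derivative[OF F] by (rule smooth_on_compose[OF o, rotated]) auto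
  then have "smooth_on ?N ((\<lambda>x. v (\<lambda>y. f (m x y))) \<circ> inv_into U \<phi>)"
    by (rule smooth_on_cong[OF o, rotated])
      (use smooth_op_partial[OF m f w U V N F] in \<open>auto simp: o_def\<close>)
  then show ?thesis using N(2) by (intro smooth_atI[OF U o]) auto
qed

text \<open>Schwarz's theorem for the coordinate expression, the two vectors being the directions
  \<open>(w', 0)\<close> and \<open>(0, w)\<close> of the product.\<close>

lemma smooth_op_commute:
  assumes m: "smooth_op m" and f: "smooth_at A (m q r) f"
    and u: "u \<in> tangent_space A q" and v: "v \<in> tangent_space A r"
  shows "u (\<lambda>x. v (\<lambda>y. f (m x y))) = v (\<lambda>y. u (\<lambda>x. f (m x y)))"
proof -
  have fl: "smooth_op (\<lambda>x y. m y x)" using m by (rule smooth_op_flip)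
  obtain U \<phi> w' where U: "(U, \<phi>) \<in> A" "q \<in> U" and w': "u = tangent_vec A U \<phi> q w'"
    using u by (auto simp: tangent_space_def tangent_vec_def)
  obtain V \<psi> w where V: "(V, \<psi>) \<in> A" "r \<in> V" and w: "v = tangent_vec A V \<psi> r w"
    using v by (auto simp: tangent_space_def tangent_vec_def)
  obtain N where N: "open N" "(\<phi> q, \<psi> r) \<in> N" "N \<subseteq> \<phi> ` U \<times> \<psi> ` V" and
    F: "smooth_on N (\<lambda>x. f (m (inv_into U \<phi> (fst x)) (inv_into V \<psi> (snd x))))" (is "smooth_on N ?F")
    by (rule smooth_opE[OF m U V f])
  have o: "open {y. (y, \<psi> r) \<in> N}" "open {z. (\<phi> q, z) \<in> N}" using N(1) by (auto intro: open_slice)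
  have d: "(\<lambda>x. frechet_derivative ?F (at x) c) differentiable (at (\<phi> q, \<psi> r))" for c
    using smooth_on_frechet_derivative[OF F] N(2) by (rule smooth_on_differentiable)
  have "u (\<lambda>x. v (\<lambda>y. f (m x y))) =
      frechet_derivative ((\<lambda>x. v (\<lambda>y. f (m x y))) \<circ> inv_into U \<phi>) (at (\<phi> q)) w'"
    using smooth_op_derivative[OF m f v] by (simp add: w' tangent_vec_def)
  also have "frechet_derivative ((\<lambda>x. v (\<lambda>y. f (m x y))) \<circ> inv_into U \<phi>) (at (\<phi> q)) =
      frechet_derivative (\<lambda>y. frechet_derivative ?F (at (y, \<psi> r)) (0, w)) (at (\<phi> q))"
    using smooth_op_partial[OF m f w U V N F] N(2)
    by (intro frechet_derivative_transform_within_open[OF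
          smooth_at_differentiable[OF smooth_op_derivative[OF m f v] U] o(1)]) auto
  also have "\<dots> w' = frechet_derivative (\<lambda>x. frechet_derivative ?F (at x) (0, w)) (at (\<phi> q, \<psi> r)) (w', 0)"
    by (rule frechet_derivative_slice(2)[OF d])
  also have "\<dots> = frechet_derivative (\<lambda>x. frechet_derivative ?F (at x) (w', 0)) (at (\<phi> q, \<psi> r)) (0, w)"
    by (rule frechet_derivative_commute[OF N(1,2) F])
  also have "\<dots> = frechet_derivative (\<lambda>z. frechet_derivative ?F (at (\<phi> q, z)) (w', 0)) (at (\<psi> r)) w"
    by (rule frechet_derivative_slice(1)[OF d, symmetric])
  also have "frechet_derivative (\<lambda>z. frechet_derivative ?F (at (\<phi> q, z)) (w', 0)) (at (\<psi> r)) =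
      frechet_derivative ((\<lambda>y. u (\<lambda>x. f (m x y))) \<circ> inv_into V \<psi>) (at (\<psi> r))"
  \<comment> \<open>\<open>smooth_op_partial\<close> concerns the second argument; the same
    computation is carried out here for the first, on the slices with the second coordinate
    fixed.\<close>
  proof (rule frechet_derivative_transform_within_open[OF _ o(2), symmetric])
    show "(\<lambda>y. u (\<lambda>x. f (m x y))) \<circ> inv_into V \<psi> differentiable at (\<psi> r)"
      by (rule smooth_at_differentiable[OF smooth_op_derivative[OF fl f u] V])
    show "\<psi> r \<in> {z. (\<phi> q, z) \<in> N}" using N(2) by simp
    fix z assume "z \<in> {z. (\<phi> q, z) \<in> N}"
    then have z: "(\<phi> q, z) \<in> N" by simp
    let ?M = "{y. (y, z) \<in> N}"
    have oM: "open ?M" using N(1) by (rule open_slice)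
    have "smooth_on ?M (\<lambda>y. (y, z))"
      by (intro smooth_on_Pair oM smooth_on_const smooth_on_id)
    then have "smooth_on ?M (\<lambda>y. ?F (y, z))"
      using F by (rule smooth_on_compose[OF oM, rotated]) auto
    then have "smooth_at A q (\<lambda>x. f (m x (inv_into V \<psi> z)))"
      using z by (intro smooth_atI[OF U oM]) (auto simp: o_def)
    moreover have "frechet_derivative (\<lambda>y. ?F (y, z)) (at (\<phi> q)) w' = frechet_derivative ?F (at (\<phi> q, z)) (w', 0)"
      by (intro frechet_derivative_slice smooth_on_differentiable[OF F z])
    ultimately show "((\<lambda>y. u (\<lambda>x. f (m x y))) \<circ> inv_into V \<psi>) z = frechet_derivative ?F (at (\<phi> q, z)) (w', 0)"
      by (simp add: w' tangent_vec_def o_def)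
  qed
  also have "\<dots> w = v (\<lambda>y. u (\<lambda>x. f (m x y)))"
    using smooth_op_derivative[OF fl f u] by (simp add: w tangent_vec_def)
  finally show ?thesis .
qed

end

section \<open>Translations of the group and their invariant fields\<close>

definition right_invariant_field :: "'g monoid \<Rightarrow> 'g tangent \<Rightarrow> 'g \<Rightarrow> 'g tangent"
  where "right_invariant_field G u p = pushforward (\<lambda>q. q \<otimes>\<^bsub>G\<^esub> p) u"

locale lie_group_manifold = smooth_manifold A
  for A :: "('g::{t2_space,second_countable_topology}, 'e::euclidean_space) atlas" +
  fixes G :: "'g monoid" (structure)
  assumes lie_group: "lie_group A G"
begin

sublocale group G
  using lie_group by (simp add: lie_group_def)

lemma carrier_UNIV [simp]: "carrier G = UNIV"
  using lie_group by (simp add: lie_group_def)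

lemma mult_assoc: "x \<otimes> y \<otimes> z = x \<otimes> (y \<otimes> z)"
  by (simp add: m_assoc)

lemma inv_mult_cancel [simp]: "inv x \<otimes> (x \<otimes> y) = y" "x \<otimes> (inv x \<otimes> y) = y"
    "y \<otimes> x \<otimes> inv x = y" "y \<otimes> inv x \<otimes> x = y"
  by (simp_all add: mult_assoc[symmetric]) (simp_all add: mult_assoc)

lemma continuous_mult: "continuous_on UNIV (\<lambda>(x, y). x \<otimes> y)"
  using lie_group by (simp add: lie_group_def smooth_map_def)

lemma continuous_translation: "continuous_on UNIV (\<lambda>x. p \<otimes> x)" "continuous_on UNIV (\<lambda>x. x \<otimes> p)"
proof -
  have "continuous_on UNIV (\<lambda>x. (\<lambda>(x, y). x \<otimes> y) (p, x))" "continuous_on UNIV (\<lambda>x. (\<lambda>(x, y). x \<otimes> y) (x, p))"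
    by (intro continuous_on_compose2[OF continuous_mult] continuous_intros; simp)+
  then show "continuous_on UNIV (\<lambda>x. p \<otimes> x)" "continuous_on UNIV (\<lambda>x. x \<otimes> p)" by simp_all
qed

text \<open>Extracts joint smoothness from the product atlas. The set \<open>N\<close> is so small
  that products stay inside a chart \<open>W\<close>, in the part of it where \<open>f\<close> is
  smooth in coordinates, so \<open>f\<close> can be composed with multiplication read in
  charts.\<close>

lemma smooth_op_mult: "smooth_op (\<otimes>)"
  unfolding smooth_op_def
proof (intro allI impI)
  fix q r f U \<phi> V \<psi>
  assume U: "(U, \<phi>) \<in> A" "q \<in> U" and V: "(V, \<psi>) \<in> A" "r \<in> V" and f: "smooth_at A (q \<otimes> r) f"
  obtain W \<kappa> where W: "(W, \<kappa>) \<in> A" "q \<otimes> r \<in> W" using chart_ex by blast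
  obtain M where M: "open M" "\<kappa> (q \<otimes> r) \<in> M" "smooth_on M (f \<circ> inv_into W \<kappa>)"
    using smooth_atE[OF f W] by metis
  define J where "J x = (inv_into U \<phi> (fst x), inv_into V \<psi> (snd x))" for x
  define P where "P = W \<inter> \<kappa> -` M"
  define N where "N = \<phi> ` U \<times> \<psi> ` V \<inter> (\<lambda>x. (\<lambda>(x, y). x \<otimes> y) (J x)) -` P"
  have P: "open P" "q \<otimes> r \<in> P" "P \<subseteq> W" "\<And>x. x \<in> P \<Longrightarrow> \<kappa> x \<in> M" unfolding P_def
    using W M by (auto intro: chart_preimage_open)
  have cont: "continuous_on (\<phi> ` U \<times> \<psi> ` V) J" unfolding J_def
    by (intro continuous_on_Pair continuous_on_compose2[OF chart_inv_continuous[OF U(1)]]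
        continuous_on_compose2[OF chart_inv_continuous[OF V(1)]] continuous_intros) auto
  then have "continuous_on (\<phi> ` U \<times> \<psi> ` V) (\<lambda>x. (\<lambda>(x, y). x \<otimes> y) (J x))"
    by (intro continuous_on_compose2[OF continuous_mult]) auto
  then have N: "open N" unfolding N_def
    using P by (intro continuous_open_preimage open_Times chart_open_image[OF U(1)] chart_open_image[OF V(1)])
  have J: "J (\<phi> x, \<psi> y) = (x, y)" if "x \<in> U" "y \<in> V" for x y
    using that chart_inv[OF U(1)] chart_inv[OF V(1)] by (simp add: J_def)
  have "inj_on \<phi> U" "inj_on \<psi> V"
    using chart_inv[OF U(1)] chart_inv[OF V(1)] by (metis inj_on_inverseI)+
  then have inj: "inj_on (map_prod \<phi> \<psi>) (U \<times> V)" by (rule map_prod_inj_on)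
  \<comment> \<open>\<open>inv_into\<close> of the product chart is the pair of inverse charts only
    on the image of the chart, hence the restriction to \<open>N\<close>.\<close>
  have J': "inv_into (U \<times> V) (map_prod \<phi> \<psi>) x = J x" if "x \<in> N" for x
  proof -
    have "x \<in> \<phi> ` U \<times> \<psi> ` V" using that by (simp add: N_def)
    then obtain a b where "a \<in> U" "b \<in> V" "x = map_prod \<phi> \<psi> (a, b)" by auto
    then show ?thesis using inv_into_f_f[OF inj, of "(a, b)"] J by simp
  qed
  have "(U \<times> V, map_prod \<phi> \<psi>) \<in> prod_atlas A A" using U V by (auto simp: prod_atlas_def)
  then have "smooth_on (map_prod \<phi> \<psi> ` (U \<times> V \<inter> (\<lambda>(x, y). x \<otimes> y) -` W))
      (\<kappa> \<circ> (\<lambda>(x, y). x \<otimes> y) \<circ> inv_into (U \<times> V) (map_prod \<phi> \<psi>))"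
    using lie_group W(1) unfolding lie_group_def smooth_map_def by fastforce
  moreover have "N \<subseteq> map_prod \<phi> \<psi> ` (U \<times> V \<inter> (\<lambda>(x, y). x \<otimes> y) -` W)"
  proof
    fix x assume x: "x \<in> N"
    then obtain a b where ab: "a \<in> U" "b \<in> V" "x = (\<phi> a, \<psi> b)" by (auto simp: N_def)
    then have "a \<otimes> b \<in> W" using x J P(3) by (auto simp: N_def)
    then show "x \<in> map_prod \<phi> \<psi> ` (U \<times> V \<inter> (\<lambda>(x, y). x \<otimes> y) -` W)"
      using ab by (intro image_eqI[of _ _ "(a, b)"]) auto
  qed
  ultimately have "smooth_on N (\<kappa> \<circ> (\<lambda>(x, y). x \<otimes> y) \<circ> inv_into (U \<times> V) (map_prod \<phi> \<psi>))"
    by (rule smooth_on_subset)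
  then have "smooth_on N (\<lambda>x. \<kappa> ((\<lambda>(x, y). x \<otimes> y) (J x)))"
    by (rule smooth_on_cong[OF N, rotated]) (simp add: J')
  then have "smooth_on N (\<lambda>x. (f \<circ> inv_into W \<kappa>) (\<kappa> ((\<lambda>(x, y). x \<otimes> y) (J x))))"
    using M(3) by (rule smooth_on_compose[OF N, rotated]) (use P in \<open>auto simp: N_def\<close>)
  then have "smooth_on N (\<lambda>x. f (inv_into U \<phi> (fst x) \<otimes> inv_into V \<psi> (snd x)))"
    by (rule smooth_on_cong[OF N, rotated])
      (use P(3) chart_inv[OF W(1)] in \<open>auto simp: N_def J_def\<close>)
  then show "\<exists>N. open N \<and> (\<phi> q, \<psi> r) \<in> N \<and> N \<subseteq> \<phi> ` U \<times> \<psi> ` V \<and>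
      smooth_on N (\<lambda>x. f (inv_into U \<phi> (fst x) \<otimes> inv_into V \<psi> (snd x)))"
    using N U V P(2) J by (intro exI[of _ N]) (auto simp: N_def)
qed

lemmas smooth_op_mult' = smooth_op_flip[OF smooth_op_mult]

lemma smooth_at_left_translation: "smooth_at A (p \<otimes> q) f \<longleftrightarrow> smooth_at A q (\<lambda>x. f (p \<otimes> x))"
proof
  assume "smooth_at A q (\<lambda>x. f (p \<otimes> x))"
  then have "smooth_at A (inv p \<otimes> (p \<otimes> q)) (\<lambda>x. f (p \<otimes> x))" by simp
  from smooth_op_slice[OF smooth_op_mult this] show "smooth_at A (p \<otimes> q) f" by simp
qed (rule smooth_op_slice[OF smooth_op_mult])

lemma smooth_at_right_translation: "smooth_at A (q \<otimes> p) f \<longleftrightarrow> smooth_at A q (\<lambda>x. f (x \<otimes> p))"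
proof
  assume "smooth_at A q (\<lambda>x. f (x \<otimes> p))"
  then have "smooth_at A (q \<otimes> p \<otimes> inv p) (\<lambda>x. f (x \<otimes> p))" by simp
  from smooth_op_slice[OF smooth_op_mult' this] show "smooth_at A (q \<otimes> p) f" by simp
qed (rule smooth_op_slice[OF smooth_op_mult'])

lemma left_translation_tangent:
  "v \<in> tangent_space A q \<Longrightarrow> pushforward (\<lambda>x. p \<otimes> x) v \<in> tangent_space A (p \<otimes> q)"
  by (rule pushforward_tangent[OF continuous_translation(1) smooth_at_left_translation])

lemma right_translation_tangent:
  "v \<in> tangent_space A q \<Longrightarrow> pushforward (\<lambda>x. x \<otimes> p) v \<in> tangent_space A (q \<otimes> p)"
  by (rule pushforward_tangent[OF continuous_translation(2) smooth_at_right_translation])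

lemma left_field_apply: "left_invariant_field G v p f = v (\<lambda>q. f (p \<otimes> q))"
  by (simp add: left_invariant_field_def pushforward_def o_def)

lemma right_field_apply: "right_invariant_field G v p f = v (\<lambda>q. f (q \<otimes> p))"
  by (simp add: right_invariant_field_def pushforward_def o_def)

lemma left_field_vector_field:
  assumes "v \<in> tangent_space A \<one>"
  shows "left_invariant_field G v \<in> vector_fields A"
  unfolding vector_fields_iff
proof (intro conjI allI impI)
  show "left_invariant_field G v p \<in> tangent_space A p" for p
    using left_translation_tangent[OF assms, of p] by (simp add: left_invariant_field_def)
  show "smooth_at A p (\<lambda>q. left_invariant_field G v q f)" if "smooth_at A p f" for p f
    using smooth_op_derivative[OF smooth_op_mult _ assms, of p f] that by (simp add: left_field_apply)
qed

lemma right_field_vector_field: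
  assumes "v \<in> tangent_space A \<one>"
  shows "right_invariant_field G v \<in> vector_fields A"
  unfolding vector_fields_iff
proof (intro conjI allI impI)
  show "right_invariant_field G v p \<in> tangent_space A p" for p
    using right_translation_tangent[OF assms, of p] by (simp add: right_invariant_field_def)
  show "smooth_at A p (\<lambda>q. right_invariant_field G v q f)" if "smooth_at A p f" for p f
    using smooth_op_derivative[OF smooth_op_mult' _ assms, of p f] that by (simp add: right_field_apply)
qed

lemma left_field_one: "left_invariant_field G v \<one> = v"
  and right_field_one: "right_invariant_field G v \<one> = v"
  by (simp_all add: left_field_apply right_field_apply fun_eq_iff)

text \<open>Translating \<open>f\<close> by \<open>p\<close> carries the bracket at \<open>p\<close>
  to the bracket at the identity. Since translation also preserves non-smoothness, the two default
  values agree.\<close>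

lemma bracket_left_fields:
  "lie_bracket A (left_invariant_field G u) (left_invariant_field G v) p =
    left_invariant_field G (lie_algebra_bracket A G u v) p"
proof
  fix f
  have "smooth_at A p f \<longleftrightarrow> smooth_at A \<one> (\<lambda>q. f (p \<otimes> q))"
    using smooth_at_left_translation[of p \<one> f] by simp
  then show "lie_bracket A (left_invariant_field G u) (left_invariant_field G v) p f =
      left_invariant_field G (lie_algebra_bracket A G u v) p f"
    by (simp add: lie_bracket_def lie_algebra_bracket_def left_field_apply mult_assoc)
qed

text \<open>By associativity both sides differentiate \<open>f (x \<otimes> y)\<close> once in
  \<open>x\<close> at \<open>p\<close> and once in \<open>y\<close> at the identity, so the claim is
  the symmetry of mixed derivatives.\<close>

lemma right_left_fields_commute:
  assumes u: "u \<in> tangent_space A \<one>" and v: "v \<in> tangent_space A \<one>" and f: "smooth_at A p f"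
  shows "right_invariant_field G u p (\<lambda>q. left_invariant_field G v q f) =
    left_invariant_field G v p (\<lambda>q. right_invariant_field G u q f)"
proof -
  have "right_invariant_field G u p \<in> tangent_space A p"
    using right_field_vector_field[OF u] by (rule vector_fields_tangent)
  from smooth_op_commute[OF smooth_op_mult _ this v, of f] show ?thesis
    using f by (simp add: left_field_apply right_field_apply mult_assoc)
qed

lemma right_field_eq_0:
  assumes "right_invariant_field G u p = 0"
  shows "u = 0"
proof
  fix f
  have "right_invariant_field G u p (\<lambda>q. f (q \<otimes> inv p)) = 0" using assms by simp
  then show "u f = 0 f" by (simp add: right_field_apply mult_assoc)
qed

end

section \<open>Killing fields in an orthonormal left-invariant frame\<close>

text \<open>Index type and structure constants stay arbitrary, so that the formulas hold in every
  orthonormal left-invariant frame, in particular in a rotated one.\<close>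

locale invariant_frame = lie_group_manifold A G
  for A :: "('g::{t2_space,second_countable_topology}, 'e::euclidean_space) atlas"
    and G :: "'g monoid" (structure) +
  fixes g :: "'g \<Rightarrow> 'g tangent \<Rightarrow> 'g tangent \<Rightarrow> real"
    and D :: "('g \<Rightarrow> 'g tangent) \<Rightarrow> ('g \<Rightarrow> 'g tangent) \<Rightarrow> 'g \<Rightarrow> 'g tangent"
    and e :: "'n::finite \<Rightarrow> 'g tangent"
    and C :: "'n \<Rightarrow> 'n \<Rightarrow> 'n \<Rightarrow> real"
  assumes metric: "left_invariant_metric A G g"
    and connection: "levi_civita_connection A g D"
    and span_frame: "span (range e) = tangent_space A \<one>"
    and frame_orthonormal: "g \<one> (e i) (e j) = (if i = j then 1 else 0)"
    and frame_bracket: "lie_algebra_bracket A G (e i) (e j) = (\<Sum>k\<in>UNIV. C i j k *\<^sub>R e k)"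
begin

abbreviation E where "E i \<equiv> left_invariant_field G (e i)"

lemma frame_tangent: "e i \<in> tangent_space A \<one>"
  unfolding span_frame[symmetric] by (simp add: span_base)

lemma frame_field: "E i \<in> vector_fields A"
  by (intro left_field_vector_field frame_tangent)

lemmas frame_field_tangent = vector_fields_tangent[OF frame_field]

lemma metric_props:
  assumes "u \<in> tangent_space A p" "v \<in> tangent_space A p"
  shows metric_sym: "g p u v = g p v u"
    and metric_add: "w \<in> tangent_space A p \<Longrightarrow> g p (u + v) w = g p u w + g p v w"
    and metric_scale: "g p (r *\<^sub>R u) v = r * g p u v"
  using metric assms by (simp_all add: left_invariant_metric_def riemannian_metric_def)

lemma metric_smooth:
  assumes "X \<in> vector_fields A" "Y \<in> vector_fields A"
  shows "smooth_at A p (\<lambda>q. g q (X q) (Y q))"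
proof -
  have "smooth_fun_on A UNIV (\<lambda>q. g q (X q) (Y q))"
    using metric assms by (simp add: left_invariant_metric_def riemannian_metric_def)
  then show ?thesis by (simp add: smooth_fun_on_iff)
qed

lemma metric_zero: "w \<in> tangent_space A p \<Longrightarrow> g p 0 w = 0"
  using metric_scale[of 0 p w 0] subspace_0[OF tangent_subspace, of p] by simp

lemma metric_sum:
  assumes "finite I" "\<And>i. i \<in> I \<Longrightarrow> v i \<in> tangent_space A p" "w \<in> tangent_space A p"
  shows "g p (\<Sum>i\<in>I. r i *\<^sub>R v i) w = (\<Sum>i\<in>I. r i * g p (v i) w)"
  using assms(1,2)
proof (induction I)
  case (insert j I)
  have tangent: "(\<Sum>i\<in>I. r i *\<^sub>R v i) \<in> tangent_space A p" "r j *\<^sub>R v j \<in> tangent_space A p"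
    using insert.prems by (auto intro!: subspace_sum subspace_scale tangent_subspace)
  have "g p (r j *\<^sub>R v j) w = r j * g p (v j) w"
    by (intro metric_scale insert.prems assms(3)) simp
  moreover have "g p (\<Sum>i\<in>I. r i *\<^sub>R v i) w = (\<Sum>i\<in>I. r i * g p (v i) w)"
    by (intro insert.IH insert.prems) simp
  ultimately show ?case
    by (simp only: sum.insert[OF insert.hyps] metric_add[OF tangent(2,1) assms(3)])
qed (simp add: metric_zero assms(3))

lemma frame_field_orthonormal: "g p (E i p) (E j p) = (if i = j then 1 else 0)"
proof -
  have "g (p \<otimes> \<one>) (pushforward (\<lambda>q. p \<otimes> q) (e i)) (pushforward (\<lambda>q. p \<otimes> q) (e j)) = g \<one> (e i) (e j)"
    using metric frame_tangent unfolding left_invariant_metric_def by blast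
  then show ?thesis by (simp add: left_invariant_field_def frame_orthonormal)
qed

lemma metric_frame_sum: "g p (\<Sum>i\<in>UNIV. r i *\<^sub>R E i p) (E j p) = r j"
  by (subst metric_sum) (simp_all add: frame_field_tangent frame_field_orthonormal if_distrib cong: if_cong)

lemma frame_sum_tangent: "(\<Sum>i\<in>UNIV. r i *\<^sub>R E i p) \<in> tangent_space A p"
  by (intro subspace_sum subspace_scale tangent_subspace frame_field_tangent)

lemma sum_apply: "(\<Sum>i\<in>I. h i) x = (\<Sum>i\<in>I. h i x :: real)" for h :: "'i \<Rightarrow> 'x \<Rightarrow> real"
  by (induction I rule: infinite_finite_induct) auto

text \<open>The vector is translated to the identity, where the frame spans by assumption, and back
  again; orthonormality then identifies the coefficients.\<close>

lemma frame_expansion: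
  assumes v: "v \<in> tangent_space A p"
  shows "v = (\<Sum>i\<in>UNIV. g p v (E i p) *\<^sub>R E i p)"
proof -
  let ?w = "pushforward (\<lambda>x. inv p \<otimes> x) v"
  let ?R = "range (\<lambda>r. \<Sum>i\<in>UNIV. r i *\<^sub>R e i)"
  have "subspace ?R"
  proof (rule subspaceI)
    show "0 \<in> ?R" by (intro image_eqI[of _ _ "\<lambda>_. 0"]) auto
    show "x + y \<in> ?R" if x: "x \<in> ?R" and y: "y \<in> ?R" for x y
    proof -
      obtain r s where "x = (\<Sum>i\<in>UNIV. r i *\<^sub>R e i)" "y = (\<Sum>i\<in>UNIV. s i *\<^sub>R e i)"
        using x y by blast
      then show ?thesis
        by (intro image_eqI[of _ _ "\<lambda>i. r i + s i"]) (auto simp: scaleR_add_left sum.distrib)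
    qed
    show "c *\<^sub>R x \<in> ?R" if x: "x \<in> ?R" for c x
    proof -
      obtain r where "x = (\<Sum>i\<in>UNIV. r i *\<^sub>R e i)" using x by blast
      then show ?thesis
        by (intro image_eqI[of _ _ "\<lambda>i. c * r i"]) (auto simp: scaleR_sum_right)
    qed
  qed
  moreover have "e j \<in> ?R" for j
    by (intro image_eqI[of _ _ "\<lambda>i. if i = j then 1 else 0"]) (auto simp: if_distrib[of "\<lambda>c. c *\<^sub>R _"] cong: if_cong)
  ultimately have "tangent_space A \<one> \<subseteq> ?R" unfolding span_frame[symmetric] by (intro span_minimal) auto
  moreover have "?w \<in> tangent_space A \<one>" using left_translation_tangent[OF v, of "inv p"] by simp
  ultimately obtain r where r: "?w = (\<Sum>i\<in>UNIV. r i *\<^sub>R e i)" by blast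
  have "v f = (\<Sum>i\<in>UNIV. r i *\<^sub>R E i p) f" for f
  proof -
    have "v f = ?w (\<lambda>q. f (p \<otimes> q))" by (simp add: pushforward_def o_def)
    also have "\<dots> = (\<Sum>i\<in>UNIV. r i *\<^sub>R E i p) f"
      unfolding r by (simp add: sum_apply scaleR_fun_def left_field_apply)
    finally show ?thesis .
  qed
  then have v: "v = (\<Sum>i\<in>UNIV. r i *\<^sub>R E i p)" by (rule ext)
  show ?thesis unfolding v metric_frame_sum ..
qed

lemma frame_commutator:
  assumes f: "smooth_at A p f"
  shows "E i p (\<lambda>q. E j q f) - E j p (\<lambda>q. E i q f) = (\<Sum>k\<in>UNIV. C i j k * E k p f)"
proof -
  have "E i p (\<lambda>q. E j q f) - E j p (\<lambda>q. E i q f) = lie_bracket A (E i) (E j) p f"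
    using f by (simp add: lie_bracket_def)
  then show ?thesis
    by (simp add: bracket_left_fields frame_bracket left_field_apply sum_apply scaleR_fun_def)
qed

section \<open>Coefficient functions and the Killing equations\<close>

definition coeff :: "('g \<Rightarrow> 'g tangent) \<Rightarrow> 'n \<Rightarrow> 'g \<Rightarrow> real"
  where "coeff X i p = g p (X p) (E i p)"

lemma coeff_smooth: "X \<in> vector_fields A \<Longrightarrow> smooth_at A p (coeff X i)"
  unfolding coeff_def[abs_def] by (intro metric_smooth frame_field)

lemma field_expansion: "X \<in> vector_fields A \<Longrightarrow> X p = (\<Sum>i\<in>UNIV. coeff X i p *\<^sub>R E i p)"
  unfolding coeff_def by (intro frame_expansion vector_fields_tangent)

lemma field_apply: "X \<in> vector_fields A \<Longrightarrow> X p f = (\<Sum>i\<in>UNIV. coeff X i p * E i p f)"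
  by (subst field_expansion) (auto simp: sum_apply scaleR_fun_def)

lemma frame_combination_field:
  "(\<And>i p. smooth_at A p (x i)) \<Longrightarrow> (\<lambda>p. \<Sum>i\<in>I. x i p *\<^sub>R E i p) \<in> vector_fields A"
proof (induction I rule: infinite_finite_induct)
  case (insert i I)
  then show ?case
    unfolding sum.insert[OF insert.hyps] by (intro vector_fields_add vector_fields_scaleR frame_field) auto
qed (auto simp: vector_fields_iff subspace_0[OF tangent_subspace] smooth_at_const)

lemma coeff_frame_combination: "coeff (\<lambda>p. \<Sum>i\<in>UNIV. x i p *\<^sub>R E i p) = x"
  unfolding coeff_def by (intro ext) (rule metric_frame_sum)

lemma derivative_frame_sum:
  assumes v: "v \<in> tangent_space A p" and "\<And>i. smooth_at A p (x i)" "\<And>i. smooth_at A p (h i)"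
  shows "v (\<lambda>q. \<Sum>i\<in>UNIV. x i q * h i q) = (\<Sum>i\<in>UNIV. x i p * v (h i) + v (x i) * h i p)"
proof -
  have "v (\<lambda>q. \<Sum>i\<in>UNIV. x i q * h i q) = (\<Sum>i\<in>UNIV. v (\<lambda>q. x i q * h i q))"
    by (intro tangent_sum[OF v] smooth_at_mult assms)
  then show ?thesis by (simp only: tangent_mult[OF assms])
qed

lemma bracket_frame_field:
  assumes X: "X \<in> vector_fields A"
  shows "lie_bracket A X (E j) p =
    (\<Sum>k\<in>UNIV. ((\<Sum>i\<in>UNIV. coeff X i p * C i j k) - E j p (coeff X k)) *\<^sub>R E k p)"
proof
  fix f
  show "lie_bracket A X (E j) p f =
    (\<Sum>k\<in>UNIV. ((\<Sum>i\<in>UNIV. coeff X i p * C i j k) - E j p (coeff X k)) *\<^sub>R E k p) f"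
  proof (cases "smooth_at A p f")
    case f: True
    have "lie_bracket A X (E j) p f = X p (\<lambda>q. E j q f) - E j p (\<lambda>q. X q f)"
      using f by (simp add: lie_bracket_def)
    also have "X p (\<lambda>q. E j q f) = (\<Sum>i\<in>UNIV. coeff X i p * E i p (\<lambda>q. E j q f))"
      by (rule field_apply[OF X])
    also have "E j p (\<lambda>q. X q f) =
        (\<Sum>i\<in>UNIV. coeff X i p * E j p (\<lambda>q. E i q f) + E j p (coeff X i) * E i p f)"
    proof -
      have "(\<lambda>q. X q f) = (\<lambda>q. \<Sum>i\<in>UNIV. coeff X i q * E i q f)"
        by (rule ext) (rule field_apply[OF X])
      then show ?thesis
        by (simp only:) (intro derivative_frame_sum frame_field_tangent coeff_smooth X
            vector_fields_smooth[OF frame_field f])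
    qed
    also have "(\<Sum>i\<in>UNIV. coeff X i p * E i p (\<lambda>q. E j q f)) - \<dots> =
        (\<Sum>i\<in>UNIV. coeff X i p * (E i p (\<lambda>q. E j q f) - E j p (\<lambda>q. E i q f))) - (\<Sum>i\<in>UNIV. E j p (coeff X i) * E i p f)"
      by (simp add: algebra_simps sum.distrib sum_subtractf)
    also have "\<dots> = (\<Sum>i\<in>UNIV. coeff X i p * (\<Sum>k\<in>UNIV. C i j k * E k p f)) - (\<Sum>k\<in>UNIV. E j p (coeff X k) * E k p f)"
      by (simp add: frame_commutator[OF f])
    also have "(\<Sum>i\<in>UNIV. coeff X i p * (\<Sum>k\<in>UNIV. C i j k * E k p f)) =
        (\<Sum>k\<in>UNIV. (\<Sum>i\<in>UNIV. coeff X i p * C i j k) * E k p f)"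
      by (simp add: sum_distrib_left sum_distrib_right mult.assoc) (rule sum.swap)
    finally show ?thesis by (simp add: sum_apply scaleR_fun_def sum_subtractf left_diff_distrib)
  next
    case False
    have "(\<Sum>k\<in>UNIV. ((\<Sum>i\<in>UNIV. coeff X i p * C i j k) - E j p (coeff X k)) *\<^sub>R E k p) f = 0"
      by (rule tangent_nonsmooth[OF frame_sum_tangent False])
    then show ?thesis using False by (simp add: lie_bracket_def)
  qed
qed

lemma bracket_expansion:
  assumes X: "X \<in> vector_fields A" and Y: "Y \<in> vector_fields A"
  shows "lie_bracket A X Y p =
    (\<Sum>j\<in>UNIV. coeff Y j p *\<^sub>R lie_bracket A X (E j) p + X p (coeff Y j) *\<^sub>R E j p)"
proof
  fix f
  show "lie_bracket A X Y p f =
    (\<Sum>j\<in>UNIV. coeff Y j p *\<^sub>R lie_bracket A X (E j) p + X p (coeff Y j) *\<^sub>R E j p) f"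
  proof (cases "smooth_at A p f")
    case f: True
    have "X p (\<lambda>q. Y q f) = (\<Sum>i\<in>UNIV. coeff Y i p * X p (\<lambda>q. E i q f) + X p (coeff Y i) * E i p f)"
    proof -
      have "(\<lambda>q. Y q f) = (\<lambda>q. \<Sum>i\<in>UNIV. coeff Y i q * E i q f)"
        by (rule ext) (rule field_apply[OF Y])
      then show ?thesis
        by (simp only:) (intro derivative_frame_sum vector_fields_tangent[OF X] coeff_smooth Y
            vector_fields_smooth[OF frame_field f])
    qed
    moreover have "Y p (\<lambda>q. X q f) = (\<Sum>j\<in>UNIV. coeff Y j p * E j p (\<lambda>q. X q f))"
      by (rule field_apply[OF Y])
    ultimately show ?thesis using f
      by (simp add: lie_bracket_def sum_apply scaleR_fun_def sum.distrib sum_subtractf algebra_simps)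
  next
    case False
    then have "E j p f = 0" for j using tangent_nonsmooth[OF frame_field_tangent] by blast
    then show ?thesis using False by (simp add: lie_bracket_def sum_apply scaleR_fun_def)
  qed
qed

lemma metric_coeff:
  assumes "X \<in> vector_fields A" "Y \<in> vector_fields A"
  shows "g p (X p) (Y p) = (\<Sum>i\<in>UNIV. coeff X i p * coeff Y i p)"
proof -
  have "g p (X p) (Y p) = (\<Sum>i\<in>UNIV. coeff X i p * g p (E i p) (Y p))"
    by (subst field_expansion[OF assms(1)]) (intro metric_sum finite frame_field_tangent vector_fields_tangent[OF assms(2)])
  moreover have "g p (E i p) (Y p) = coeff Y i p" for i
    unfolding coeff_def by (intro metric_sym frame_field_tangent vector_fields_tangent[OF assms(2)])
  ultimately show ?thesis by simp
qed

text \<open>The Lie derivative of the metric on two frame fields. Their inner products are constant,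
  so only the brackets of the field with the frame contribute.\<close>

definition killing_coeffs :: "('n \<Rightarrow> 'g \<Rightarrow> real) \<Rightarrow> bool" where
  "killing_coeffs x \<longleftrightarrow> (\<forall>i p. smooth_at A p (x i)) \<and>
    (\<forall>j k p. E j p (x k) + E k p (x j) = (\<Sum>i\<in>UNIV. x i p * (C i j k + C i k j)))"

lemma killing_field_iff:
  assumes X: "X \<in> vector_fields A"
  shows "killing_field A g X \<longleftrightarrow> killing_coeffs (coeff X)"
proof -
  \<comment> \<open>The component of \<open>lie_bracket A X (E j)\<close> along \<open>E k\<close>;
    the Killing condition amounts to its skewness in \<open>j\<close> and \<open>k\<close>.\<close>
  define W where "W j k p = (\<Sum>i\<in>UNIV. coeff X i p * C i j k) - E j p (coeff X k)" for j k p
  have bracket: "lie_bracket A X (E j) p = (\<Sum>k\<in>UNIV. W j k p *\<^sub>R E k p)" for j p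
    unfolding W_def by (rule bracket_frame_field[OF X])
  have W: "g p (lie_bracket A X (E j) p) (E k p) = W j k p" for j k p
    unfolding bracket by (rule metric_frame_sum)
  have W': "g p (E k p) (lie_bracket A X (E j) p) = W j k p" for j k p
  proof -
    have "g p (E k p) (lie_bracket A X (E j) p) = g p (lie_bracket A X (E j) p) (E k p)"
      unfolding bracket by (rule metric_sym[OF frame_field_tangent frame_sum_tangent])
    then show ?thesis using W by simp
  qed
  have iff: "killing_coeffs (coeff X) \<longleftrightarrow> (\<forall>j k p. W j k p + W k j p = 0)"
    unfolding killing_coeffs_def W_def by (auto simp: coeff_smooth[OF X] algebra_simps sum.distrib)
  show ?thesis unfolding iff
  proof
    assume K: "killing_field A g X"
    show "\<forall>j k p. W j k p + W k j p = 0"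
    proof (intro allI)
      fix j k p
      have "X p (\<lambda>q. g q (E j q) (E k q)) = W j k p + W k j p"
        using K frame_field unfolding killing_field_def by (simp add: W W')
      then show "W j k p + W k j p = 0"
        by (simp add: frame_field_orthonormal tangent_const[OF vector_fields_tangent[OF X]])
    qed
  next
    assume skew: "\<forall>j k p. W j k p + W k j p = 0"
    have *: "g p (lie_bracket A X Y p) (Z p) =
        (\<Sum>j\<in>UNIV. X p (coeff Y j) * coeff Z j p) + (\<Sum>j\<in>UNIV. \<Sum>k\<in>UNIV. coeff Y j p * coeff Z k p * W j k p)"
      and **: "g p (Z p) (lie_bracket A X Y p) = g p (lie_bracket A X Y p) (Z p)"
      if Y: "Y \<in> vector_fields A" and Z: "Z \<in> vector_fields A" for Y Z p
    proof -
      let ?b = "\<lambda>k. (\<Sum>j\<in>UNIV. coeff Y j p * W j k p) + X p (coeff Y k)"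
      have b: "lie_bracket A X Y p = (\<Sum>k\<in>UNIV. ?b k *\<^sub>R E k p)"
      proof -
        have "(\<Sum>j\<in>UNIV. \<Sum>k\<in>UNIV. (coeff Y j p * W j k p) *\<^sub>R E k p) =
            (\<Sum>k\<in>UNIV. \<Sum>j\<in>UNIV. (coeff Y j p * W j k p) *\<^sub>R E k p)" by (rule sum.swap)
        then show ?thesis unfolding bracket_expansion[OF X Y] bracket
          by (simp add: scaleR_sum_right scaleR_sum_left scaleR_add_left sum.distrib)
      qed
      have c: "g p (E k p) (Z p) = coeff Z k p" for k
        unfolding coeff_def by (intro metric_sym frame_field_tangent vector_fields_tangent[OF Z])
      have "g p (lie_bracket A X Y p) (Z p) = (\<Sum>k\<in>UNIV. ?b k * coeff Z k p)"
        unfolding b c[symmetric] by (intro metric_sum finite frame_field_tangent vector_fields_tangent[OF Z])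
      also have "(\<Sum>k\<in>UNIV. ?b k * coeff Z k p) = (\<Sum>j\<in>UNIV. X p (coeff Y j) * coeff Z j p) +
          (\<Sum>k\<in>UNIV. \<Sum>j\<in>UNIV. coeff Y j p * coeff Z k p * W j k p)"
        by (simp add: algebra_simps sum.distrib sum_distrib_left)
      also have "(\<Sum>k\<in>UNIV. \<Sum>j\<in>UNIV. coeff Y j p * coeff Z k p * W j k p) =
          (\<Sum>j\<in>UNIV. \<Sum>k\<in>UNIV. coeff Y j p * coeff Z k p * W j k p)" by (rule sum.swap)
      finally show "g p (lie_bracket A X Y p) (Z p) =
        (\<Sum>j\<in>UNIV. X p (coeff Y j) * coeff Z j p) + (\<Sum>j\<in>UNIV. \<Sum>k\<in>UNIV. coeff Y j p * coeff Z k p * W j k p)" .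
      show "g p (Z p) (lie_bracket A X Y p) = g p (lie_bracket A X Y p) (Z p)"
        unfolding b by (intro metric_sym vector_fields_tangent[OF Z] frame_sum_tangent)
    qed
    show "killing_field A g X"
      unfolding killing_field_def
    proof (intro conjI X ballI allI)
      fix Y Z p assume Y: "Y \<in> vector_fields A" and Z: "Z \<in> vector_fields A"
      \<comment> \<open>For general \<open>Y\<close> and \<open>Z\<close> the derivatives of their
        coefficients account for the product rule. What is left contracts \<open>W\<close> with an
        expression symmetric in its indices and cancels by skewness.\<close>
      have "(\<Sum>j\<in>UNIV. \<Sum>k\<in>UNIV. coeff Y j p * coeff Z k p * W j k p) + (\<Sum>j\<in>UNIV. \<Sum>k\<in>UNIV. coeff Z j p * coeff Y k p * W j k p)
          = (\<Sum>j\<in>UNIV. \<Sum>k\<in>UNIV. coeff Y j p * coeff Z k p * W j k p) + (\<Sum>k\<in>UNIV. \<Sum>j\<in>UNIV. coeff Z j p * coeff Y k p * W j k p)"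
        by (subst (2) sum.swap) simp
      also have "\<dots> = (\<Sum>j\<in>UNIV. \<Sum>k\<in>UNIV. coeff Y j p * coeff Z k p * (W j k p + W k j p))"
        by (simp add: sum.distrib[symmetric] algebra_simps)
      finally have 0: "(\<Sum>j\<in>UNIV. \<Sum>k\<in>UNIV. coeff Y j p * coeff Z k p * W j k p) + (\<Sum>j\<in>UNIV. \<Sum>k\<in>UNIV. coeff Z j p * coeff Y k p * W j k p) = 0"
        using skew by simp
      have "X p (\<lambda>q. g q (Y q) (Z q)) = (\<Sum>j\<in>UNIV. coeff Y j p * X p (coeff Z j) + X p (coeff Y j) * coeff Z j p)"
        unfolding metric_coeff[OF Y Z] by (intro derivative_frame_sum vector_fields_tangent[OF X] coeff_smooth Y Z)
      also have "\<dots> = g p (lie_bracket A X Y p) (Z p) + g p (Y p) (lie_bracket A X Z p)"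
        using 0 by (simp add: *[OF Y Z] *[OF Z Y] **[OF Z Y] sum.distrib mult.commute)
      finally show "X p (\<lambda>q. g q (Y q) (Z q)) = g p (lie_bracket A X Y p) (Z p) + g p (Y p) (lie_bracket A X Z p)" .
    qed
  qed
qed

subsection \<open>The Levi-Civita connection\<close>

text \<open>Koszul's formula in an orthonormal left-invariant frame: the component along
  \<open>E k\<close> of the covariant derivative of \<open>E i\<close> in the direction
  \<open>E j\<close>.\<close>

definition christoffel :: "'n \<Rightarrow> 'n \<Rightarrow> 'n \<Rightarrow> real"
  where "christoffel j i k = (C j i k - C i k j + C k j i) / 2"

lemma connection_props:
  shows connection_field: "X \<in> vector_fields A \<Longrightarrow> Y \<in> vector_fields A \<Longrightarrow> D X Y \<in> vector_fields A"
    and connection_add_left: "X \<in> vector_fields A \<Longrightarrow> X' \<in> vector_fields A \<Longrightarrow> Y \<in> vector_fields A \<Longrightarrow>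
      D (X + X') Y = D X Y + D X' Y"
    and connection_add_right: "X \<in> vector_fields A \<Longrightarrow> Y \<in> vector_fields A \<Longrightarrow> Y' \<in> vector_fields A \<Longrightarrow>
      D X (Y + Y') = D X Y + D X Y'"
    and torsion_free: "X \<in> vector_fields A \<Longrightarrow> Y \<in> vector_fields A \<Longrightarrow> D X Y - D Y X = lie_bracket A X Y"
    and metric_compatible: "X \<in> vector_fields A \<Longrightarrow> Y \<in> vector_fields A \<Longrightarrow> Z \<in> vector_fields A \<Longrightarrow>
      X p (\<lambda>q. g q (Y q) (Z q)) = g p (D X Y p) (Z p) + g p (Y p) (D X Z p)"
  using connection unfolding levi_civita_connection_def affine_connection_def by blast+

lemma connection_scale:
  assumes "\<And>p. smooth_at A p f" "X \<in> vector_fields A" "Y \<in> vector_fields A"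
  shows connection_scale_left: "D (\<lambda>p. f p *\<^sub>R X p) Y = (\<lambda>p. f p *\<^sub>R D X Y p)"
    and connection_scale_right: "D X (\<lambda>p. f p *\<^sub>R Y p) = (\<lambda>p. X p f *\<^sub>R Y p + f p *\<^sub>R D X Y p)"
proof -
  have "smooth_fun_on A UNIV f" using assms(1) by (simp add: smooth_fun_on_iff)
  then show "D (\<lambda>p. f p *\<^sub>R X p) Y = (\<lambda>p. f p *\<^sub>R D X Y p)"
    "D X (\<lambda>p. f p *\<^sub>R Y p) = (\<lambda>p. X p f *\<^sub>R Y p + f p *\<^sub>R D X Y p)"
    using connection assms(2,3) unfolding levi_civita_connection_def affine_connection_def by blast+
qed

text \<open>\<open>D\<close> is known through its axioms only. Metric compatibility makes the
  components skew in the last two indices, and vanishing torsion prescribes their skew part in the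
  first two; three instances of each determine them.\<close>

lemma connection_frame: "D (E j) (E i) p = (\<Sum>k\<in>UNIV. christoffel j i k *\<^sub>R E k p)"
proof -
  have tangent: "D (E j) (E i) p \<in> tangent_space A p" for i j
    by (intro vector_fields_tangent connection_field frame_field)
  define c where "c j i k = g p (D (E j) (E i) p) (E k p)" for i j k
  have skew: "c j i k + c j k i = 0" for i j k
  proof -
    have "E j p (\<lambda>q. g q (E i q) (E k q)) = c j i k + g p (E i p) (D (E j) (E k) p)"
      unfolding c_def by (intro metric_compatible frame_field)
    also have "g p (E i p) (D (E j) (E k) p) = c j k i"
      unfolding c_def by (intro metric_sym frame_field_tangent tangent)
    finally show ?thesis
      by (simp add: frame_field_orthonormal tangent_const[OF frame_field_tangent])
  qed
  have torsion: "c j i k - c i j k = C j i k" for i j k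
  proof -
    have "D (E j) (E i) p - D (E i) (E j) p = lie_bracket A (E j) (E i) p"
      using torsion_free[OF frame_field[of j] frame_field[of i]] by (simp add: fun_eq_iff)
    also have "\<dots> = (\<Sum>k\<in>UNIV. C j i k *\<^sub>R E k p)"
      by (simp add: bracket_left_fields frame_bracket left_field_apply fun_eq_iff sum_apply scaleR_fun_def)
    finally have "D (E j) (E i) p = (\<Sum>k\<in>UNIV. C j i k *\<^sub>R E k p) + D (E i) (E j) p"
      by (simp add: algebra_simps)
    then have "c j i k = g p (\<Sum>k\<in>UNIV. C j i k *\<^sub>R E k p) (E k p) + c i j k"
      unfolding c_def by (simp add: metric_add frame_sum_tangent tangent frame_field_tangent)
    then show ?thesis by (simp add: metric_frame_sum)
  qed
  have "2 * c j i k = C j i k - C i k j + C k j i" for k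
    using skew[of j i k] skew[of i j k] skew[of k i j] torsion[of j i k] torsion[of i k j] torsion[of k j i]
    by linarith
  then have "c j i k = christoffel j i k" for k
    unfolding christoffel_def by (metis nonzero_mult_div_cancel_left zero_neq_numeral)
  then show ?thesis using frame_expansion[OF tangent[of j i]] unfolding c_def by simp
qed

lemma connection_combination:
  assumes x: "\<And>i p. smooth_at A p (x i)" and Y: "Y \<in> vector_fields A"
  shows "finite I \<Longrightarrow> D (\<lambda>p. \<Sum>i\<in>I. x i p *\<^sub>R E i p) Y p = (\<Sum>i\<in>I. x i p *\<^sub>R D (E i) Y p)"
    and "finite I \<Longrightarrow> D Y (\<lambda>p. \<Sum>i\<in>I. x i p *\<^sub>R E i p) p = (\<Sum>i\<in>I. Y p (x i) *\<^sub>R E i p + x i p *\<^sub>R D Y (E i) p)"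
proof -
  \<comment> \<open>The axioms do not mention the zero field; it is treated as a product with the
    constant function 0.\<close>
  have 0: "D (\<lambda>p. 0) Y p = 0" "D Y (\<lambda>p. 0) p = 0"
    using connection_scale_left[OF smooth_at_const Y Y, of 0] connection_scale_right[OF smooth_at_const Y Y, of 0]
    unfolding scaleR_zero_left tangent_const[OF vector_fields_tangent[OF Y]] add_0 by (simp_all only:)
  have s: "(\<lambda>p. x i p *\<^sub>R E i p) \<in> vector_fields A" for i
    by (intro vector_fields_scaleR x frame_field)
  have sum: "(\<lambda>p. \<Sum>i\<in>insert j I. x i p *\<^sub>R E i p) = (\<lambda>p. x j p *\<^sub>R E j p) + (\<lambda>p. \<Sum>i\<in>I. x i p *\<^sub>R E i p)"
    if "finite I" "j \<notin> I" for I j using that by (simp add: plus_fun_def[of "\<lambda>p. x j p *\<^sub>R E j p"])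
  show "finite I \<Longrightarrow> D (\<lambda>p. \<Sum>i\<in>I. x i p *\<^sub>R E i p) Y p = (\<Sum>i\<in>I. x i p *\<^sub>R D (E i) Y p)"
  proof (induction I rule: finite_induct)
    case (insert j I)
    then show ?case
      unfolding sum[OF insert(1,2)] connection_add_left[OF s frame_combination_field[OF x] Y]
        connection_scale_left[OF x frame_field Y] by simp
  qed (simp only: 0 sum.empty)
  show "finite I \<Longrightarrow> D Y (\<lambda>p. \<Sum>i\<in>I. x i p *\<^sub>R E i p) p = (\<Sum>i\<in>I. Y p (x i) *\<^sub>R E i p + x i p *\<^sub>R D Y (E i) p)"
  proof (induction I rule: finite_induct)
    case (insert j I)
    then show ?case
      unfolding sum[OF insert(1,2)] connection_add_right[OF Y s frame_combination_field[OF x]]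
        connection_scale_right[OF x Y frame_field] by simp
  qed (simp only: 0 sum.empty)
qed

definition parallel_coeffs :: "('n \<Rightarrow> 'g \<Rightarrow> real) \<Rightarrow> bool" where
  "parallel_coeffs x \<longleftrightarrow> (\<forall>j k. e j (x k) + (\<Sum>i\<in>UNIV. x i \<one> * christoffel j i k) = 0)"

text \<open>The connection is linear over functions in its first argument, so it is enough to test
  the frame directions.\<close>

lemma parallel_at_iff:
  assumes X: "X \<in> vector_fields A"
  shows "parallel_at A D \<one> X \<longleftrightarrow> parallel_coeffs (coeff X)"
proof -
  let ?P = "\<lambda>j k. e j (coeff X k) + (\<Sum>i\<in>UNIV. coeff X i \<one> * christoffel j i k)"
  have X': "X = (\<lambda>p. \<Sum>i\<in>UNIV. coeff X i p *\<^sub>R E i p)" using field_expansion[OF X] by (rule ext)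
  have DE: "D (E j) X \<one> = (\<Sum>k\<in>UNIV. ?P j k *\<^sub>R E k \<one>)" for j
  proof -
    have "D (E j) X \<one> = (\<Sum>k\<in>UNIV. E j \<one> (coeff X k) *\<^sub>R E k \<one> + coeff X k \<one> *\<^sub>R D (E j) (E k) \<one>)"
      by (subst X') (intro connection_combination coeff_smooth X frame_field finite)
    also have "\<dots> = (\<Sum>k\<in>UNIV. e j (coeff X k) *\<^sub>R E k \<one>) +
        (\<Sum>i\<in>UNIV. \<Sum>k\<in>UNIV. (coeff X i \<one> * christoffel j i k) *\<^sub>R E k \<one>)"
      by (simp add: connection_frame sum.distrib scaleR_sum_right left_field_one)
    also have "(\<Sum>i\<in>UNIV. \<Sum>k\<in>UNIV. (coeff X i \<one> * christoffel j i k) *\<^sub>R E k \<one>) =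
        (\<Sum>k\<in>UNIV. \<Sum>i\<in>UNIV. (coeff X i \<one> * christoffel j i k) *\<^sub>R E k \<one>)" by (rule sum.swap)
    finally show ?thesis unfolding scaleR_add_left sum.distrib scaleR_sum_left .
  qed
  show ?thesis
  proof
    assume "parallel_at A D \<one> X"
    then have "(\<Sum>k\<in>UNIV. ?P j k *\<^sub>R E k \<one>) = 0" for j
      using frame_field DE by (simp add: parallel_at_def)
    then have "?P j k = 0" for j k
      using metric_frame_sum[of \<one> "?P j" k] metric_zero[OF frame_field_tangent] by simp
    then show "parallel_coeffs (coeff X)" by (simp add: parallel_coeffs_def)
  next
    assume "parallel_coeffs (coeff X)"
    then have 0: "D (E j) X \<one> = 0" for j unfolding DE by (simp add: parallel_coeffs_def)
    have "D Y X \<one> = 0" if Y: "Y \<in> vector_fields A" for Y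
    proof -
      have Y': "Y = (\<lambda>p. \<Sum>i\<in>UNIV. coeff Y i p *\<^sub>R E i p)" using field_expansion[OF Y] by (rule ext)
      have "D (\<lambda>p. \<Sum>i\<in>UNIV. coeff Y i p *\<^sub>R E i p) X \<one> = (\<Sum>i\<in>UNIV. coeff Y i \<one> *\<^sub>R D (E i) X \<one>)"
        by (intro connection_combination coeff_smooth X Y finite)
      then show ?thesis using Y' 0 by simp
    qed
    then show "parallel_at A D \<one> X" by (simp add: parallel_at_def)
  qed
qed

text \<open>Because the frame is global, fields and tuples of coefficient functions correspond. What
  remains is a question about functions with prescribed derivatives along the frame.\<close>

lemma symmetry_space_eq:
  "symmetry_space A g D \<one> =
    {\<Sum>i\<in>UNIV. x i \<one> *\<^sub>R e i | x. killing_coeffs x \<and> parallel_coeffs x}" (is "_ = ?S")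
proof (intro equalityI subsetI)
  fix v assume "v \<in> symmetry_space A g D \<one>"
  then obtain X where v: "v = X \<one>" and K: "killing_field A g X" "parallel_at A D \<one> X"
    by (auto simp: symmetry_space_def)
  then have X: "X \<in> vector_fields A" by (simp add: killing_field_def)
  then have "v = (\<Sum>i\<in>UNIV. coeff X i \<one> *\<^sub>R e i)"
    unfolding v by (subst field_expansion) (auto simp: left_field_one)
  then show "v \<in> ?S" using K by (auto simp: killing_field_iff[OF X] parallel_at_iff[OF X])
next
  fix v assume "v \<in> ?S"
  then obtain x where v: "v = (\<Sum>i\<in>UNIV. x i \<one> *\<^sub>R e i)" and K: "killing_coeffs x" "parallel_coeffs x"
    by blast
  let ?X = "\<lambda>p. \<Sum>i\<in>UNIV. x i p *\<^sub>R E i p"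
  have X: "?X \<in> vector_fields A" using K(1) by (intro frame_combination_field) (simp add: killing_coeffs_def)
  have "v = ?X \<one>" by (simp add: v left_field_one)
  moreover have "killing_field A g ?X" "parallel_at A D \<one> ?X"
    using K by (simp_all add: killing_field_iff[OF X] parallel_at_iff[OF X] coeff_frame_combination)
  ultimately show "v \<in> symmetry_space A g D \<one>"
    unfolding symmetry_space_def by (intro CollectI exI[of _ ?X] conjI)
qed

lemma killing_coeffs_lincomb:
  assumes "killing_coeffs x" "killing_coeffs y"
  shows "killing_coeffs (\<lambda>i p. r * x i p + s * y i p)"
proof -
  have sm: "smooth_at A p (x i)" "smooth_at A p (y i)" for i p
    using assms by (auto simp: killing_coeffs_def)
  have "E j p (\<lambda>p. r * x i p + s * y i p) = r * E j p (x i) + s * E j p (y i)" for i j p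
    by (simp add: tangent_add[OF frame_field_tangent] tangent_cmult[OF frame_field_tangent] smooth_at_mult smooth_at_const sm)
  moreover have "(\<Sum>i\<in>UNIV. (r * x i p + s * y i p) * c i) =
      r * (\<Sum>i\<in>UNIV. x i p * c i) + s * (\<Sum>i\<in>UNIV. y i p * c i)" for c p
    by (simp add: sum_distrib_left sum.distrib algebra_simps)
  moreover have "r * a + s * b + (r * a' + s * b') = r * (a + a') + s * (b + b')" for a b a' b'
    by (simp add: algebra_simps)
  ultimately show ?thesis using assms unfolding killing_coeffs_def
    by (simp only: smooth_at_add smooth_at_mult smooth_at_const simp_thms)
qed

lemma parallel_coeffs_lincomb:
  assumes "killing_coeffs x" "killing_coeffs y" "parallel_coeffs x" "parallel_coeffs y"
  shows "parallel_coeffs (\<lambda>i p. r * x i p + s * y i p)"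
  unfolding parallel_coeffs_def
proof (intro allI)
  fix j k
  have sm: "smooth_at A p (x i)" "smooth_at A p (y i)" for i p
    using assms by (auto simp: killing_coeffs_def)
  have "e j (\<lambda>p. r * x k p + s * y k p) + (\<Sum>i\<in>UNIV. (r * x i \<one> + s * y i \<one>) * christoffel j i k) =
     r * (e j (x k) + (\<Sum>i\<in>UNIV. x i \<one> * christoffel j i k)) + s * (e j (y k) + (\<Sum>i\<in>UNIV. y i \<one> * christoffel j i k))"
    by (simp add: tangent_add[OF frame_tangent] tangent_cmult[OF frame_tangent] smooth_at_mult smooth_at_const sm
       algebra_simps sum.distrib sum_distrib_left)
  then show "e j (\<lambda>p. r * x k p + s * y k p) + (\<Sum>i\<in>UNIV. (r * x i \<one> + s * y i \<one>) * christoffel j i k) = 0"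
    using assms(3,4) by (simp add: parallel_coeffs_def)
qed

lemma symmetry_space_subspace: "subspace (symmetry_space A g D \<one>)"
proof -
  have K0: "killing_coeffs (\<lambda>i p. 0)" "parallel_coeffs (\<lambda>i p. 0)"
    by (simp_all add: killing_coeffs_def parallel_coeffs_def smooth_at_const
        tangent_const[OF frame_field_tangent] tangent_const[OF frame_tangent])
  have lin: "r *\<^sub>R u + s *\<^sub>R v \<in> symmetry_space A g D \<one>"
    if u: "u \<in> symmetry_space A g D \<one>" and v: "v \<in> symmetry_space A g D \<one>" for r s u v
  proof -
    obtain x where x: "u = (\<Sum>i\<in>UNIV. x i \<one> *\<^sub>R e i)" "killing_coeffs x" "parallel_coeffs x"
      using u unfolding symmetry_space_eq by (elim CollectE exE conjE) (rule that)
    obtain y where y: "v = (\<Sum>i\<in>UNIV. y i \<one> *\<^sub>R e i)" "killing_coeffs y" "parallel_coeffs y"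
      using v unfolding symmetry_space_eq by (elim CollectE exE conjE) (rule that)
    have "r *\<^sub>R u + s *\<^sub>R v = (\<Sum>i\<in>UNIV. (r * x i \<one> + s * y i \<one>) *\<^sub>R e i)"
      by (simp add: x(1) y(1) scaleR_sum_right scaleR_add_left sum.distrib)
    then show ?thesis
      unfolding symmetry_space_eq
      using killing_coeffs_lincomb[OF x(2) y(2)] parallel_coeffs_lincomb[OF x(2) y(2) x(3) y(3)]
      by (intro CollectI exI[of _ "\<lambda>i p. r * x i p + s * y i p"] conjI)
  qed
  have "0 \<in> symmetry_space A g D \<one>" unfolding symmetry_space_eq using K0 by force
  then show ?thesis
    using lin[of _ _ 1 1] lin[of _ _ _ 0] by (intro subspaceI) auto
qed

subsection \<open>Right-invariant fields\<close>

text \<open>The matrix of the adjoint action of the inverse of the argument.\<close>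

definition adj :: "'n \<Rightarrow> 'n \<Rightarrow> 'g \<Rightarrow> real"
  where "adj k = coeff (right_invariant_field G (e k))"

lemma right_frame_field: "right_invariant_field G (e k) \<in> vector_fields A"
  by (intro right_field_vector_field frame_tangent)

lemma adj_smooth: "smooth_at A p (adj k i)"
  unfolding adj_def by (rule coeff_smooth[OF right_frame_field])

lemma adj_one: "adj k i \<one> = (if k = i then 1 else 0)"
  by (simp add: adj_def coeff_def right_field_one left_field_one frame_orthonormal)

text \<open>The bracket of a right-invariant field with \<open>E j\<close> vanishes; written in the
  frame, this is a linear differential system for the matrix entries.\<close>

lemma adj_derivative: "E j p (adj k i) = (\<Sum>l\<in>UNIV. adj k l p * C l j i)"
proof -
  let ?R = "right_invariant_field G (e k)"
  have "lie_bracket A ?R (E j) p f = 0" for f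
    using right_left_fields_commute[OF frame_tangent frame_tangent] by (simp add: lie_bracket_def)
  then have "lie_bracket A ?R (E j) p = 0" by (simp add: fun_eq_iff)
  then have "(\<Sum>i\<in>UNIV. ((\<Sum>l\<in>UNIV. adj k l p * C l j i) - E j p (adj k i)) *\<^sub>R E i p) = 0"
    unfolding bracket_frame_field[OF right_frame_field] adj_def by simp
  then show ?thesis
    using metric_frame_sum[of p "\<lambda>i. (\<Sum>l\<in>UNIV. adj k l p * C l j i) - E j p (adj k i)" i]
      metric_zero[OF frame_field_tangent] by simp
qed

text \<open>A relation between the rows at \<open>p\<close> is a right-invariant field vanishing at
  \<open>p\<close>, and the generator of such a field is zero.\<close>

lemma adj_nondegenerate:
  assumes "\<And>i. (\<Sum>k\<in>UNIV. r k * adj k i p) = 0"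
  shows "r k = 0"
proof -
  let ?v = "\<Sum>k\<in>UNIV. r k *\<^sub>R e k"
  have "right_invariant_field G ?v p = (\<Sum>k\<in>UNIV. r k *\<^sub>R right_invariant_field G (e k) p)"
    by (simp add: fun_eq_iff right_field_apply sum_apply scaleR_fun_def)
  also have "\<dots> = (\<Sum>k\<in>UNIV. \<Sum>i\<in>UNIV. (r k * adj k i p) *\<^sub>R E i p)"
    unfolding field_expansion[OF right_frame_field, of _ p] adj_def by (simp add: scaleR_sum_right)
  also have "\<dots> = (\<Sum>i\<in>UNIV. \<Sum>k\<in>UNIV. (r k * adj k i p) *\<^sub>R E i p)" by (rule sum.swap)
  also have "\<dots> = 0" using assms by (simp add: scaleR_sum_left[symmetric])
  finally have "(\<Sum>k\<in>UNIV. r k *\<^sub>R E k \<one>) = 0" using right_field_eq_0 by (simp add: left_field_one)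
  then show ?thesis
    using metric_frame_sum[of \<one> r k] metric_zero[OF frame_field_tangent] by simp
qed

end

section \<open>Semidirect products of the line and the plane\<close>

context smooth_manifold
begin

lemma smooth_at_minus: "smooth_at A p f \<Longrightarrow> smooth_at A p (\<lambda>q. - f q)"
  using smooth_at_mult[of p "\<lambda>q. - 1" f] by (simp add: smooth_at_const)

lemma smooth_at_diff: "smooth_at A p f \<Longrightarrow> smooth_at A p g \<Longrightarrow> smooth_at A p (\<lambda>q. f q - g q)"
  using smooth_at_add[of p f "\<lambda>q. - g q"] by (simp add: smooth_at_minus)

lemma tangent_diff:
  assumes v: "v \<in> tangent_space A p" and f: "smooth_at A p f" and g: "smooth_at A p g"
  shows "v (\<lambda>q. f q - g q) = v f - v g"
  using tangent_add[OF v f smooth_at_mult[OF smooth_at_const g], of "- 1"] tangent_cmult[OF v g, of "- 1"]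
  by simp

lemma tangent_minus:
  "v \<in> tangent_space A p \<Longrightarrow> smooth_at A p f \<Longrightarrow> v (\<lambda>q. - f q) = - v f"
  using tangent_cmult[of v p f "- 1"] by simp

lemma tangent_inverse:
  assumes v: "v \<in> tangent_space A p" and f: "smooth_at A p f" and nz: "\<And>q. f q \<noteq> 0"
  shows "v (\<lambda>q. inverse (f q)) = - (inverse (f p) * inverse (f p) * v f)"
proof -
  have "v (\<lambda>q. f q * inverse (f q)) = f p * v (\<lambda>q. inverse (f q)) + v f * inverse (f p)"
    by (intro tangent_mult v f smooth_at_inverse nz)
  then have "f p * v (\<lambda>q. inverse (f q)) + v f * inverse (f p) = 0"
    by (simp add: nz tangent_const[OF v])
  then have "inverse (f p) * (f p * v (\<lambda>q. inverse (f q)) + v f * inverse (f p)) = 0" by simp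
  then show ?thesis using nz[of p] by (simp add: field_simps)
qed

lemmas smooth_intros = smooth_at_const smooth_at_add smooth_at_diff smooth_at_minus smooth_at_mult smooth_at_inverse

end

text \<open>\<open>M\<close> is the matrix of ad e_1 on the abelian plane of e_2 and e_3, its rows
  being the images of these vectors. The fourth entry is independent of the first, since rotating
  the plane can make the diagonal unequal.\<close>

definition semidirect :: "real \<Rightarrow> real \<Rightarrow> real \<Rightarrow> real \<Rightarrow> 3 \<Rightarrow> 3 \<Rightarrow> 3 \<Rightarrow> real" where
  "semidirect a b c d i j k =
    (let M = \<lambda>j k. if j = 2 \<and> k = 2 then a else if j = 2 \<and> k = 3 then b
                 else if j = 3 \<and> k = 2 then c else if j = 3 \<and> k = 3 then d else 0
     in if i = 1 then M j k else if j = 1 then - M i k else 0)"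

locale semidirect_frame = invariant_frame A G g D e "semidirect a b c d"
  for A :: "('g::{t2_space,second_countable_topology}, 'e::euclidean_space) atlas"
    and G :: "'g monoid" (structure)
    and g D and e :: "3 \<Rightarrow> 'g tangent" and a b c d +
  assumes conn: "connected (UNIV :: 'g set)"
begin

lemmas deriv_simps =
  tangent_const[OF frame_field_tangent] tangent_add[OF frame_field_tangent]
  tangent_diff[OF frame_field_tangent] tangent_minus[OF frame_field_tangent]
  tangent_cmult[OF frame_field_tangent] tangent_mult[OF frame_field_tangent]

lemma commutators:
  assumes "smooth_at A p f"
  shows "E 1 p (\<lambda>q. E 2 q f) - E 2 p (\<lambda>q. E 1 q f) = a * E 2 p f + b * E 3 p f"
    and "E 1 p (\<lambda>q. E 3 q f) - E 3 p (\<lambda>q. E 1 q f) = c * E 2 p f + d * E 3 p f"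
    and "E 2 p (\<lambda>q. E 3 q f) - E 3 p (\<lambda>q. E 2 q f) = 0"
  using frame_commutator[OF assms] by (simp_all add: sum_3 semidirect_def)

lemma smooth_E: "smooth_at A p f \<Longrightarrow> smooth_at A p (\<lambda>q. E i q f)"
  by (rule vector_fields_smooth[OF frame_field])

lemma killing_coeffs_iff:
  "killing_coeffs x \<longleftrightarrow> (\<forall>i p. smooth_at A p (x i)) \<and>
    (\<forall>p. E 1 p (x 1) = 0 \<and> E 2 p (x 2) = a * x 1 p \<and> E 3 p (x 3) = d * x 1 p \<and>
      E 1 p (x 2) + E 2 p (x 1) = - a * x 2 p - c * x 3 p \<and>
      E 1 p (x 3) + E 3 p (x 1) = - b * x 2 p - d * x 3 p \<and>
      E 2 p (x 3) + E 3 p (x 2) = (b + c) * x 1 p)"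
  unfolding killing_coeffs_def forall_3 sum_3
  by (rule conj_cong[OF refl]) (auto simp: semidirect_def algebra_simps)

text \<open>The Killing equations make the covariant derivative skew, so three of its nine
  components at the identity determine the others.\<close>

lemma parallel_coeffs_iff:
  assumes "killing_coeffs x"
  shows "parallel_coeffs x \<longleftrightarrow>
    e 2 (x 1) = - a * x 2 \<one> - (b + c) / 2 * x 3 \<one> \<and>
    e 3 (x 1) = - (b + c) / 2 * x 2 \<one> - d * x 3 \<one> \<and>
    e 2 (x 3) = (b + c) / 2 * x 1 \<one>"
proof -
  have "e 1 (x 1) = 0" "e 2 (x 2) = a * x 1 \<one>" "e 3 (x 3) = d * x 1 \<one>"
    "e 1 (x 2) + e 2 (x 1) = - a * x 2 \<one> - c * x 3 \<one>"
    "e 1 (x 3) + e 3 (x 1) = - b * x 2 \<one> - d * x 3 \<one>"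
    "e 2 (x 3) + e 3 (x 2) = (b + c) * x 1 \<one>"
    using assms unfolding killing_coeffs_iff by (metis left_field_one)+
  then show ?thesis
    unfolding parallel_coeffs_def forall_3 sum_3 christoffel_def
    by (simp add: semidirect_def algebra_simps) (auto simp: algebra_simps field_simps)
qed

text \<open>The three further components of the covariant derivative vanish at the identity as a
  consequence of the Killing equations.\<close>

lemma symmetry_spaceI:
  assumes smooth: "\<And>p. smooth_at A p x1" "\<And>p. smooth_at A p x2" "\<And>p. smooth_at A p x3"
    and killing: "\<And>p. E 1 p x1 = 0" "\<And>p. E 2 p x2 = a * x1 p" "\<And>p. E 3 p x3 = d * x1 p"
      "\<And>p. E 1 p x2 + E 2 p x1 = - a * x2 p - c * x3 p"
      "\<And>p. E 1 p x3 + E 3 p x1 = - b * x2 p - d * x3 p"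
      "\<And>p. E 2 p x3 + E 3 p x2 = (b + c) * x1 p"
    and parallel: "E 2 \<one> x1 = - a * x2 \<one> - (b + c) / 2 * x3 \<one>"
      "E 3 \<one> x1 = - (b + c) / 2 * x2 \<one> - d * x3 \<one>"
      "E 2 \<one> x3 = (b + c) / 2 * x1 \<one>"
    and v: "v = x1 \<one> *\<^sub>R e 1 + x2 \<one> *\<^sub>R e 2 + x3 \<one> *\<^sub>R e 3"
  shows "v \<in> symmetry_space A g D \<one>"
proof -
  define x :: "3 \<Rightarrow> 'g \<Rightarrow> real" where "x i = (if i = 1 then x1 else if i = 2 then x2 else x3)" for i
  have x: "x 1 = x1" "x 2 = x2" "x 3 = x3" by (simp_all add: x_def)
  have K: "killing_coeffs x"
    unfolding killing_coeffs_iff forall_3 x using smooth killing by simp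
  moreover have "parallel_coeffs x"
    unfolding parallel_coeffs_iff[OF K] x using parallel by (simp add: left_field_one)
  moreover have "v = (\<Sum>i\<in>UNIV. x i \<one> *\<^sub>R e i)" by (simp add: v sum_3 x)
  ultimately show ?thesis unfolding symmetry_space_eq by blast
qed

lemma symmetry_spaceE:
  assumes "v \<in> symmetry_space A g D \<one>"
  obtains x where "killing_coeffs x" "parallel_coeffs x"
    "v = x 1 \<one> *\<^sub>R e 1 + x 2 \<one> *\<^sub>R e 2 + x 3 \<one> *\<^sub>R e 3"
  using assms unfolding symmetry_space_eq sum_3 by auto

subsection \<open>Functions obtained from the adjoint representation\<close>

lemma constant_function:
  assumes smooth: "\<And>p. smooth_at A p f" and 0: "\<And>i p. E i p f = 0"
  shows "f p = f \<one>"
proof (rule vanishing_derivative_imp_constant[OF conn smooth])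
  fix p v assume v: "v \<in> tangent_space A p"
  show "v f = 0"
    by (subst frame_expansion[OF v]) (simp add: sum_apply scaleR_fun_def 0)
qed

text \<open>Brackets have no component along \<open>e 1\<close>, so this component of a
  right-invariant field has zero derivative and keeps its value at the identity.\<close>

lemma adj_first: "adj k 1 p = (if k = 1 then 1 else 0)"
proof -
  have "E j p (adj k 1) = 0" for j p
    unfolding adj_derivative sum_3 by (simp add: semidirect_def)
  then have "adj k 1 p = adj k 1 \<one>" by (rule constant_function[OF adj_smooth])
  then show ?thesis by (simp add: adj_one)
qed

lemma adj_derivs:
  "E 1 p (adj k 2) = - a * adj k 2 p - c * adj k 3 p"
  "E 1 p (adj k 3) = - b * adj k 2 p - d * adj k 3 p"
  "E 2 p (adj k 2) = a * adj k 1 p" "E 2 p (adj k 3) = b * adj k 1 p"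
  "E 3 p (adj k 2) = c * adj k 1 p" "E 3 p (adj k 3) = d * adj k 1 p"
  unfolding adj_derivative sum_3 by (simp_all add: semidirect_def)

text \<open>The reciprocal determinant of the adjoint matrix on the plane. It stands for exp ((a +
  d) t), with t a coordinate along \<open>e 1\<close>, and is the integrating factor in the
  constructions of Killing fields.\<close>

lemma modular_function:
  obtains \<iota> where "\<And>p. smooth_at A p \<iota>" "\<And>p. E 1 p \<iota> = (a + d) * \<iota> p"
    "\<And>p. E 2 p \<iota> = 0" "\<And>p. E 3 p \<iota> = 0" "\<iota> \<one> = 1"
proof -
  define \<delta> where "\<delta> = (\<lambda>p. adj 2 2 p * adj 3 3 p - adj 2 3 p * adj 3 2 p)"
  have smooth: "smooth_at A p \<delta>" for p
    unfolding \<delta>_def by (intro smooth_intros adj_smooth)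
  have deriv: "E 1 p \<delta> = - (a + d) * \<delta> p" "E 2 p \<delta> = 0" "E 3 p \<delta> = 0" for p
    unfolding \<delta>_def by (simp_all add: deriv_simps smooth_intros adj_smooth adj_derivs adj_first algebra_simps)
  have nz: "\<delta> p \<noteq> 0" for p
  proof
    assume 0: "\<delta> p = 0"
    have indep: "r2 = 0 \<and> r3 = 0"
      if r: "r2 * adj 2 2 p + r3 * adj 3 2 p = 0" "r2 * adj 2 3 p + r3 * adj 3 3 p = 0" for r2 r3
    proof -
      have "(\<Sum>k\<in>UNIV. (if k = 2 then r2 else if k = 3 then r3 else 0) * adj k i p) = 0" for i :: 3
        using r by (cases i rule: exhaust_3[THEN disjE]) (auto simp: sum_3 adj_first)
      from adj_nondegenerate[OF this, of 2] adj_nondegenerate[OF this, of 3] show ?thesis by simp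
    qed
    \<comment> \<open>If the determinant vanishes, each column of the matrix, with its entries
      exchanged and one sign changed, is a relation between the rows. Such relations are trivial, so
      the whole matrix is zero, and then even the coefficients 1, 0 give a relation.\<close>
    have "adj 3 2 p = 0 \<and> - adj 2 2 p = 0" "adj 3 3 p = 0 \<and> - adj 2 3 p = 0"
      using 0 by (intro indep; simp add: \<delta>_def algebra_simps)+
    then show False using indep[of 1 0] by simp
  qed
  show ?thesis
  proof (rule that[of "\<lambda>p. inverse (\<delta> p)"])
    show "smooth_at A p (\<lambda>p. inverse (\<delta> p))" for p by (intro smooth_intros smooth nz)
    show "E 1 p (\<lambda>p. inverse (\<delta> p)) = (a + d) * inverse (\<delta> p)"
      "E 2 p (\<lambda>p. inverse (\<delta> p)) = 0" "E 3 p (\<lambda>p. inverse (\<delta> p)) = 0" for p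
      using nz[of p] by (simp_all only: tangent_inverse[OF frame_field_tangent smooth nz] deriv) (simp_all add: field_simps)
    show "inverse (\<delta> \<one>) = 1" by (simp add: \<delta>_def adj_one)
  qed
qed

text \<open>A right-invariant field is parallel at the identity iff covariant differentiation along it
  annihilates all left-invariant fields.\<close>

lemma right_invariant_symmetry:
  assumes "(b - c) * r1 = 0" "a * r2 + (b + c) / 2 * r3 = 0" "(b + c) / 2 * r2 + d * r3 = 0"
  shows "r1 *\<^sub>R e 1 + r2 *\<^sub>R e 2 + r3 *\<^sub>R e 3 \<in> symmetry_space A g D \<one>"
proof (rule symmetry_spaceI)
  let ?x = "\<lambda>i p. r1 * adj 1 i p + r2 * adj 2 i p + r3 * adj 3 i p"
  show "smooth_at A p (?x 1)" "smooth_at A p (?x 2)" "smooth_at A p (?x 3)" for p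
    by (intro smooth_intros adj_smooth)+
  show "E 1 p (?x 1) = 0" "E 2 p (?x 2) = a * ?x 1 p" "E 3 p (?x 3) = d * ?x 1 p"
    "E 1 p (?x 2) + E 2 p (?x 1) = - a * ?x 2 p - c * ?x 3 p"
    "E 1 p (?x 3) + E 3 p (?x 1) = - b * ?x 2 p - d * ?x 3 p"
    "E 2 p (?x 3) + E 3 p (?x 2) = (b + c) * ?x 1 p" for p
    by (simp_all add: deriv_simps smooth_intros adj_smooth adj_derivs adj_first algebra_simps)
  show "E 2 \<one> (?x 1) = - a * ?x 2 \<one> - (b + c) / 2 * ?x 3 \<one>"
    "E 3 \<one> (?x 1) = - (b + c) / 2 * ?x 2 \<one> - d * ?x 3 \<one>"
    "E 2 \<one> (?x 3) = (b + c) / 2 * ?x 1 \<one>"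
    using assms
    by (simp_all add: deriv_simps smooth_intros adj_smooth adj_derivs adj_first adj_one algebra_simps)
      (simp_all add: field_simps)
  show "r1 *\<^sub>R e 1 + r2 *\<^sub>R e 2 + r3 *\<^sub>R e 3 = ?x 1 \<one> *\<^sub>R e 1 + ?x 2 \<one> *\<^sub>R e 2 + ?x 3 \<one> *\<^sub>R e 3"
    by (simp add: adj_one)
qed

end

subsection \<open>Obstructions\<close>

context semidirect_frame
begin

text \<open>The functions \<open>u\<close>, \<open>v\<close>, \<open>w\<close> are the components of the covariant derivative of the Killing
  field. The commutators applied to the coefficients determine all their derivatives, and the
  commutators applied to \<open>u\<close> and \<open>w\<close> then yield conditions on the value at the identity.\<close>

lemma symmetry_obstruction:
  assumes K: "killing_coeffs x" and P: "parallel_coeffs x"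
    and d: "d = a" and b: "b = s + q" and c: "c = s - q"
  shows "s * ((a\<^sup>2 - s\<^sup>2 - s * q) * x 2 \<one> - a * q * x 3 \<one>) = 0"
    and "s * (a * q * x 2 \<one> + (a\<^sup>2 - s\<^sup>2 + s * q) * x 3 \<one>) = 0"
    and "q\<^sup>2 * s * x 1 \<one> = 0"
proof -
  define X Y Z where "X = x 1" "Y = x 2" "Z = x 3"
  have sm: "smooth_at A p X" "smooth_at A p Y" "smooth_at A p Z" for p
    using K unfolding killing_coeffs_def X_Y_Z_def by blast+
  \<comment> \<open>Here \<open>s\<close> and \<open>q\<close> are the symmetric and skew
    off-diagonal parts of the matrix; the components \<open>u\<close>, \<open>v\<close>,
    \<open>w\<close> involve only \<open>a\<close> and \<open>s\<close>.\<close>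
  define u where "u = (\<lambda>p. E 2 p X + a * Y p + s * Z p)"
  define v where "v = (\<lambda>p. E 3 p X + s * Y p + a * Z p)"
  define w where "w = (\<lambda>p. E 2 p Z - s * X p)"
  have sm': "smooth_at A p u" "smooth_at A p v" "smooth_at A p w" for p
    unfolding u_def v_def w_def by (intro smooth_intros smooth_E sm)+
  have killing: "E 1 p X = 0" "E 2 p Y = a * X p" "E 3 p Z = a * X p"
      "E 1 p Y + E 2 p X = - a * Y p - c * Z p" "E 1 p Z + E 3 p X = - b * Y p - a * Z p"
      "E 2 p Z + E 3 p Y = (b + c) * X p" for p
    using K[unfolded killing_coeffs_iff] by (simp_all add: X_Y_Z_def d)
  have first: "E 1 p X = 0" "E 1 p Y = q * Z p - u p" "E 1 p Z = - q * Y p - v p"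
      "E 2 p X = u p - a * Y p - s * Z p" "E 2 p Y = a * X p" "E 2 p Z = s * X p + w p"
      "E 3 p X = v p - s * Y p - a * Z p" "E 3 p Y = s * X p - w p" "E 3 p Z = a * X p" for p
    using killing[of p] by (simp_all add: u_def v_def w_def b c algebra_simps)
  note ds = deriv_simps smooth_intros sm sm'
  have r1: "E 1 p u = q * v p - (a\<^sup>2 + s\<^sup>2 + 2 * s * q) * Y p - 2 * a * s * Z p"
    "E 1 p v = - q * u p - 2 * a * s * Y p + (2 * s * q - s\<^sup>2 - a\<^sup>2) * Z p"
    "E 2 p v - E 3 p u = 2 * a * w p" for p
    using commutators[OF sm(1), of p] unfolding b c d
    by (simp_all add: first ds) (simp_all add: algebra_simps power2_eq_square)
  have r2: "E 2 p u = (a\<^sup>2 + s\<^sup>2 + 2 * s * q) * X p - s * w p"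
    "E 3 p u - E 1 p w = 2 * a * s * X p - a * w p"
    "E 2 p w = s * u p - a * v p + (a\<^sup>2 - s\<^sup>2) * Z p" for p
    using commutators[OF sm(2), of p] unfolding b c d
    by (simp_all add: first ds) (simp_all add: algebra_simps power2_eq_square)
  have r3: "E 1 p w + E 2 p v = 2 * a * s * X p + a * w p"
    "E 3 p v = (a\<^sup>2 + s\<^sup>2 - 2 * s * q) * X p + s * w p"
    "E 3 p w = a * u p - s * v p + (s\<^sup>2 - a\<^sup>2) * Y p" for p
    using commutators[OF sm(3), of p] unfolding b c d
    by (simp_all add: first ds) (simp_all add: algebra_simps power2_eq_square)
  \<comment> \<open>Three of the nine relations couple \<open>E 2 p v\<close>,
    \<open>E 3 p u\<close> and \<open>E 1 p w\<close>. Combining them separates these derivatives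
    and forces \<open>E 1 p w\<close> to vanish.\<close>
  have second:
    "E 1 p u = q * v p - (a\<^sup>2 + s\<^sup>2 + 2 * s * q) * Y p - 2 * a * s * Z p"
    "E 1 p v = - q * u p - 2 * a * s * Y p + (2 * s * q - s\<^sup>2 - a\<^sup>2) * Z p"
    "E 1 p w = 0"
    "E 2 p u = (a\<^sup>2 + s\<^sup>2 + 2 * s * q) * X p - s * w p"
    "E 2 p w = s * u p - a * v p + (a\<^sup>2 - s\<^sup>2) * Z p"
    "E 3 p u = 2 * a * s * X p - a * w p"
    "E 3 p v = (a\<^sup>2 + s\<^sup>2 - 2 * s * q) * X p + s * w p"
    "E 3 p w = a * u p - s * v p + (s\<^sup>2 - a\<^sup>2) * Y p" for p
    using r1[of p] r2[of p] r3[of p] by linarith+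
  \<comment> \<open>At the identity the components drop out of the remaining commutator relations,
    which thereby become linear conditions on the value of the field alone.\<close>
  have 0: "u \<one> = 0" "v \<one> = 0" "w \<one> = 0"
    using P unfolding parallel_coeffs_iff[OF K] u_def v_def w_def X_Y_Z_def
    by (simp_all add: left_field_one b c d)
  show "s * ((a\<^sup>2 - s\<^sup>2 - s * q) * x 2 \<one> - a * q * x 3 \<one>) = 0"
    using commutators(1)[OF sm'(3), of \<one>] unfolding X_Y_Z_def[symmetric] b c d
    by (simp add: first second ds 0) algebra
  show "s * (a * q * x 2 \<one> + (a\<^sup>2 - s\<^sup>2 + s * q) * x 3 \<one>) = 0"
    using commutators(2)[OF sm'(3), of \<one>] unfolding X_Y_Z_def[symmetric] b c d
    by (simp add: first second ds 0) algebra
  show "q\<^sup>2 * s * x 1 \<one> = 0"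
    using commutators(2)[OF sm'(1), of \<one>] unfolding X_Y_Z_def[symmetric] b c d
    by (simp add: first second ds 0) algebra
qed

subsection \<open>Constructions\<close>

text \<open>The coefficients of the special conformal fields of the half-space model, expressed by the
  functions \<open>\<xi>\<close> and \<open>\<zeta>\<close>.\<close>

lemma hyperbolic_symmetry:
  assumes a: "a > 0" and d: "d = a" and c: "c = - b"
  shows "e 1 \<in> symmetry_space A g D \<one>" "e 2 \<in> symmetry_space A g D \<one>" "e 3 \<in> symmetry_space A g D \<one>"
proof -
  \<comment> \<open>With c = -b the matrix has determinant a^2 + b^2. Its inverse turns the first
    row of \<open>adj\<close> into functions \<open>\<xi>2\<close>, \<open>\<xi>3\<close> that
    vanish at the identity and are dual to the directions \<open>e 2\<close> and
    \<open>e 3\<close>.\<close>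
  define \<alpha> \<beta> where "\<alpha> = a / (a\<^sup>2 + b\<^sup>2)" "\<beta> = b / (a\<^sup>2 + b\<^sup>2)"
  have "a\<^sup>2 + b\<^sup>2 \<noteq> 0" using a by (simp add: sum_power2_eq_zero_iff)
  then have unit: "\<alpha> * a + \<beta> * b = 1" "\<alpha> * b = \<beta> * a"
    by (simp_all add: \<alpha>_\<beta>_def add_divide_distrib[symmetric] power2_eq_square)
  define \<xi>2 where "\<xi>2 = (\<lambda>p. \<alpha> * adj 1 2 p + \<beta> * adj 1 3 p)"
  define \<xi>3 where "\<xi>3 = (\<lambda>p. - \<beta> * adj 1 2 p + \<alpha> * adj 1 3 p)"
  have sm: "smooth_at A p \<xi>2" "smooth_at A p \<xi>3" for p
    unfolding \<xi>2_def \<xi>3_def by (intro smooth_intros adj_smooth)+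
  have d\<xi>: "E 1 p \<xi>2 = - a * \<xi>2 p + b * \<xi>3 p" "E 1 p \<xi>3 = - b * \<xi>2 p - a * \<xi>3 p"
    "E 2 p \<xi>2 = 1" "E 2 p \<xi>3 = 0" "E 3 p \<xi>2 = 0" "E 3 p \<xi>3 = 1" for p
    using unit unfolding \<xi>2_def \<xi>3_def
    by (simp_all add: deriv_simps smooth_intros adj_smooth adj_derivs adj_first c d algebra_simps)
  have \<xi>0: "\<xi>2 \<one> = 0" "\<xi>3 \<one> = 0" by (simp_all add: \<xi>2_def \<xi>3_def adj_one)
  note ds = deriv_simps smooth_intros sm d\<xi> \<xi>0
  \<comment> \<open>This is the right-invariant field of \<open>e 1\<close> minus \<open>b\<close>
    times the rotation with coefficients \<open>0\<close>, \<open>- \<xi>3\<close>,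
    \<open>\<xi>2\<close>.\<close>
  show "e 1 \<in> symmetry_space A g D \<one>"
    by (rule symmetry_spaceI[of "\<lambda>p. 1" "\<lambda>p. a * \<xi>2 p" "\<lambda>p. a * \<xi>3 p"])
      (simp_all add: ds c d algebra_simps)
  obtain \<iota> where \<iota>: "\<And>p. smooth_at A p \<iota>" "\<And>p. E 1 p \<iota> = (a + a) * \<iota> p"
    "\<And>p. E 2 p \<iota> = 0" "\<And>p. E 3 p \<iota> = 0" "\<iota> \<one> = 1"
    using modular_function d by metis
  have special: "(- 1 / a * adj k 2 \<one>) *\<^sub>R e 2 + (- 1 / a * adj k 3 \<one>) *\<^sub>R e 3 \<in> symmetry_space A g D \<one>"
    if k: "k \<noteq> 1" for k
  proof -
    define \<zeta>2 where "\<zeta>2 = adj k 2"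
    define \<zeta>3 where "\<zeta>3 = adj k 3"
    have sm\<zeta>: "smooth_at A p \<zeta>2" "smooth_at A p \<zeta>3" for p
      unfolding \<zeta>2_def \<zeta>3_def by (rule adj_smooth)+
    have d\<zeta>: "E 1 p \<zeta>2 = - a * \<zeta>2 p + b * \<zeta>3 p" "E 1 p \<zeta>3 = - b * \<zeta>2 p - a * \<zeta>3 p"
      "E 2 p \<zeta>2 = 0" "E 2 p \<zeta>3 = 0" "E 3 p \<zeta>2 = 0" "E 3 p \<zeta>3 = 0" for p
      using k by (simp_all add: \<zeta>2_def \<zeta>3_def adj_derivs adj_first c d)
    \<comment> \<open>The constant \<open>- r\<close> in \<open>n\<close> is dictated by the Killing
      equations pairing \<open>E 1\<close> with the plane: its contribution cancels the derivatives
      of \<open>x1\<close>. The last terms of \<open>x2\<close> and \<open>x3\<close> subtract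
      \<open>r\<close> times the right-invariant field of \<open>e k\<close>, which preserves the
      Killing property and achieves parallelism at the identity.\<close>
    define r where "r = inverse (2 * a)"
    have r: "2 * (a * r) = 1" "a * r = 1 / 2" "r * a = 1 / 2" using a by (simp_all add: r_def)
    \<comment> \<open>One half is kept opaque, so that the identities are polynomial and are checked
      using \<open>2 * \<kappa> = 1\<close>.\<close>
    define \<kappa> where "\<kappa> = (1 / 2 :: real)"
    have \<kappa>: "2 * \<kappa> = 1" by (simp add: \<kappa>_def)
    define x1 where "x1 = (\<lambda>p. (\<xi>2 p * \<zeta>2 p + \<xi>3 p * \<zeta>3 p) * \<iota> p)"
    define n where "n = (\<lambda>p. - r - \<kappa> * (a * (\<xi>2 p * \<xi>2 p + \<xi>3 p * \<xi>3 p)))"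
    define x2 where "x2 = (\<lambda>p. \<zeta>2 p * \<iota> p * n p + a * \<xi>2 p * x1 p - r * \<zeta>2 p)"
    define x3 where "x3 = (\<lambda>p. \<zeta>3 p * \<iota> p * n p + a * \<xi>3 p * x1 p - r * \<zeta>3 p)"
    note ds = ds sm\<zeta> d\<zeta> \<iota>
    have smx: "smooth_at A p x1" "smooth_at A p n" for p
      unfolding x1_def n_def by (intro smooth_intros sm sm\<zeta> \<iota>)+
    have dx1: "E 1 p x1 = 0" "E 2 p x1 = \<zeta>2 p * \<iota> p" "E 3 p x1 = \<zeta>3 p * \<iota> p" for p
      unfolding x1_def by (simp_all add: ds algebra_simps)
    have "E 1 p n = 2 * \<kappa> * (a * a * (\<xi>2 p * \<xi>2 p + \<xi>3 p * \<xi>3 p))" "E 2 p n = 2 * \<kappa> * (- a * \<xi>2 p)"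
      "E 3 p n = 2 * \<kappa> * (- a * \<xi>3 p)" for p
      unfolding n_def by (simp_all add: ds) (simp_all add: algebra_simps)
    note dn = this[unfolded \<kappa> mult_1]
    note ds' = ds smx dx1 dn
    show ?thesis
    proof (rule symmetry_spaceI[of x1 x2 x3])
      show "smooth_at A p x1" "smooth_at A p x2" "smooth_at A p x3" for p
        unfolding x2_def x3_def by (intro smooth_intros smx sm sm\<zeta> \<iota>)+
      show "E 1 p x1 = 0" for p by (rule dx1)
      show "E 2 p x2 = a * x1 p" "E 3 p x3 = d * x1 p" "E 2 p x3 + E 3 p x2 = (b + c) * x1 p" for p
        unfolding x2_def x3_def by (simp_all add: ds' d c x1_def algebra_simps)
      show "E 1 p x2 + E 2 p x1 = - a * x2 p - c * x3 p" "E 1 p x3 + E 3 p x1 = - b * x2 p - d * x3 p" for p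
        using r(1) \<kappa> unfolding x2_def x3_def
        by (simp_all only: ds' d c) (unfold n_def x1_def, algebra+)
      show "E 2 \<one> x1 = - a * x2 \<one> - (b + c) / 2 * x3 \<one>"
        "E 3 \<one> x1 = - (b + c) / 2 * x2 \<one> - d * x3 \<one>"
        "E 2 \<one> x3 = (b + c) / 2 * x1 \<one>"
        using r unfolding x2_def x3_def by (simp_all add: ds' d c) (simp_all add: n_def x1_def ds algebra_simps)
      show "(- 1 / a * adj k 2 \<one>) *\<^sub>R e 2 + (- 1 / a * adj k 3 \<one>) *\<^sub>R e 3 =
          x1 \<one> *\<^sub>R e 1 + x2 \<one> *\<^sub>R e 2 + x3 \<one> *\<^sub>R e 3"
        using a by (simp add: x1_def x2_def x3_def n_def ds \<zeta>2_def[symmetric] \<zeta>3_def[symmetric] r_def algebra_simps field_simps)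
    qed
  qed
  have scale: "w \<in> symmetry_space A g D \<one>" if "(- 1 / a) *\<^sub>R w \<in> symmetry_space A g D \<one>" for w
  proof -
    have "- a *\<^sub>R (- 1 / a) *\<^sub>R w \<in> symmetry_space A g D \<one>"
      using symmetry_space_subspace that by (rule subspace_scale)
    moreover have "- a *\<^sub>R (- 1 / a) *\<^sub>R w = w" using a by simp
    ultimately show ?thesis by (simp only:)
  qed
  show "e 2 \<in> symmetry_space A g D \<one>" by (rule scale) (use special[of 2] in \<open>simp add: adj_one\<close>)
  show "e 3 \<in> symmetry_space A g D \<one>" by (rule scale) (use special[of 3] in \<open>simp add: adj_one\<close>)
qed

text \<open>Here ad e_1 is skew, so the left-invariant field of \<open>e 1\<close> is itself Killing
  and parallel.\<close>

lemma flat_symmetry: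
  assumes "a = 0" "d = 0" "c = - b"
  shows "e 1 \<in> symmetry_space A g D \<one>"
  by (rule symmetry_spaceI[of "\<lambda>p. 1" "\<lambda>p. 0" "\<lambda>p. 0"]) (simp_all add: deriv_simps smooth_at_const assms)

text \<open>When \<open>e 3\<close> is central, the field below is the lift of the rotation about the identity of the
  quotient surface.\<close>

lemma lifted_rotation:
  assumes c: "c = 0" and d: "d = 0" and nz: "a \<noteq> 0 \<or> b \<noteq> 0"
  obtains y1 y2 y3 where
    "\<And>p. smooth_at A p y1" "\<And>p. smooth_at A p y2" "\<And>p. smooth_at A p y3"
    "\<And>p. E 1 p y1 = 0" "\<And>p. E 2 p y2 = a * y1 p" "\<And>p. E 3 p y3 = 0"
    "\<And>p. E 1 p y2 + E 2 p y1 = - a * y2 p" "\<And>p. E 1 p y3 + E 3 p y1 = - b * y2 p"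
    "\<And>p. E 2 p y3 + E 3 p y2 = b * y1 p"
    "y1 \<one> = 0" "y2 \<one> = 0" "y3 \<one> = 0" "E 2 \<one> y1 = 1" "E 3 \<one> y1 = 0" "E 2 \<one> y3 = 0"
proof -
  \<comment> \<open>Either of \<open>a\<close> and \<open>b\<close> may vanish; dividing by the sum
    of their squares treats the Heisenberg group and the product with a line at once.\<close>
  define \<alpha> \<beta> where "\<alpha> = a / (a\<^sup>2 + b\<^sup>2)" "\<beta> = b / (a\<^sup>2 + b\<^sup>2)"
  have "a\<^sup>2 + b\<^sup>2 \<noteq> 0" using nz by (simp add: sum_power2_eq_zero_iff)
  then have unit: "\<alpha> * a + \<beta> * b = 1"
    by (simp add: \<alpha>_\<beta>_def add_divide_distrib[symmetric] power2_eq_square)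
  define \<xi> where "\<xi> = (\<lambda>p. \<alpha> * adj 1 2 p + \<beta> * adj 1 3 p)"
  \<comment> \<open>With t a coordinate along \<open>e 1\<close>, this is (1 - exp (-a t)) / a, or t
    itself when \<open>a = 0\<close>; in this form no division by \<open>a\<close> occurs.\<close>
  define \<phi> where "\<phi> = (\<lambda>p. \<alpha> * (1 - adj 2 2 p) - \<beta> * adj 2 3 p)"
  note ds = deriv_simps smooth_intros adj_smooth adj_derivs adj_first adj_one c d
  \<comment> \<open>The image of ad e_1 is spanned by
    \<open>a *\<^sub>R e 2 + b *\<^sub>R e 3\<close>. Hence the deviation of each of the first two
    rows of \<open>adj\<close> from its value at the identity is proportional to
    \<open>(a, b)\<close>; this relation and the next express it.\<close>
  have rel1: "b * adj 1 2 p = a * adj 1 3 p" for p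
  proof -
    have "(\<lambda>p. b * adj 1 2 p - a * adj 1 3 p) p = (\<lambda>p. b * adj 1 2 p - a * adj 1 3 p) \<one>"
    proof (rule constant_function)
      show "E i p (\<lambda>p. b * adj 1 2 p - a * adj 1 3 p) = 0" for i p
        using exhaust_3[of i] by (auto simp: ds)
    qed (intro smooth_intros adj_smooth)
    then show ?thesis by (simp add: adj_one)
  qed
  have rel2: "a * adj 2 3 p = b * (adj 2 2 p - 1)" for p
  proof -
    have "(\<lambda>p. a * adj 2 3 p - b * (adj 2 2 p - 1)) p = (\<lambda>p. a * adj 2 3 p - b * (adj 2 2 p - 1)) \<one>"
    proof (rule constant_function)
      show "E i p (\<lambda>p. a * adj 2 3 p - b * (adj 2 2 p - 1)) = 0" for i p
        using exhaust_3[of i] by (auto simp: ds)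
    qed (intro smooth_intros adj_smooth)
    then show ?thesis by (simp add: adj_one)
  qed
  have sm: "smooth_at A p \<xi>" "smooth_at A p \<phi>" for p
    unfolding \<xi>_def \<phi>_def by (intro smooth_intros adj_smooth)+
  have m12: "adj 1 2 p = a * \<xi> p" for p
  proof -
    have "a * \<xi> p = (a * \<alpha>) * adj 1 2 p + \<beta> * (a * adj 1 3 p)" by (simp add: \<xi>_def algebra_simps)
    also have "\<dots> = (a * \<alpha> + b * \<beta>) * adj 1 2 p" by (simp add: rel1[symmetric] algebra_simps)
    finally show ?thesis using unit by (simp add: mult.commute)
  qed
  have m22: "adj 2 2 p = 1 - a * \<phi> p" for p
  proof -
    have "a * \<phi> p = (a * \<alpha>) * (1 - adj 2 2 p) - \<beta> * (a * adj 2 3 p)" by (simp add: \<phi>_def algebra_simps)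
    also have "\<dots> = (a * \<alpha> + b * \<beta>) * (1 - adj 2 2 p)" by (simp add: rel2 algebra_simps)
    finally show ?thesis using unit by (simp add: mult.commute)
  qed
  have "E 1 p \<xi> = - (\<alpha> * a + \<beta> * b) * adj 1 2 p" "E 2 p \<xi> = \<alpha> * a + \<beta> * b" "E 3 p \<xi> = 0"
    "E 1 p \<phi> = (\<alpha> * a + \<beta> * b) * adj 2 2 p" "E 2 p \<phi> = 0" "E 3 p \<phi> = 0" for p
    unfolding \<xi>_def \<phi>_def by (simp_all add: ds algebra_simps)
  then have der: "E 1 p \<xi> = - a * \<xi> p" "E 2 p \<xi> = 1" "E 3 p \<xi> = 0"
    "E 1 p \<phi> = 1 - a * \<phi> p" "E 2 p \<phi> = 0" "E 3 p \<phi> = 0" for p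
    unfolding unit m12 m22 by simp_all
  have 0: "\<xi> \<one> = 0" "\<phi> \<one> = 0" by (simp_all add: \<xi>_def \<phi>_def adj_one)
  obtain \<iota> where \<iota>: "\<And>p. smooth_at A p \<iota>" "\<And>p. E 1 p \<iota> = a * \<iota> p"
    "\<And>p. E 2 p \<iota> = 0" "\<And>p. E 3 p \<iota> = 0" "\<iota> \<one> = 1"
    using modular_function unfolding d add_0_right by metis
  note ds = deriv_simps smooth_intros sm der 0 \<iota>
  define \<kappa> where "\<kappa> = (1 / 2 :: real)"
  have \<kappa>: "2 * \<kappa> = 1" by (simp add: \<kappa>_def)
  \<comment> \<open>The first two coefficients are the rotation of the quotient surface, of
    curvature -a^2: in \<open>y2\<close>, the part without \<xi> is - sinh (a t) / a, or -t when
    \<open>a = 0\<close>. The third integrates the remaining equations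
    \<open>E 2 p y3 = b * y1 p\<close> and \<open>E 1 p y3 = - b * y2 p\<close>.\<close>
  define y1 where "y1 = (\<lambda>p. \<xi> p * \<iota> p)"
  define y2 where "y2 = (\<lambda>p. \<kappa> * ((a * (\<xi> p * \<xi> p) - \<phi> p * (2 - a * \<phi> p)) * \<iota> p))"
  define y3 where "y3 = (\<lambda>p. \<kappa> * (b * ((\<xi> p * \<xi> p + \<phi> p * \<phi> p) * \<iota> p)))"
  have smy: "smooth_at A p y1" "smooth_at A p y2" "smooth_at A p y3" for p
    unfolding y1_def y2_def y3_def by (intro smooth_intros sm \<iota>)+
  have d1: "E 1 p y1 = 0" "E 2 p y1 = \<iota> p" "E 3 p y1 = 0" for p
    unfolding y1_def by (simp_all add: ds algebra_simps)
  have d2: "E 1 p y2 = \<kappa> * ((- a * (a * (\<xi> p * \<xi> p)) - 2 * (1 - a * \<phi> p) * (1 - a * \<phi> p) - a * \<phi> p * (2 - a * \<phi> p)) * \<iota> p)"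
    "E 2 p y2 = 2 * \<kappa> * (a * \<xi> p * \<iota> p)" "E 3 p y2 = 0" for p
    unfolding y2_def by (simp_all add: ds) (simp_all add: algebra_simps)
  have d3: "E 1 p y3 = \<kappa> * (b * ((- a * (\<xi> p * \<xi> p) + 2 * \<phi> p - a * (\<phi> p * \<phi> p)) * \<iota> p))"
    "E 2 p y3 = 2 * \<kappa> * (b * \<xi> p * \<iota> p)" "E 3 p y3 = 0" for p
    unfolding y3_def by (simp_all add: ds) (simp_all add: algebra_simps)
  show ?thesis
  proof (rule that[OF smy])
    show "E 1 p y2 + E 2 p y1 = - a * y2 p" "E 1 p y3 + E 3 p y1 = - b * y2 p" for p
      using \<kappa> unfolding d1 d2 d3 unfolding y2_def by algebra (simp add: algebra_simps)
  qed (simp_all add: d1 d2 d3 \<kappa> 0 \<iota>, simp_all add: y1_def y2_def y3_def 0)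
qed

end

subsection \<open>Change of frame\<close>

context invariant_frame
begin

lemma metric_frame_combination:
  "g \<one> (\<Sum>i\<in>UNIV. r i *\<^sub>R e i) (\<Sum>i\<in>UNIV. s i *\<^sub>R e i) = (\<Sum>i\<in>UNIV. r i * s i)"
proof -
  have tangent: "(\<Sum>i\<in>UNIV. s i *\<^sub>R e i) \<in> tangent_space A \<one>" for s
    using frame_sum_tangent[where p = \<one>] by (simp add: left_field_one)
  have "g \<one> (\<Sum>i\<in>UNIV. r i *\<^sub>R e i) (\<Sum>i\<in>UNIV. s i *\<^sub>R e i) = (\<Sum>i\<in>UNIV. r i * g \<one> (e i) (\<Sum>i\<in>UNIV. s i *\<^sub>R e i))"
    by (intro metric_sum finite frame_tangent tangent)
  moreover have "g \<one> (e i) (\<Sum>i\<in>UNIV. s i *\<^sub>R e i) = s i" for i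
    using metric_sym[OF frame_tangent tangent] metric_frame_sum[of \<one> s i] by (simp add: left_field_one)
  ultimately show ?thesis by simp
qed

lemma bracket_combination:
  "lie_algebra_bracket A G (\<Sum>i\<in>UNIV. r i *\<^sub>R e i) (\<Sum>i\<in>UNIV. s i *\<^sub>R e i) =
    (\<Sum>i\<in>UNIV. \<Sum>j\<in>UNIV. (r i * s j) *\<^sub>R (\<Sum>k\<in>UNIV. C i j k *\<^sub>R e k))"
proof
  fix f
  show "lie_algebra_bracket A G (\<Sum>i\<in>UNIV. r i *\<^sub>R e i) (\<Sum>i\<in>UNIV. s i *\<^sub>R e i) f =
    (\<Sum>i\<in>UNIV. \<Sum>j\<in>UNIV. (r i * s j) *\<^sub>R (\<Sum>k\<in>UNIV. C i j k *\<^sub>R e k)) f"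
  proof (cases "smooth_at A \<one> f")
    case f: True
    have field: "left_invariant_field G (\<Sum>i\<in>UNIV. r i *\<^sub>R e i) p h = (\<Sum>i\<in>UNIV. r i * E i p h)" for r p h
      by (simp add: left_field_apply sum_apply scaleR_fun_def)
    have deriv: "E i \<one> (\<lambda>q. \<Sum>j\<in>UNIV. s j * E j q f) = (\<Sum>j\<in>UNIV. s j * E i \<one> (\<lambda>q. E j q f))" for i s
    proof -
      have "E i \<one> (\<lambda>q. \<Sum>j\<in>UNIV. s j * E j q f) = (\<Sum>j\<in>UNIV. E i \<one> (\<lambda>q. s j * E j q f))"
        by (intro tangent_sum[OF frame_field_tangent] smooth_at_mult smooth_at_const vector_fields_smooth[OF frame_field f])
      then show ?thesis
        by (simp only: tangent_cmult[OF frame_field_tangent vector_fields_smooth[OF frame_field f]])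
    qed
    have "lie_algebra_bracket A G (\<Sum>i\<in>UNIV. r i *\<^sub>R e i) (\<Sum>i\<in>UNIV. s i *\<^sub>R e i) f =
        (\<Sum>i\<in>UNIV. \<Sum>j\<in>UNIV. r i * s j * E i \<one> (\<lambda>q. E j q f)) - (\<Sum>j\<in>UNIV. \<Sum>i\<in>UNIV. r i * s j * E j \<one> (\<lambda>q. E i q f))"
      using f by (simp add: lie_algebra_bracket_def lie_bracket_def field deriv sum_distrib_left ac_simps)
    also have "(\<Sum>j\<in>UNIV. \<Sum>i\<in>UNIV. r i * s j * E j \<one> (\<lambda>q. E i q f)) = (\<Sum>i\<in>UNIV. \<Sum>j\<in>UNIV. r i * s j * E j \<one> (\<lambda>q. E i q f))"
      by (rule sum.swap)
    also have "(\<Sum>i\<in>UNIV. \<Sum>j\<in>UNIV. r i * s j * E i \<one> (\<lambda>q. E j q f)) - \<dots> =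
        (\<Sum>i\<in>UNIV. \<Sum>j\<in>UNIV. r i * s j * (E i \<one> (\<lambda>q. E j q f) - E j \<one> (\<lambda>q. E i q f)))"
      by (simp add: sum_subtractf right_diff_distrib)
    also have "\<dots> = (\<Sum>i\<in>UNIV. \<Sum>j\<in>UNIV. (r i * s j) *\<^sub>R (\<Sum>k\<in>UNIV. C i j k *\<^sub>R e k)) f"
      unfolding frame_commutator[OF f] by (simp add: sum_apply scaleR_fun_def left_field_one)
    finally show ?thesis .
  next
    case False
    then have "e k f = 0" for k using tangent_nonsmooth[OF frame_tangent] by blast
    then show ?thesis using False by (simp add: lie_algebra_bracket_def lie_bracket_def sum_apply scaleR_fun_def)
  qed
qed

text \<open>The metric and the connection are untouched, so the symmetry space is literally the same
  set, and what is proved in one frame can be read in another.\<close>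

lemma change_frame:
  assumes M: "\<And>i j. (\<Sum>k\<in>UNIV. M i k * M j k) = (if i = j then 1 else 0)"
    and M': "\<And>k l. (\<Sum>i\<in>UNIV. M i k * M i l) = (if k = l then 1 else 0)"
    and C': "\<And>i j m. (\<Sum>k\<in>UNIV. \<Sum>l\<in>UNIV. M i k * M j l * C k l m) = (\<Sum>n\<in>UNIV. C' i j n * M n m)"
  shows "invariant_frame A G g D (\<lambda>i. \<Sum>k\<in>UNIV. M i k *\<^sub>R e k) C'"
proof unfold_locales
  let ?e = "\<lambda>i. \<Sum>k\<in>UNIV. M i k *\<^sub>R e k"
  show "left_invariant_metric A G g" "levi_civita_connection A g D" by (rule metric connection)+
  have "e l \<in> span (range ?e)" for l
  proof -
    have "(\<Sum>i\<in>UNIV. M i l *\<^sub>R ?e i) = (\<Sum>i\<in>UNIV. \<Sum>k\<in>UNIV. (M i k * M i l) *\<^sub>R e k)"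
      by (simp add: scaleR_sum_right mult.commute)
    also have "\<dots> = (\<Sum>k\<in>UNIV. \<Sum>i\<in>UNIV. (M i k * M i l) *\<^sub>R e k)" by (rule sum.swap)
    also have "\<dots> = e l"
      by (simp add: scaleR_sum_left[symmetric] M' if_distrib[of "\<lambda>c. c *\<^sub>R _"] cong: if_cong)
    finally have "e l = (\<Sum>i\<in>UNIV. M i l *\<^sub>R ?e i)" ..
    also have "\<dots> \<in> span (range ?e)" by (intro span_sum span_scale span_base) simp
    finally show ?thesis .
  qed
  then have "span (range e) \<subseteq> span (range ?e)" by (intro span_minimal) auto
  moreover have "span (range ?e) \<subseteq> span (range e)"
  proof (intro span_minimal subspace_span subsetI)
    fix v assume "v \<in> range ?e"
    then obtain i where v: "v = ?e i" by blast
    show "v \<in> span (range e)" unfolding v by (intro span_sum span_scale) (simp add: span_base)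
  qed
  ultimately show "span (range ?e) = tangent_space A \<one>" using span_frame by blast
  show "g \<one> (?e i) (?e j) = (if i = j then 1 else 0)" for i j
    unfolding metric_frame_combination by (rule M)
  show "lie_algebra_bracket A G (?e i) (?e j) = (\<Sum>n\<in>UNIV. C' i j n *\<^sub>R ?e n)" for i j
  proof -
    have "lie_algebra_bracket A G (?e i) (?e j) =
        (\<Sum>k\<in>UNIV. \<Sum>l\<in>UNIV. \<Sum>m\<in>UNIV. (M i k * M j l * C k l m) *\<^sub>R e m)"
      unfolding bracket_combination by (simp add: scaleR_sum_right)
    also have "\<dots> = (\<Sum>k\<in>UNIV. \<Sum>m\<in>UNIV. \<Sum>l\<in>UNIV. (M i k * M j l * C k l m) *\<^sub>R e m)"
      by (rule sum.cong[OF refl]) (rule sum.swap)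
    also have "\<dots> = (\<Sum>m\<in>UNIV. \<Sum>k\<in>UNIV. \<Sum>l\<in>UNIV. (M i k * M j l * C k l m) *\<^sub>R e m)"
      by (rule sum.swap)
    also have "\<dots> = (\<Sum>m\<in>UNIV. (\<Sum>n\<in>UNIV. C' i j n * M n m) *\<^sub>R e m)"
      by (simp add: scaleR_sum_left[symmetric] C')
    also have "\<dots> = (\<Sum>m\<in>UNIV. \<Sum>n\<in>UNIV. (C' i j n * M n m) *\<^sub>R e m)"
      by (simp add: scaleR_sum_left)
    also have "\<dots> = (\<Sum>n\<in>UNIV. \<Sum>m\<in>UNIV. (C' i j n * M n m) *\<^sub>R e m)"
      by (rule sum.swap)
    finally show ?thesis by (simp add: scaleR_sum_right)
  qed
qed

end

context semidirect_frame
begin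

text \<open>The lifted rotation vanishes at the identity, so adding a multiple of it changes the
  covariant derivative there but not the value. This corrects the invariant field of the central
  vector \<open>e 3\<close> and, if \<open>b = 0\<close>, the right-invariant field of
  \<open>e 2\<close>.\<close>

lemma central_direction_symmetry:
  assumes c: "c = 0" and d: "d = 0" and nz: "a \<noteq> 0 \<or> b \<noteq> 0"
  shows "e 3 \<in> symmetry_space A g D \<one> \<and> (b = 0 \<longrightarrow> e 2 \<in> symmetry_space A g D \<one>)"
proof (rule lifted_rotation[OF assms], intro conjI impI)
  fix y1 y2 y3
  assume y:
    "\<And>p. smooth_at A p y1" "\<And>p. smooth_at A p y2" "\<And>p. smooth_at A p y3"
    "\<And>p. E 1 p y1 = 0" "\<And>p. E 2 p y2 = a * y1 p" "\<And>p. E 3 p y3 = 0"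
    "\<And>p. E 1 p y2 + E 2 p y1 = - a * y2 p" "\<And>p. E 1 p y3 + E 3 p y1 = - b * y2 p"
    "\<And>p. E 2 p y3 + E 3 p y2 = b * y1 p"
    "y1 \<one> = 0" "y2 \<one> = 0" "y3 \<one> = 0" "E 2 \<one> y1 = 1" "E 3 \<one> y1 = 0" "E 2 \<one> y3 = 0"
  note ds = deriv_simps smooth_intros y(1-6,10-15) c d adj_smooth adj_derivs adj_first adj_one
  have y': "E 1 p y2 = - a * y2 p - E 2 p y1" "E 1 p y3 = - b * y2 p - E 3 p y1"
    "E 2 p y3 = b * y1 p - E 3 p y2" for p
    using y(7-9)[of p] by simp_all
  \<comment> \<open>The field \<open>E 3\<close> requires \<open>E 2 \<one> x1 = - (b / 2)\<close>
    for parallelism, and the rotation has \<open>E 2 \<one> y1 = 1\<close>.\<close>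
  define t where "t = - b / 2"
  have t: "b / 2 = - t" by (simp add: t_def)
  show "e 3 \<in> symmetry_space A g D \<one>"
    by (rule symmetry_spaceI[of "\<lambda>p. t * y1 p" "\<lambda>p. t * y2 p" "\<lambda>p. 1 + t * y3 p"])
      (intro smooth_intros y | simp add: ds t | simp add: ds y' algebra_simps)+
  show "e 2 \<in> symmetry_space A g D \<one>" if b: "b = 0"
    by (rule symmetry_spaceI[of "\<lambda>p. (- a) * y1 p" "\<lambda>p. adj 2 2 p + (- a) * y2 p" "\<lambda>p. adj 2 3 p + (- a) * y3 p"])
      (intro smooth_intros adj_smooth y | simp add: ds b | simp add: ds y' b algebra_simps)+
qed

end

subsection \<open>The space of parallel directions\<close>

text \<open>Any two loops are freely homotopic, in particular two constant ones; following a base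
  point through such a homotopy gives a path between them.\<close>

lemma simply_connected_UNIV_imp_connected:
  assumes "simply_connected (UNIV :: 'a::topological_space set)"
  shows "connected (UNIV :: 'a set)"
proof (unfold connected_iff_connected_component, intro ballI)
  fix x y :: 'a
  have "homotopic_loops UNIV (\<lambda>_. x) (\<lambda>_. y)"
    using assms unfolding simply_connected_def by (auto simp: path_def pathfinish_def pathstart_def)
  then obtain h :: "real \<times> real \<Rightarrow> 'a" where h: "continuous_on ({0..1} \<times> {0..1}) h"
    and h0: "\<And>t. t \<in> {0..1} \<Longrightarrow> h (0, t) = x" and h1: "\<And>t. t \<in> {0..1} \<Longrightarrow> h (1, t) = y"
    unfolding homotopic_loops by auto
  have "continuous_on {0..1 :: real} (\<lambda>t. h (t, 0))"
    by (rule continuous_on_compose2[OF h]) (auto intro!: continuous_intros)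
  then have "connected ((\<lambda>t. h (t, 0)) ` {0..1 :: real})"
    by (rule connected_continuous_image) simp
  moreover have "x \<in> (\<lambda>t. h (t, 0)) ` {0..1 :: real}" "y \<in> (\<lambda>t. h (t, 0)) ` {0..1 :: real}"
    using h0[of 0] h1[of 0] by (auto intro: image_eqI[of _ _ 0] image_eqI[of _ _ 1])
  ultimately show "connected_component UNIV x y" unfolding connected_component_def by blast
qed

context semidirect_frame
begin

lemma frame_independent:
  assumes "r1 *\<^sub>R e 1 + r2 *\<^sub>R e 2 + r3 *\<^sub>R e 3 = 0"
  shows "r1 = 0" "r2 = 0" "r3 = 0"
proof -
  define r :: "3 \<Rightarrow> real" where "r i = (if i = 1 then r1 else if i = 2 then r2 else r3)" for i
  have "(\<Sum>i\<in>UNIV. r i *\<^sub>R E i \<one>) = 0" using assms by (simp add: sum_3 r_def left_field_one)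
  then have "r i = 0" for i
    using metric_frame_sum[of \<one> r i] metric_zero[OF frame_field_tangent] by simp
  from this[of 1] this[of 2] this[of 3] show "r1 = 0" "r2 = 0" "r3 = 0" by (simp_all add: r_def)
qed

lemma lie_algebra_eq: "lie_algebra A G = span {e 1, e 2, e 3}"
  using span_frame by (simp add: lie_algebra_def UNIV_3 image_insert)

lemma dim_lie_algebra: "dim (lie_algebra A G) = 3"
proof -
  have distinct: "e 1 \<noteq> e 2" "e 1 \<noteq> e 3" "e 2 \<noteq> e 3"
    using frame_independent[of 1 "- 1" 0] frame_independent[of 1 0 "- 1"] frame_independent[of 0 1 "- 1"] by auto
  have "e 1 \<notin> span {e 2, e 3}"
  proof
    assume "e 1 \<in> span {e 2, e 3}"
    then obtain k l where "e 1 - k *\<^sub>R e 2 = l *\<^sub>R e 3"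
      unfolding span_insert[of "e 2"] span_singleton by blast
    then have "1 *\<^sub>R e 1 + (- k) *\<^sub>R e 2 + (- l) *\<^sub>R e 3 = 0" by simp
    from frame_independent(1)[OF this] show False by simp
  qed
  moreover have "e 2 \<notin> span {e 3}"
  proof
    assume "e 2 \<in> span {e 3}"
    then obtain l where "e 2 = l *\<^sub>R e 3" unfolding span_singleton by blast
    then have "0 *\<^sub>R e 1 + 1 *\<^sub>R e 2 + (- l) *\<^sub>R e 3 = 0" by simp
    from frame_independent(2)[OF this] show False by simp
  qed
  moreover have "e 3 \<noteq> 0" using frame_independent(3)[of 0 0 1] by auto
  ultimately have "independent {e 1, e 2, e 3}" using distinct by (simp add: independent_insert)
  then show ?thesis
    unfolding lie_algebra_eq using distinct by (simp add: dim_eq_card_independent)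
qed

lemma symmetry_space_subset: "symmetry_space A g D \<one> \<subseteq> lie_algebra A G"
  unfolding symmetry_space_eq lie_algebra_def
  using frame_sum_tangent[where p = \<one>] by (auto simp: left_field_one)

lemma symmetry_space_whole:
  assumes "e 1 \<in> symmetry_space A g D \<one>" "e 2 \<in> symmetry_space A g D \<one>" "e 3 \<in> symmetry_space A g D \<one>"
  shows "symmetry_space A g D \<one> = lie_algebra A G" "dim (symmetry_space A g D \<one>) = 3"
proof -
  have "lie_algebra A G \<subseteq> symmetry_space A g D \<one>"
    unfolding lie_algebra_eq using assms by (intro span_minimal symmetry_space_subspace) auto
  then show "symmetry_space A g D \<one> = lie_algebra A G"
    using symmetry_space_subset by blast
  then show "dim (symmetry_space A g D \<one>) = 3" by (simp add: dim_lie_algebra)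
qed

lemma symmetry_space_line:
  assumes w: "w \<in> symmetry_space A g D \<one>" "w \<noteq> 0"
    and sub: "\<And>v. v \<in> symmetry_space A g D \<one> \<Longrightarrow> \<exists>r. v = r *\<^sub>R w"
  shows "symmetry_space A g D \<one> = span {w} \<and> dim (symmetry_space A g D \<one>) = 1"
proof -
  have "span {w} \<subseteq> symmetry_space A g D \<one>"
    using w(1) by (intro span_minimal symmetry_space_subspace) auto
  moreover have "symmetry_space A g D \<one> \<subseteq> span {w}"
    using sub by (auto simp: span_singleton)
  ultimately have "symmetry_space A g D \<one> = span {w}" by blast
  moreover have "independent {w}" using w(2) by simp
  from dim_span_eq_card_independent[OF this] have "dim (span {w}) = 1" by simp
  ultimately show ?thesis by simp
qed

end

section \<open>The degenerate loci of a triple\<close>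

locale triple_frame = semidirect_frame A G g D e a b c a
  for A :: "('g::{t2_space,second_countable_topology}, 'e::euclidean_space) atlas"
    and G :: "'g monoid" (structure) and g D and e :: "3 \<Rightarrow> 'g tangent" and a b c +
  assumes a: "a \<ge> 0" and b: "b \<ge> \<bar>c\<bar>"
begin

abbreviation S where "S \<equiv> symmetry_space A g D \<one>"

text \<open>With s = (b + c) / 2 and q = (b - c) / 2 the conditions become a homogeneous linear
  system in the entries of the triple. The case lemmas solve it for the upper bound and match it
  with constructed fields.\<close>

lemma obstruction:
  assumes "v \<in> S"
  shows "\<exists>X Y Z. v = X *\<^sub>R e 1 + Y *\<^sub>R e 2 + Z *\<^sub>R e 3 \<and>
    (b + c) * ((2 * a\<^sup>2 - b\<^sup>2 - b * c) * Y - a * (b - c) * Z) = 0 \<and>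
    (b + c) * (a * (b - c) * Y + (2 * a\<^sup>2 - c\<^sup>2 - b * c) * Z) = 0 \<and>
    (b + c) * (b - c) * X = 0"
proof -
  obtain x where x: "killing_coeffs x" "parallel_coeffs x"
    and v: "v = x 1 \<one> *\<^sub>R e 1 + x 2 \<one> *\<^sub>R e 2 + x 3 \<one> *\<^sub>R e 3"
    using assms by (rule symmetry_spaceE)
  define s q where "s = (b + c) / 2" "q = (b - c) / 2"
  have bc: "b = s + q" "c = s - q" by (simp_all add: s_q_def field_simps)
  have *: "s * ((a\<^sup>2 - s\<^sup>2 - s * q) * x 2 \<one> - a * q * x 3 \<one>) = 0"
    "s * (a * q * x 2 \<one> + (a\<^sup>2 - s\<^sup>2 + s * q) * x 3 \<one>) = 0" "q\<^sup>2 * s * x 1 \<one> = 0"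
    by (rule symmetry_obstruction[OF x refl bc])+
  show ?thesis
  proof (intro exI conjI, rule v)
    show "(b + c) * ((2 * a\<^sup>2 - b\<^sup>2 - b * c) * x 2 \<one> - a * (b - c) * x 3 \<one>) = 0"
      using *(1) bc by algebra
    show "(b + c) * (a * (b - c) * x 2 \<one> + (2 * a\<^sup>2 - c\<^sup>2 - b * c) * x 3 \<one>) = 0"
      using *(2) bc by algebra
    show "(b + c) * (b - c) * x 1 \<one> = 0"
      using *(3) by (auto simp: bc)
  qed
qed

text \<open>The symmetric part of ad e_1 is \<open>a\<close> times the identity on the plane. The
  metric is flat for \<open>a = 0\<close> and has constant curvature -a^2 otherwise.\<close>

lemma symmetry_trace_free:
  assumes "c = - b"
  shows "S = lie_algebra A G \<and> dim S = 3"
proof (cases "a = 0")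
  case True
  have "e 2 \<in> S" "e 3 \<in> S"
    using right_invariant_symmetry[of 0 1 0] right_invariant_symmetry[of 0 0 1] True assms by simp_all
  then show ?thesis using symmetry_space_whole[OF flat_symmetry] True assms by simp
next
  case False
  then have "a > 0" using a by simp
  from symmetry_space_whole[OF hyperbolic_symmetry[OF this refl assms]] show ?thesis by simp
qed

text \<open>For b c = a^2 the matrix is singular and its kernel, spanned by
  \<open>a *\<^sub>R e 2 - b *\<^sub>R e 3\<close>, is central. In a frame whose third vector lies
  in the kernel the constants are 2 a, c - b, 0, 0; if c = b, the second direction is covered as
  well.\<close>

lemma rotated_symmetry:
  assumes bc: "b * c = a\<^sup>2" and b0: "b > 0"
  shows "a *\<^sub>R e 2 - b *\<^sub>R e 3 \<in> S" "c = b \<Longrightarrow> b *\<^sub>R e 2 + a *\<^sub>R e 3 \<in> S"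
proof -
  define r where "r = sqrt (a\<^sup>2 + b\<^sup>2)"
  have r: "r > 0" unfolding r_def using b0 by (simp add: add_nonneg_pos)
  define \<alpha> \<beta> where "\<alpha> = a / r" "\<beta> = b / r"
  have "r\<^sup>2 = a\<^sup>2 + b\<^sup>2" unfolding r_def by simp
  then have "a * a + b * b = r * r" by (simp add: power2_eq_square)
  then have "\<alpha> * \<alpha> + \<beta> * \<beta> = 1"
    using r by (simp add: \<alpha>_\<beta>_def add_divide_distrib[symmetric])
  then have unit: "\<alpha> * \<alpha> + \<beta> * \<beta> = 1" "\<beta> * \<beta> + \<alpha> * \<alpha> = 1" by simp_all
  have ab: "a = r * \<alpha>" "b = r * \<beta>" using r by (simp_all add: \<alpha>_\<beta>_def)
  \<comment> \<open>On the plane this is a symmetric reflection matrix, with rows (b, a) and (a, -b)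
    divided by \<open>r\<close>.\<close>
  define M :: "3 \<Rightarrow> 3 \<Rightarrow> real" where "M i k =
    (if i = 1 then (if k = 1 then 1 else 0)
     else if i = 2 then (if k = 1 then 0 else if k = 2 then \<beta> else \<alpha>)
     else (if k = 1 then 0 else if k = 2 then \<alpha> else - \<beta>))" for i k
  have rel: "b * \<alpha> = a * \<beta>" "c * \<beta> = a * \<alpha>"
  proof -
    show "b * \<alpha> = a * \<beta>" by (simp add: ab)
    have "r * (c * \<beta>) = r * (a * \<alpha>)" using bc ab by algebra
    then show "c * \<beta> = a * \<alpha>" using r by simp
  qed
  have frame: "invariant_frame A G g D (\<lambda>i. \<Sum>k\<in>UNIV. M i k *\<^sub>R e k) (semidirect (2 * a) (c - b) 0 0)"
  proof (rule change_frame)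
    show "(\<Sum>k\<in>UNIV. M i k * M j k) = (if i = j then 1 else 0)" for i j
      using exhaust_3[of i] exhaust_3[of j] unit by (auto simp: sum_3 M_def)
    show "(\<Sum>i\<in>UNIV. M i k * M i l) = (if k = l then 1 else 0)" for k l
      using exhaust_3[of k] exhaust_3[of l] unit by (auto simp: sum_3 M_def)
    show "(\<Sum>k\<in>UNIV. \<Sum>l\<in>UNIV. M i k * M j l * semidirect a b c a k l m) =
        (\<Sum>n\<in>UNIV. semidirect (2 * a) (c - b) 0 0 i j n * M n m)" for i j m
      using exhaust_3[of i] exhaust_3[of j] exhaust_3[of m] rel
      by (auto simp: sum_3 M_def semidirect_def algebra_simps)
  qed
  interpret R: semidirect_frame A G g D "\<lambda>i. \<Sum>k\<in>UNIV. M i k *\<^sub>R e k" "2 * a" "c - b" 0 0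
    unfolding semidirect_frame_def semidirect_frame_axioms_def using frame conn by blast
  have "2 * a \<noteq> 0 \<or> c - b \<noteq> 0" using bc b0 by auto
  from R.central_direction_symmetry[OF refl refl this]
  have "\<alpha> *\<^sub>R e 2 - \<beta> *\<^sub>R e 3 \<in> S" "c = b \<Longrightarrow> \<beta> *\<^sub>R e 2 + \<alpha> *\<^sub>R e 3 \<in> S"
    by (simp_all add: sum_3 M_def)
  then have "r *\<^sub>R (\<alpha> *\<^sub>R e 2 - \<beta> *\<^sub>R e 3) \<in> S" "c = b \<Longrightarrow> r *\<^sub>R (\<beta> *\<^sub>R e 2 + \<alpha> *\<^sub>R e 3) \<in> S"
    by (auto intro: subspace_scale[OF symmetry_space_subspace])
  then show "a *\<^sub>R e 2 - b *\<^sub>R e 3 \<in> S" "c = b \<Longrightarrow> b *\<^sub>R e 2 + a *\<^sub>R e 3 \<in> S"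
    by (simp_all add: ab scaleR_add_right scaleR_diff_right)
qed

text \<open>The hyperbolic plane times a line. The direction \<open>e 1\<close> comes from a
  right-invariant field, and the rotated frame supplies both diagonals of the plane.\<close>

lemma symmetry_product:
  assumes "a > 0" "b = a" "c = a"
  shows "S = lie_algebra A G \<and> dim S = 3"
proof -
  have e1: "e 1 \<in> S" using right_invariant_symmetry[of 1 0 0] assms by simp
  have fz: "a *\<^sub>R e 2 - a *\<^sub>R e 3 \<in> S" "a *\<^sub>R e 2 + a *\<^sub>R e 3 \<in> S"
    using rotated_symmetry assms by (simp_all add: power2_eq_square)
  have *: "x *\<^sub>R (a *\<^sub>R e 2 - a *\<^sub>R e 3) + y *\<^sub>R (a *\<^sub>R e 2 + a *\<^sub>R e 3) \<in> S" for x y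
    by (rule subspace_add[OF symmetry_space_subspace])
      (rule subspace_scale[OF symmetry_space_subspace], rule fz)+
  have "x *\<^sub>R (a *\<^sub>R e 2 - a *\<^sub>R e 3) + y *\<^sub>R (a *\<^sub>R e 2 + a *\<^sub>R e 3) =
      ((x + y) * a) *\<^sub>R e 2 + ((y - x) * a) *\<^sub>R e 3" for x y
    by (simp add: algebra_simps)
  with * have **: "((x + y) * a) *\<^sub>R e 2 + ((y - x) * a) *\<^sub>R e 3 \<in> S" for x y by simp
  define h where "h = 1 / (2 * a)"
  have h: "(h + h) * a = 1" "(h - (- h)) * a = 1" using assms(1) by (simp_all add: h_def field_simps)
  have "((h + h) * a) *\<^sub>R e 2 + ((h - h) * a) *\<^sub>R e 3 \<in> S" "((- h + h) * a) *\<^sub>R e 2 + ((h - (- h)) * a) *\<^sub>R e 3 \<in> S"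
    by (rule **)+
  then have "e 2 \<in> S" "e 3 \<in> S"
    unfolding h diff_self add.left_inverse mult_zero_left scaleR_zero_left scaleR_one add_0_left add_0_right .
  then show ?thesis using symmetry_space_whole[OF e1] by simp
qed

text \<open>A symmetric matrix makes the right-invariant field of \<open>e 1\<close> parallel at the
  identity. The system for the other two components is diagonal, both of its entries being 2 (a^2 -
  b^2).\<close>

lemma symmetry_symmetric:
  assumes "c = b" "b > 0" "a \<noteq> b"
  shows "S = span {e 1} \<and> dim S = 1"
proof (rule symmetry_space_line)
  show "e 1 \<in> S" using right_invariant_symmetry[of 1 0 0] assms by simp
  show "e 1 \<noteq> 0" using frame_independent[of 1 0 0] by auto
  fix v assume "v \<in> S"
  from obstruction[OF this] obtain X Y Z where v: "v = X *\<^sub>R e 1 + Y *\<^sub>R e 2 + Z *\<^sub>R e 3"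
    "(b + c) * ((2 * a\<^sup>2 - b\<^sup>2 - b * c) * Y - a * (b - c) * Z) = 0"
    "(b + c) * (a * (b - c) * Y + (2 * a\<^sup>2 - c\<^sup>2 - b * c) * Z) = 0" by blast
  have "a\<^sup>2 \<noteq> b\<^sup>2" using assms a by (metis abs_of_nonneg less_imp_le power2_eq_iff_nonneg)
  then have "2 * a\<^sup>2 - b\<^sup>2 - b * b \<noteq> 0" by (simp add: power2_eq_square)
  then have "Y = 0" "Z = 0" using v(2,3) assms by auto
  then show "\<exists>r. v = r *\<^sub>R e 1" using v(1) by auto
qed

text \<open>All entries of the symmetric part of the matrix equal \<open>a\<close>, so it
  annihilates \<open>e 2 - e 3\<close>, whose right-invariant field is then parallel at the
  identity.\<close>

lemma symmetry_isotropic: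
  assumes "b + c = 2 * a" "a > 0" "c \<noteq> b"
  shows "S = span {e 2 - e 3} \<and> dim S = 1"
proof (rule symmetry_space_line)
  show "e 2 - e 3 \<in> S" using right_invariant_symmetry[of 0 1 "- 1"] assms by simp
  show "e 2 - e 3 \<noteq> 0" using frame_independent[of 0 1 "- 1"] by auto
  fix v assume "v \<in> S"
  from obstruction[OF this] obtain X Y Z where v: "v = X *\<^sub>R e 1 + Y *\<^sub>R e 2 + Z *\<^sub>R e 3"
    "(b + c) * ((2 * a\<^sup>2 - b\<^sup>2 - b * c) * Y - a * (b - c) * Z) = 0"
    "(b + c) * (b - c) * X = 0" by blast
  have "X = 0" using v(3) assms by simp
  have b: "b = 2 * a - c" using assms(1) by simp
  have "(b - c) * a * (b + c) * (Y + Z) = 0" using v(2) b by algebra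
  then have "Z = - Y" using assms by simp
  then show "\<exists>r. v = r *\<^sub>R (e 2 - e 3)" using v(1) \<open>X = 0\<close>
    by (intro exI[of _ Y]) (simp add: scaleR_diff_right)
qed

text \<open>The central direction is attained by \<open>rotated_symmetry\<close>, and for
  \<open>c \<noteq> b\<close> the obstruction leaves no other. At \<open>a = 0\<close> this is the
  Heisenberg group.\<close>

lemma symmetry_central:
  assumes "b * c = a\<^sup>2" "b > 0" "c \<noteq> b"
  shows "S = span {a *\<^sub>R e 2 - b *\<^sub>R e 3} \<and> dim S = 1"
proof (rule symmetry_space_line)
  have "c \<ge> 0" using assms(1,2) by (metis zero_le_mult_iff not_less zero_le_power2)
  show "a *\<^sub>R e 2 - b *\<^sub>R e 3 \<in> S" using rotated_symmetry assms by blast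
  show "a *\<^sub>R e 2 - b *\<^sub>R e 3 \<noteq> 0" using frame_independent[of 0 a "- b"] assms(2) by auto
  fix v assume "v \<in> S"
  from obstruction[OF this] obtain X Y Z where v: "v = X *\<^sub>R e 1 + Y *\<^sub>R e 2 + Z *\<^sub>R e 3"
    "(b + c) * ((2 * a\<^sup>2 - b\<^sup>2 - b * c) * Y - a * (b - c) * Z) = 0"
    "(b + c) * (b - c) * X = 0" by blast
  have bc: "b + c \<noteq> 0" using assms(2) \<open>c \<ge> 0\<close> by simp
  have "X = 0" using v(3) assms bc by simp
  have "(b + c) * (c - b) * (b * Y + a * Z) = 0" using v(2) assms(1) by algebra
  then have "b * Y + a * Z = 0" using bc assms(3) by simp
  then have "Y = - (a * Z) / b" using assms(2) by (simp add: field_simps)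
  then show "\<exists>r. v = r *\<^sub>R (a *\<^sub>R e 2 - b *\<^sub>R e 3)" using v(1) \<open>X = 0\<close> assms(2)
    by (intro exI[of _ "- Z / b"]) (simp add: scaleR_diff_right)
qed

lemma symmetry_generic:
  assumes "b + c \<noteq> 0" "c \<noteq> b" "b + c \<noteq> 2 * a" "b * c \<noteq> a\<^sup>2"
  shows "dim S = 0"
proof -
  have "v = 0" if "v \<in> S" for v
  proof -
    from obstruction[OF that] obtain X Y Z where v: "v = X *\<^sub>R e 1 + Y *\<^sub>R e 2 + Z *\<^sub>R e 3"
      "(b + c) * ((2 * a\<^sup>2 - b\<^sup>2 - b * c) * Y - a * (b - c) * Z) = 0"
      "(b + c) * (a * (b - c) * Y + (2 * a\<^sup>2 - c\<^sup>2 - b * c) * Z) = 0"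
      "(b + c) * (b - c) * X = 0" by blast
    have "X = 0" using v(4) assms by simp
    have eqs: "(2 * a\<^sup>2 - b\<^sup>2 - b * c) * Y - a * (b - c) * Z = 0"
      "a * (b - c) * Y + (2 * a\<^sup>2 - c\<^sup>2 - b * c) * Z = 0" using v(2,3) assms(1) by simp_all
    \<comment> \<open>The determinant of the system \<open>eqs\<close>, in factored form; its
      vanishing marks the loci b + c = 2 a and b c = a^2.\<close>
    define \<Delta> where "\<Delta> = (2 * a - b - c) * (2 * a + b + c) * (a\<^sup>2 - b * c)"
    have "2 * a + b + c \<noteq> 0" using assms(1) a b by simp
    then have "\<Delta> \<noteq> 0" using assms by (simp add: \<Delta>_def)
    moreover have "\<Delta> * Y = 0" "\<Delta> * Z = 0" unfolding \<Delta>_def using eqs by algebra+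
    ultimately show "v = 0" using v(1) \<open>X = 0\<close> by simp
  qed
  then have "S \<subseteq> {0}" by blast
  then have "S = {0}" using subspace_0[OF symmetry_space_subspace] by blast
  then have "S = span {}" by simp
  then show ?thesis using dim_span_eq_card_independent[OF independent_empty] by (simp only: card.empty)
qed

end

section \<open>The thirteen cases distributed over the degenerate loci\<close>

theorem mainTheorem1:
  fixes G :: "'g::{t2_space,second_countable_topology} monoid"
    and A :: "('g, real ^ 3) atlas"
    and g :: "'g \<Rightarrow> 'g tangent \<Rightarrow> 'g tangent \<Rightarrow> real"
    and D :: "('g \<Rightarrow> 'g tangent) \<Rightarrow> ('g \<Rightarrow> 'g tangent) \<Rightarrow> 'g \<Rightarrow> 'g tangent"
    and e1 e2 e3 :: "'g tangent"
    and a b c :: real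
  assumes "a \<ge> 0" and "b \<ge> \<bar>c\<bar>"
    and "lie_group A G"
    and "simply_connected (UNIV :: 'g set)"
    and "left_invariant_metric A G g"
    and "levi_civita_connection A g D"
    and "has_triple A G g e1 e2 e3 a b c"
  shows
    "let S = symmetry_space A g D \<one>\<^bsub>G\<^esub>;
         i = dim S;
         \<gg> = lie_algebra A G;
         K = b * c / a\<^sup>2;
         case1 = (a > 0 \<and> b > 0 \<and> K > 1 \<and> c = b);
         case2 = (a > 0 \<and> b > 0 \<and> K = 1 \<and> c = b);
         case3 = (a > 0 \<and> b > 0 \<and> K = 1 \<and> b \<noteq> c);
         case4 = (a > 0 \<and> b > 0 \<and> 0 < K \<and> K < 1 \<and> c = b);
         case5 = (a > 0 \<and> b > 0 \<and> 0 < K \<and> K < 1 \<and>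
                  b = a + a * sqrt (1 - K) \<and> c = a - a * sqrt (1 - K));
         case6 = (a > 0 \<and> b > 0 \<and> K = 0 \<and> b = 2 * a \<and> c = 0);
         case7 = (a > 0 \<and> b > 0 \<and> K < 0 \<and> c = - b);
         case8 = (a > 0 \<and> b > 0 \<and> K < 0 \<and>
                  b = a + a * sqrt (1 - K) \<and> c = a - a * sqrt (1 - K));
         case9 = (a > 0 \<and> b = 0 \<and> c = 0);
         case10 = (a = 0 \<and> b > 0 \<and> c = b);
         case11 = (a = 0 \<and> b > 0 \<and> c = 0);
         case12 = (a = 0 \<and> b > 0 \<and> c = - b);
         case13 = (a = 0 \<and> b = 0 \<and> c = 0)
     in (case1 \<longrightarrow> S = span {e1} \<and> i = 1) \<and>
        (case2 \<longrightarrow> b = a \<and> S = \<gg> \<and> i = 3) \<and>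
        (case3 \<longrightarrow> b * c = a\<^sup>2 \<and>
           (let s = (a\<^sup>2 + b\<^sup>2) / (2 * b);
                d = a\<^sup>2 - s\<^sup>2;
                \<alpha>2 = (- (a * b) + a * s) / d;
                \<alpha>3 = (- a\<^sup>2 + b * s) / d
            in d \<noteq> 0 \<and> S = span {\<alpha>2 *\<^sub>R e2 + \<alpha>3 *\<^sub>R e3} \<and> i = 1)) \<and>
        (case4 \<longrightarrow> S = span {e1} \<and> i = 1) \<and>
        (case5 \<longrightarrow> S = span {e2 - e3} \<and> i = 1) \<and>
        (case6 \<longrightarrow> S = span {e2 - e3} \<and> i = 1) \<and>
        (case7 \<longrightarrow> S = \<gg> \<and> i = 3) \<and>
        (case8 \<longrightarrow> S = span {e2 - e3} \<and> i = 1) \<and>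
        (case9 \<longrightarrow> S = \<gg> \<and> i = 3) \<and>
        (case10 \<longrightarrow> S = span {e1} \<and> i = 1) \<and>
        (case11 \<longrightarrow> S = span {e3} \<and> i = 1) \<and>
        (case12 \<longrightarrow> S = \<gg> \<and> i = 3) \<and>
        (case13 \<longrightarrow> S = \<gg> \<and> i = 3) \<and>
        (\<not> (case1 \<or> case2 \<or> case3 \<or> case4 \<or> case5 \<or> case6 \<or> case7 \<or> case8 \<or> case9 \<or>
            case10 \<or> case11 \<or> case12 \<or> case13) \<longrightarrow> i = 0)"
proof -
  define e :: "3 \<Rightarrow> 'g tangent" where "e i = (if i = 1 then e1 else if i = 2 then e2 else e3)" for i
  have e: "e 1 = e1" "e 2 = e2" "e 3 = e3" by (simp_all add: e_def)
  have conn: "connected (UNIV :: 'g set)"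
    using assms(4) by (rule simply_connected_UNIV_imp_connected)
  interpret lie_group_manifold A G
    using assms(3) by unfold_locales (auto simp: lie_group_def)
  have bracket: "lie_algebra_bracket A G e1 e2 = a *\<^sub>R e2 + b *\<^sub>R e3"
    "lie_algebra_bracket A G e1 e3 = c *\<^sub>R e2 + a *\<^sub>R e3" "lie_algebra_bracket A G e2 e3 = 0"
    and onb: "orthonormal_basis (lie_algebra A G) (g \<one>\<^bsub>G\<^esub>) e1 e2 e3"
    using assms(7) by (auto simp: has_triple_def)
  have antisym: "lie_algebra_bracket A G u v = - lie_algebra_bracket A G v u" for u v
    by (rule ext) (simp add: lie_algebra_bracket_def lie_bracket_def)
  have self: "lie_algebra_bracket A G u u = 0" for u
    by (rule ext) (simp add: lie_algebra_bracket_def lie_bracket_def)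
  have in_span: "e1 \<in> tangent_space A \<one>\<^bsub>G\<^esub>" "e2 \<in> tangent_space A \<one>\<^bsub>G\<^esub>" "e3 \<in> tangent_space A \<one>\<^bsub>G\<^esub>"
    using onb unfolding orthonormal_basis_def lie_algebra_def by (auto intro: span_base)
  \<comment> \<open>\<open>orthonormal_basis\<close> lists each mixed inner product in one order
    only.\<close>
  have sym: "g \<one>\<^bsub>G\<^esub> u v = g \<one>\<^bsub>G\<^esub> v u" if "u \<in> tangent_space A \<one>\<^bsub>G\<^esub>" "v \<in> tangent_space A \<one>\<^bsub>G\<^esub>" for u v
    using assms(5) that unfolding left_invariant_metric_def riemannian_metric_def by blast
  interpret T: triple_frame A G g D e a b c
  proof unfold_locales
    show "left_invariant_metric A G g" "levi_civita_connection A g D" "a \<ge> 0" "\<bar>c\<bar> \<le> b"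
      "connected (UNIV :: 'g set)" by (rule assms conn)+
    show "span (range e) = tangent_space A \<one>\<^bsub>G\<^esub>"
      using onb by (simp add: orthonormal_basis_def lie_algebra_def UNIV_3 e)
    show "g \<one>\<^bsub>G\<^esub> (e i) (e j) = (if i = j then 1 else 0)" for i j
      using exhaust_3[of i] exhaust_3[of j] onb sym in_span
      by (auto simp: orthonormal_basis_def e)
    show "lie_algebra_bracket A G (e i) (e j) = (\<Sum>k\<in>UNIV. semidirect a b c a i j k *\<^sub>R e k)" for i j
      using exhaust_3[of i] exhaust_3[of j] bracket antisym[of e2 e1] antisym[of e3 e1] antisym[of e3 e2] self
      by (auto simp: sum_3 semidirect_def e)
  qed
  define S where "S = symmetry_space A g D \<one>\<^bsub>G\<^esub>"
  note classification = T.symmetry_trace_free T.symmetry_product T.symmetry_symmetric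
    T.symmetry_isotropic T.symmetry_central T.symmetry_generic
  note trace_free = classification(1)[unfolded e S_def[symmetric]]
    and product = classification(2)[unfolded e S_def[symmetric]]
    and symmetric = classification(3)[unfolded e S_def[symmetric]]
    and isotropic = classification(4)[unfolded e S_def[symmetric]]
    and central = classification(5)[unfolded e S_def[symmetric]]
    and generic = classification(6)[unfolded S_def[symmetric]]
  \<comment> \<open>For \<open>a = 0\<close> the quotient is 0 by convention; every listed case that
    mentions \<open>K\<close> also demands \<open>a > 0\<close>.\<close>
  define K where "K = b * c / a\<^sup>2"
  have aK: "b * c = K * a\<^sup>2" if "a > 0" using that by (simp add: K_def)
  \<comment> \<open>Here b and c are the roots of x^2 - 2 a x + K a^2, and \<open>b > c\<close>
    decides the signs. The discriminant condition K < 1 comes along.\<close>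
  have KaK: "b = a + a * sqrt (1 - K) \<and> c = a - a * sqrt (1 - K) \<and> K < 1"
    if "b + c = 2 * a" "a > 0" "c \<noteq> b"
  proof -
    have "b > c" using that(3) assms(2) by simp
    then have t: "b - a > 0" using that(1) by simp
    have c: "c = 2 * a - b" using that(1) by simp
    have "1 - K = (a\<^sup>2 - b * c) / a\<^sup>2" using that(2) by (simp add: K_def field_simps)
    also have "a\<^sup>2 - b * c = (b - a)\<^sup>2" unfolding c by (simp add: power2_eq_square algebra_simps)
    finally have K: "1 - K = ((b - a) / a)\<^sup>2" by (simp add: power_divide)
    then have "sqrt (1 - K) = (b - a) / a" using t that(2) by simp
    moreover have "1 - K > 0" unfolding K using t that(2) by simp
    ultimately show ?thesis using that(2) c by simp
  qed
  have isotropic_case: "S = span {e2 - e3} \<and> dim S = 1"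
    if "a > 0" "K < 1" "b = a + a * sqrt (1 - K)" "c = a - a * sqrt (1 - K)"
  proof (rule isotropic)
    show "b + c = 2 * a" by (subst that(3), subst that(4)) simp
    have "a * sqrt (1 - K) > 0" using that(1,2) by simp
    then show "c \<noteq> b" using that(3,4) by linarith
  qed (rule that)
  have c1: "a > 0 \<and> b > 0 \<and> K > 1 \<and> c = b \<longrightarrow> S = span {e1} \<and> dim S = 1"
  proof
    assume *: "a > 0 \<and> b > 0 \<and> K > 1 \<and> c = b"
    then have "a \<noteq> b" by (auto simp: K_def power2_eq_square)
    with * symmetric show "S = span {e1} \<and> dim S = 1" by blast
  qed
  have c2: "a > 0 \<and> b > 0 \<and> K = 1 \<and> c = b \<longrightarrow> b = a \<and> S = lie_algebra A G \<and> dim S = 3"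
  proof
    assume *: "a > 0 \<and> b > 0 \<and> K = 1 \<and> c = b"
    then have "b\<^sup>2 = a\<^sup>2" using aK by (simp add: power2_eq_square)
    then have "b = a" using * by simp
    with * product show "b = a \<and> S = lie_algebra A G \<and> dim S = 3" by blast
  qed
  have c3: "a > 0 \<and> b > 0 \<and> K = 1 \<and> b \<noteq> c \<longrightarrow>
    b * c = a\<^sup>2 \<and> a\<^sup>2 - ((a\<^sup>2 + b\<^sup>2) / (2 * b))\<^sup>2 \<noteq> 0 \<and>
    S = span {((- (a * b) + a * ((a\<^sup>2 + b\<^sup>2) / (2 * b))) / (a\<^sup>2 - ((a\<^sup>2 + b\<^sup>2) / (2 * b))\<^sup>2)) *\<^sub>R e2 +
      ((- a\<^sup>2 + b * ((a\<^sup>2 + b\<^sup>2) / (2 * b))) / (a\<^sup>2 - ((a\<^sup>2 + b\<^sup>2) / (2 * b))\<^sup>2)) *\<^sub>R e3} \<and> dim S = 1"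
  proof
    assume *: "a > 0 \<and> b > 0 \<and> K = 1 \<and> b \<noteq> c"
    then have bc: "b * c = a\<^sup>2" using aK by simp
    \<comment> \<open>Inserting b c = a^2 gives s = (b + c) / 2 and D = -q^2, with numerators -a q
      and b q. The prescribed vector is thus 1 / q times the central vector
      \<open>a *\<^sub>R e2 - b *\<^sub>R e3\<close>.\<close>
    define q where "q = (b - c) / 2"
    have q: "q \<noteq> 0" using * by (simp add: q_def)
    have s: "(a\<^sup>2 + b\<^sup>2) / (2 * b) = (b + c) / 2"
      unfolding bc[symmetric] using * by (simp add: field_simps power2_eq_square)
    have d: "a\<^sup>2 - ((b + c) / 2)\<^sup>2 = - (q * q)"
      unfolding bc[symmetric] q_def by (simp add: field_simps power2_eq_square)
    have n: "- (a * b) + a * ((b + c) / 2) = - (a * q)" "- a\<^sup>2 + b * ((b + c) / 2) = b * q"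
      unfolding bc[symmetric] q_def by (simp_all add: field_simps)
    have "(- (a * q) / - (q * q)) *\<^sub>R e2 + (b * q / - (q * q)) *\<^sub>R e3 = (1 / q) *\<^sub>R (a *\<^sub>R e2 - b *\<^sub>R e3)"
      using q by (simp add: scaleR_diff_right)
    moreover have "span {(1 / q) *\<^sub>R w} = span {w}" for w :: "'g tangent"
    proof (rule span_eq[THEN iffD2], intro conjI)
      show "{(1 / q) *\<^sub>R w} \<subseteq> span {w}" by (simp add: span_scale span_base)
      have "q *\<^sub>R (1 / q) *\<^sub>R w \<in> span {(1 / q) *\<^sub>R w}" by (intro span_scale span_base) simp
      then show "{w} \<subseteq> span {(1 / q) *\<^sub>R w}" using q by simp
    qed
    ultimately show "b * c = a\<^sup>2 \<and> a\<^sup>2 - ((a\<^sup>2 + b\<^sup>2) / (2 * b))\<^sup>2 \<noteq> 0 \<and>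
      S = span {((- (a * b) + a * ((a\<^sup>2 + b\<^sup>2) / (2 * b))) / (a\<^sup>2 - ((a\<^sup>2 + b\<^sup>2) / (2 * b))\<^sup>2)) *\<^sub>R e2 +
        ((- a\<^sup>2 + b * ((a\<^sup>2 + b\<^sup>2) / (2 * b))) / (a\<^sup>2 - ((a\<^sup>2 + b\<^sup>2) / (2 * b))\<^sup>2)) *\<^sub>R e3} \<and> dim S = 1"
      unfolding s d n using central[OF bc] * q bc by (simp only: simp_thms) auto
  qed
  have c4: "a > 0 \<and> b > 0 \<and> 0 < K \<and> K < 1 \<and> c = b \<longrightarrow> S = span {e1} \<and> dim S = 1"
  proof
    assume *: "a > 0 \<and> b > 0 \<and> 0 < K \<and> K < 1 \<and> c = b"
    then have "a \<noteq> b" by (auto simp: K_def power2_eq_square)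
    with * symmetric show "S = span {e1} \<and> dim S = 1" by blast
  qed
  have c5: "a > 0 \<and> b > 0 \<and> 0 < K \<and> K < 1 \<and> b = a + a * sqrt (1 - K) \<and> c = a - a * sqrt (1 - K) \<longrightarrow>
      S = span {e2 - e3} \<and> dim S = 1" using isotropic_case by blast
  have c6: "a > 0 \<and> b > 0 \<and> K = 0 \<and> b = 2 * a \<and> c = 0 \<longrightarrow> S = span {e2 - e3} \<and> dim S = 1"
    by (rule impI, rule isotropic) simp_all
  have c7: "a > 0 \<and> b > 0 \<and> K < 0 \<and> c = - b \<longrightarrow> S = lie_algebra A G \<and> dim S = 3"
    using trace_free by blast
  have c8: "a > 0 \<and> b > 0 \<and> K < 0 \<and> b = a + a * sqrt (1 - K) \<and> c = a - a * sqrt (1 - K) \<longrightarrow>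
      S = span {e2 - e3} \<and> dim S = 1" using isotropic_case by force
  have c9: "a > 0 \<and> b = 0 \<and> c = 0 \<longrightarrow> S = lie_algebra A G \<and> dim S = 3"
    by (rule impI, rule trace_free) simp_all
  have c10: "a = 0 \<and> b > 0 \<and> c = b \<longrightarrow> S = span {e1} \<and> dim S = 1"
    by (rule impI, rule symmetric) simp_all
  have c11: "a = 0 \<and> b > 0 \<and> c = 0 \<longrightarrow> S = span {e3} \<and> dim S = 1"
  proof
    \<comment> \<open>An instance of b c = a^2, where the central vector degenerates to a multiple
      of \<open>e3\<close>.\<close>
    assume *: "a = 0 \<and> b > 0 \<and> c = 0"
    have "S = span {a *\<^sub>R e2 - b *\<^sub>R e3} \<and> dim S = 1"
      by (rule central) (use * in simp_all)
    moreover have "span {a *\<^sub>R e2 - b *\<^sub>R e3} = span {e3}"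
    proof (rule span_eq[THEN iffD2], intro conjI)
      show "{a *\<^sub>R e2 - b *\<^sub>R e3} \<subseteq> span {e3}" using * by (simp add: span_neg span_scale span_base)
      have "(- 1 / b) *\<^sub>R (a *\<^sub>R e2 - b *\<^sub>R e3) \<in> span {a *\<^sub>R e2 - b *\<^sub>R e3}"
        by (intro span_scale span_base) simp
      moreover have "(- 1 / b) *\<^sub>R (a *\<^sub>R e2 - b *\<^sub>R e3) = e3" using * by simp
      ultimately show "{e3} \<subseteq> span {a *\<^sub>R e2 - b *\<^sub>R e3}" by (simp only: insert_subset empty_subsetI simp_thms)
    qed
    ultimately show "S = span {e3} \<and> dim S = 1" by metis
  qed
  have c12: "a = 0 \<and> b > 0 \<and> c = - b \<longrightarrow> S = lie_algebra A G \<and> dim S = 3"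
    using trace_free by blast
  have c13: "a = 0 \<and> b = 0 \<and> c = 0 \<longrightarrow> S = lie_algebra A G \<and> dim S = 3"
    by (rule impI, rule trace_free) simp_all
  let ?cases = "(a > 0 \<and> b > 0 \<and> K > 1 \<and> c = b) \<or> (a > 0 \<and> b > 0 \<and> K = 1 \<and> c = b) \<or>
      (a > 0 \<and> b > 0 \<and> K = 1 \<and> b \<noteq> c) \<or> (a > 0 \<and> b > 0 \<and> 0 < K \<and> K < 1 \<and> c = b) \<or>
      (a > 0 \<and> b > 0 \<and> 0 < K \<and> K < 1 \<and> b = a + a * sqrt (1 - K) \<and> c = a - a * sqrt (1 - K)) \<or>
      (a > 0 \<and> b > 0 \<and> K = 0 \<and> b = 2 * a \<and> c = 0) \<or> (a > 0 \<and> b > 0 \<and> K < 0 \<and> c = - b) \<or>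
      (a > 0 \<and> b > 0 \<and> K < 0 \<and> b = a + a * sqrt (1 - K) \<and> c = a - a * sqrt (1 - K)) \<or>
      (a > 0 \<and> b = 0 \<and> c = 0) \<or> (a = 0 \<and> b > 0 \<and> c = b) \<or> (a = 0 \<and> b > 0 \<and> c = 0) \<or>
      (a = 0 \<and> b > 0 \<and> c = - b) \<or> (a = 0 \<and> b = 0 \<and> c = 0)"
  have c14: "\<not> ?cases \<longrightarrow> dim S = 0"
  proof
    \<comment> \<open>A triple violating any of the four inequalities of \<open>generic\<close> lies
      in a listed case. Positivity of \<open>b\<close> follows from the first inequality and is used
      for the others.\<close>
    assume none: "\<not> ?cases"
    have a: "a = 0 \<or> a > 0" using assms(1) by auto
    have Kpos: "K > 0" if "a > 0" "b * c > 0" using that by (simp add: K_def)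
    have Kneg: "K < 0" if "a > 0" "b * c < 0" using that by (simp add: K_def divide_neg_pos)
    have 1: "b + c \<noteq> 0"
    proof
      assume "b + c = 0"
      then have c: "c = - b" by simp
      have "b = 0 \<or> b > 0" using assms(2) by auto
      moreover have "b > 0 \<Longrightarrow> a > 0 \<Longrightarrow> K < 0" using Kneg c by simp
      moreover have "b = 0 \<Longrightarrow> c = 0" using c by simp
      ultimately show False using none a c by argo
    qed
    then have b: "b > 0" using assms(2) by auto
    have 2: "c \<noteq> b"
    proof
      assume c: "c = b"
      then have "a > 0 \<Longrightarrow> K > 0" using Kpos b by simp
      then show False using none a b c by argo
    qed
    have 3: "b + c \<noteq> 2 * a"
    proof
      assume bc: "b + c = 2 * a"
      then have "a > 0" using a 1 by auto
      moreover from KaK[OF bc this 2] have "b = a + a * sqrt (1 - K) \<and> c = a - a * sqrt (1 - K) \<and> K < 1" .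
      moreover have "c = 0 \<and> b = 2 * a" if "K = 0" using that b bc \<open>a > 0\<close> by (simp add: K_def)
      ultimately show False using none b by argo
    qed
    have 4: "b * c \<noteq> a\<^sup>2"
    proof
      assume bc: "b * c = a\<^sup>2"
      have "K = 1" if "a > 0" using that bc by (simp add: K_def)
      moreover have "c = 0" if "a = 0" using that bc b by simp
      ultimately show False using none a b 2 by argo
    qed
    show "dim S = 0" by (rule generic[OF 1 2 3 4])
  qed
  show ?thesis
    unfolding Let_def S_def[symmetric] K_def[symmetric]
    by (intro conjI c1 c2 c3 c4 c5 c6 c7 c8 c9 c10 c11 c12 c13 c14)
qed

end
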